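(* In the setting of a vector field $G\in\mathcal U$ with a strongly dissipative geometric Lorenz attractor, let $V$ be the nonempty open set, contained in an unstable curve, on which the function $g=D(\cdot,p')$ restricts to a $C^1$ diffeomorphism onto its image, let $F^*:Y^*\to Y^*$ be a full-branch inducing scheme with $Y^*$ connected and $Y^*\subset\bigcup_{v\in V}W^s_f(v)$, with partition $\alpha^*$, and let $a_1,a_2\in\alpha^*$ be two partition elements. For the finite subsystem $$A_0=\bigcap_{n\ge0}(F^* )^{-n}(a_1\cup a_2),$$ the set $D(A_0\times A_0)\subset\mathbb R$ of values of the temporal distortion function has positive lower box dimension.
   Context: Geometric Lorenz setting. $G$ is a $C^\infty$ vector field on $\mathbb R^3$ with flow $Z_t$ and equilibrium at $0$ whose eigenvalues are real with $\lambda_{ss}<\lambda_s<0<-\lambda_s<\lambda_u$; for some $\epsilon>0$ the flow is $C^{1+\epsilon}$ linearizable near $0$ on a set containing $[-1,1]^3$ in coordinates $x_1,x_2,x_3$ along the eigenspaces of $\lambda_u,\lambda_{ss},\lambda_s$. $X=\{(x_1,x_2,1):|x_1|,|x_2|\le1\}$, $f=Z_{r}$ is the Poincaré map to $X$ (off $\{x_1=0\}$), $r$ the first return time. There is a $C^{1+\epsilon}$ $f$-invariant foliation $\mathcal W^s_f$ of a compact neighborhood of $(0,0,1)$ in $X$ by $C^\infty$ curves (stable leaves $W^s_f(x)$, including $\{x_1=0\}$) with $|f^nx-f^nx'|\le C\lambda_0^n$ on leaves ($\lambda_0<1$); each leaf meets $\bar X=\{(x_1,0,1):|x_1|\le1\}\cong[-1,1]$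 in one point, $\pi$ is the projection along leaves to $\bar X$, $\bar f(x_1)=\pi f(x_1,0,1)$. $\bar f$ is uniformly expanding ($|(\bar f^n)'|\ge c\lambda_1^n$, $\lambda_1>1$) and locally eventually onto (for open $V'\subset\bar X\setminus\{0\}$ some $\bar f^kV'\supset(0,1)$). $U=\bigcup_{x\in X}Z_{[0,r(x)]}(x)$, $\Lambda=\bigcap_{t>0}Z_t(U)$. Strong dissipativity: $\operatorname{div}G\le-\delta<0$ on $U$ and $\lambda_u+\lambda_{ss}<\lambda_s$. $\mathcal U$ is the set of such $G$. The flow then has a $C^{1+\epsilon}$ one-dimensional exponentially contracting invariant strong stable foliation $\mathcal F^{ss}$ of $U$, and $X$ is replaced by the union of the leaves of $\mathcal F^{ss}$ through $\bar X$; so $W^s_f(x)$ is the $\mathcal F^{ss}$-leaf and $r$ is constant on stable leaves, $C^{1+\epsilon}$ with a logarithmic singularity at $\{x_1=0\}$. $f$ is invertible on the attractor. Inducing schemes. $\bar Y\subset\bar X$ is an open interval, $\tau:\bar Y\to\mathbb Z^+$, and $\bar F=\bar f^\tau:\bar Y\to\bar Y$ is $C^{1+\epsilon}$ piecewise expanding with a countable partition $\alpha_0$ (mod $0$), each $a\in\alpha_0$ being mapped diffeomorphically onto $\bar Y$ ("full branch"). There are $c_0>0,\lambda\in(0,1)$ such that, with $\tau_n=\sum_{j<n}\tau\circ\bar F^j$ and $y,y'$ in the same $n$-cylinder: $|\bar f^iy'-\bar f^iy|\le c_0\lambda^{\tau_n(y)-i}|\bar F^ny'-\bar F^ny|$ and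 $|\bar f^iy|\ge\lambda^{(\tau_n(y)-i)/2}$ for $0\le i<\tau_n(y)$, and $|D\bar F^n(y)/D\bar F^n(y')-1|\le c_0|\bar F^ny-\bar F^ny'|$. By local eventual onto-ness $\bar Y$ may be chosen to be an arbitrarily small interval around any given point. $Y=\bigcup_{y\in\bar Y}W^s_f(y)$, $\tau(y)=\tau(\pi y)$, $F(y)=f^{\tau(y)}(y)$, $\alpha=\{\bigcup_{x\in a}W^s_f(x):a\in\alpha_0\}$; $\mu_Y$ is the $F$-invariant probability projecting to the absolutely continuous $\bar F$-invariant probability. For $\mu_Y$-a.e. $y$ there is a local unstable manifold $W^u_F(y)$ (a $C^{1+\epsilon}$ curve of points of the attractor whose backward $f$-orbits converge exponentially to that of $y$) with $\pi(W^u_F(y))=\bar Y$, and $[y,z]$ denotes the unique point of $W^u_F(y)\cap W^s_f(z)$. Temporal distortion function. For $y,z$ in the same unstable manifold, $D_0(y,z)=\sum_{j\ge1}[r(f^{-j}y)-r(f^{-j}z)]$, and $D(y,z)=D_0(y,[y,z])+D_0(z,[z,y])$ (where defined). $D$ is defined in terms of $r$ and $f$ and does not depend on the choice of inducing scheme; $D(A_0\times A_0)$ is the set of its values at pairs in $A_0\times A_0$ at which it is defined. The set $V$. Start from the inducing scheme on $Y=Y_0\cup Y_1$, the union of two full-branch schemes over disjoint open intervals $\bar Y_0\ni0$, $\bar Y_1\ni y_1:=\lim_{x\to0^+}\bar f^2(x)$. There are $\ell\ge0$ and points $y,y'$ in the same $Y_i$ with $\tau(y),\tau(y')>\ell$,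 each lying in the unstable manifold of a periodic point of $F$, such that, for $p=f^\ell y$, $p'=f^\ell y'$, with unstable curves $W^u(p)=f^\ell W^u_F(y)$, $W^u(p')=f^\ell W^u_F(y')$ and $[f^\ell a,f^\ell b]:=f^\ell[a,b]$, $D(p,p')\ne0$. The map $g:W^u(p)\to\mathbb R$, $g(q)=D(q,p')=D_0(q,[q,p'])+D_0(p',[p',q])$, is $C^1$, and $V\subset W^u(p)$ is a nonempty open set on which $g$ restricts to a $C^1$ diffeomorphism onto its image. *)

theory Defs
  imports "HOL-Analysis.Analysis"
begin

section \<open>Regularity classes\<close>

text \<open>\<open>Ck_on k h S\<close>, for open \<open>S\<close> in a finite-dimensional space: \<open>h\<close> is \<open>k\<close> times continuously
  differentiable on \<open>S\<close> (all iterated directional derivatives exist and are continuous).\<close>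

primrec Ck_on :: "nat \<Rightarrow> ('a::real_normed_vector \<Rightarrow> 'b::real_normed_vector) \<Rightarrow> 'a set \<Rightarrow> bool" where
  "Ck_on 0 h S \<longleftrightarrow> continuous_on S h"
| "Ck_on (Suc k) h S \<longleftrightarrow> (\<forall>x\<in>S. h differentiable (at x)) \<and>
     (\<forall>v. Ck_on k (\<lambda>x. frechet_derivative h (at x) v) S)"

definition smooth_on :: "('a::real_normed_vector \<Rightarrow> 'b::real_normed_vector) \<Rightarrow> 'a set \<Rightarrow> bool" where
  "smooth_on h S \<longleftrightarrow> (\<forall>k. Ck_on k h S)"

text \<open>Class \<open>C\<close> to the \<open>1 + e\<close> on an open set: the derivative is Hoelder with exponent \<open>e\<close> on compact
  subsets.\<close>

definition C1_holder :: "real \<Rightarrow> ('a::euclidean_space \<Rightarrow> 'b::euclidean_space) \<Rightarrow> 'a set \<Rightarrow> bool" where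
  "C1_holder e h S \<longleftrightarrow> (\<exists>h' :: 'a \<Rightarrow> 'a \<Rightarrow>\<^sub>L 'b.
     (\<forall>x\<in>S. (h has_derivative blinfun_apply (h' x)) (at x)) \<and>
     (\<forall>K. compact K \<and> K \<subseteq> S \<longrightarrow>
        (\<exists>C. \<forall>x\<in>K. \<forall>y\<in>K. norm (h' x - h' y) \<le> C * dist x y powr e)))"

definition C1_holder_diffeo :: "real \<Rightarrow> ('a::euclidean_space \<Rightarrow> 'a) \<Rightarrow> 'a set \<Rightarrow> bool" where
  "C1_holder_diffeo e h S \<longleftrightarrow> open S \<and> inj_on h S \<and> open (h ` S) \<and>
     C1_holder e h S \<and> C1_holder e (inv_into S h) (h ` S)"

text \<open>Maps on arbitrary subsets of Euclidean space (such as curves) are \<open>C\<close> to the 1 if they locally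
  extend to such maps on open sets of the ambient space.\<close>

definition C1_subset :: "('a::euclidean_space \<Rightarrow> 'b::euclidean_space) \<Rightarrow> 'a set \<Rightarrow> bool" where
  "C1_subset h V \<longleftrightarrow> (\<forall>x\<in>V. \<exists>B k. open B \<and> x \<in> B \<and> Ck_on 1 k B \<and> (\<forall>z\<in>V \<inter> B. k z = h z))"

definition C1_diffeo_onto_image :: "('a::euclidean_space \<Rightarrow> 'b::euclidean_space) \<Rightarrow> 'a set \<Rightarrow> bool" where
  "C1_diffeo_onto_image h V \<longleftrightarrow>
     inj_on h V \<and> C1_subset h V \<and> C1_subset (inv_into V h) (h ` V)"

definition smooth_curve :: "(real^3) set \<Rightarrow> bool" where
  "smooth_curve W \<longleftrightarrow> (\<exists>c T I. open T \<and> I \<subseteq> T \<and> is_interval I \<and> interior I \<noteq> {} \<and>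
     smooth_on c T \<and> inj_on c I \<and> (\<forall>t\<in>I. vector_derivative c (at t) \<noteq> 0) \<and> W = c ` I)"


section \<open>Lower box dimension\<close>

definition covering_number :: "'a::metric_space set \<Rightarrow> real \<Rightarrow> enat" where
  "covering_number A d = Inf {enat (card \<C>) | \<C>.
     finite \<C> \<and> A \<subseteq> \<Union>\<C> \<and> (\<forall>C\<in>\<C>. bounded C \<and> diameter C \<le> d)}"

definition lower_box_dim :: "'a::metric_space set \<Rightarrow> ereal" where
  "lower_box_dim A = Liminf (at_right 0)
     (\<lambda>d. case covering_number A d of
            enat n \<Rightarrow> ereal (ln (real n) / (- ln d))
          | \<infinity> \<Rightarrow> \<infinity>)"


section \<open>Flows, Poincare maps and foliated sections\<close>

definition is_flow :: "(real^3 \<Rightarrow> real^3) \<Rightarrow> (real \<Rightarrow> real^3 \<Rightarrow> real^3) \<Rightarrow> bool" where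
  "is_flow G Z \<longleftrightarrow>
     (\<forall>x. Z 0 x = x) \<and> (\<forall>s t x. Z (s + t) x = Z s (Z t x)) \<and>
     (\<forall>t x. ((\<lambda>s. Z s x) has_vector_derivative G (Z t x)) (at t)) \<and>
     smooth_on (\<lambda>(t, x). Z t x) UNIV"

definition divergence :: "(real^3 \<Rightarrow> real^3) \<Rightarrow> real^3 \<Rightarrow> real" where
  "divergence G x = (\<Sum>i\<in>UNIV. frechet_derivative G (at x) (axis i 1) $ i)"

definition return_time :: "(real \<Rightarrow> real^3 \<Rightarrow> real^3) \<Rightarrow> (real^3) set \<Rightarrow> real^3 \<Rightarrow> real" where
  "return_time Z X x = Inf {t. 0 < t \<and> Z t x \<in> X}"

definition poincare_map :: "(real \<Rightarrow> real^3 \<Rightarrow> real^3) \<Rightarrow> (real^3) set \<Rightarrow> real^3 \<Rightarrow> real^3" where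
  "poincare_map Z X x = Z (return_time Z X x) x"

text \<open>The first \<open>n\<close> iterates of \<open>h\<close> are defined at \<open>x\<close>, where \<open>h\<close> is defined off \<open>A\<close>.\<close>

definition iterates_avoid :: "('a \<Rightarrow> 'a) \<Rightarrow> 'a set \<Rightarrow> nat \<Rightarrow> 'a \<Rightarrow> bool" where
  "iterates_avoid h A n x \<longleftrightarrow> (\<forall>i<n. (h ^^ i) x \<notin> A)"

text \<open>\<open>X\<close> is a section whose Poincare map \<open>f\<close> is defined off \<open>\<Gamma>\<close>, and \<open>N \<subseteq> X\<close> carries an \<open>f\<close>-invariant,
  exponentially contracting foliation of class \<open>C\<close> to the \<open>1 + e\<close>.  The leaves are the fibres of the
  projection \<open>p\<close> to the transversal curve \<open>\<sigma> ` {-1..1}\<close>, which is identified with \<open>{-1..1}\<close>; so each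
  leaf meets this curve in one point.  The regularity of the foliation is expressed by charts \<open>h\<close>
  straightening \<open>N\<close> into a plane and the leaves into level sets of the first coordinate.  The quotient
  map \<open>s \<mapsto> p (f (\<sigma> s))\<close> is uniformly expanding and locally eventually onto.\<close>

definition lorenz_section ::
  "real \<Rightarrow> (real \<Rightarrow> real^3 \<Rightarrow> real^3) \<Rightarrow> (real \<Rightarrow> real^3) \<Rightarrow> (real^3) set \<Rightarrow> (real^3) set \<Rightarrow>
   (real^3) set \<Rightarrow> (real^3 \<Rightarrow> real) \<Rightarrow> bool" where
  "lorenz_section e Z \<sigma> X \<Gamma> N p \<longleftrightarrow>
    (let f = poincare_map Z X; fb = (\<lambda>s. p (f (\<sigma> s))) in
      (\<forall>x\<in>X - \<Gamma>. \<exists>t>0. Z t x \<in> X \<and> (\<forall>s\<in>{0<..<t}. Z s x \<notin> X)) \<and>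
      N \<subseteq> X \<and> p ` N \<subseteq> {-1..1} \<and> (\<forall>s\<in>{-1..1}. \<sigma> s \<in> N \<and> p (\<sigma> s) = s) \<and>
      {x \<in> N. p x = 0} = \<Gamma> \<inter> N \<and>
      (\<forall>x\<in>N. \<exists>B h. x \<in> B \<and> C1_holder_diffeo e h B \<and>
         (\<forall>z\<in>N \<inter> B. h z $ 1 = p z \<and> h z $ 3 = 0)) \<and>
      (\<forall>x\<in>N - \<Gamma>. f x \<in> N \<and> (\<forall>x'\<in>N - \<Gamma>. p x' = p x \<longrightarrow> p (f x') = p (f x))) \<and>
      (\<exists>C \<theta>\<^sub>0. 0 < \<theta>\<^sub>0 \<and> \<theta>\<^sub>0 < 1 \<and>
         (\<forall>x\<in>N. \<forall>x'\<in>N. \<forall>n. p x' = p x \<and> iterates_avoid f \<Gamma> n x \<longrightarrow>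
            dist ((f ^^ n) x) ((f ^^ n) x') \<le> C * \<theta>\<^sub>0 ^ n)) \<and>
      (\<exists>c \<theta>\<^sub>1. c > 0 \<and> \<theta>\<^sub>1 > 1 \<and>
         (\<forall>n. \<forall>s\<in>{-1..1}. iterates_avoid fb {0} n s \<longrightarrow>
            (\<exists>D. ((fb ^^ n) has_real_derivative D) (at s within {-1..1}) \<and> \<bar>D\<bar> \<ge> c * \<theta>\<^sub>1 ^ n))) \<and>
      (\<forall>V'. open V' \<and> V' \<noteq> {} \<and> V' \<subseteq> {-1..1} - {0} \<longrightarrow>
         (\<exists>k. {0<..<1} \<subseteq> (fb ^^ k) ` {s \<in> V'. iterates_avoid fb {0} k s})))"

text \<open>The region swept out by the orbits from \<open>X\<close> up to their first return; orbits starting in \<open>\<Gamma>\<close> do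
  not return, and are followed for all positive time.\<close>

definition swept_region ::
  "(real \<Rightarrow> real^3 \<Rightarrow> real^3) \<Rightarrow> (real^3) set \<Rightarrow> (real^3) set \<Rightarrow> (real^3) set" where
  "swept_region Z X \<Gamma> = {Z t x | t x. x \<in> X \<and> 0 \<le> t \<and> (x \<notin> \<Gamma> \<longrightarrow> t \<le> return_time Z X x)}"

text \<open>\<open>\<F> x\<close> is the leaf through \<open>x\<close> of a one-dimensional foliation, of class \<open>C\<close> to the \<open>1 + e\<close>, of an
  open neighbourhood of \<open>U\<close>; it is invariant and exponentially contracting over \<open>U\<close>.  (The set \<open>U\<close> is
  not open, and leaves through its boundary may leave it.)\<close>

definition strong_stable_foliation ::
  "real \<Rightarrow> (real \<Rightarrow> real^3 \<Rightarrow> real^3) \<Rightarrow> (real^3) set \<Rightarrow> (real^3 \<Rightarrow> (real^3) set) \<Rightarrow> bool" where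
  "strong_stable_foliation e Z U \<F> \<longleftrightarrow> (\<exists>R. open R \<and> U \<subseteq> R \<and>
     (\<forall>x\<in>R. x \<in> \<F> x \<and> \<F> x \<subseteq> R \<and> connected (\<F> x) \<and> (\<forall>y\<in>\<F> x. \<F> y = \<F> x)) \<and>
     (\<forall>x\<in>R. \<exists>B h a b. x \<in> B \<and> B \<subseteq> R \<and> C1_holder_diffeo e h B \<and> h ` B = box a b \<and>
        (\<forall>y\<in>B. connected_component_set (\<F> y \<inter> B) y =
           {z \<in> B. h z $ 1 = h y $ 1 \<and> h z $ 2 = h y $ 2}))) \<and>
     (\<forall>x\<in>U. \<forall>t\<ge>0. Z t ` \<F> x \<subseteq> \<F> (Z t x)) \<and>
     (\<exists>C \<kappa>. 0 < \<kappa> \<and> \<kappa> < 1 \<and>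
        (\<forall>x\<in>U. \<forall>x'\<in>\<F> x. \<forall>t\<ge>0. dist (Z t x) (Z t x') \<le> C * \<kappa> powr t))"


section \<open>Strongly dissipative geometric Lorenz attractors\<close>

text \<open>The field \<open>chart\<close> is the inverse of the linearizing coordinates: it maps \<open>(x\<^sub>1, x\<^sub>2, x\<^sub>3)\<close> to the
  point of phase space with these coordinates.  The field \<open>ssleaf\<close> gives the leaf of the strong stable
  foliation through a point; \<open>hexp\<close> is the Hoelder exponent common to all objects of class \<open>C\<close> to
  the \<open>1 + hexp\<close>.\<close>

record lorenz =
  vf :: "real^3 \<Rightarrow> real^3"
  flow :: "real \<Rightarrow> real^3 \<Rightarrow> real^3"
  hexp :: real
  lam_u :: real
  lam_ss :: real
  lam_s :: real
  chart :: "real^3 \<Rightarrow> real^3"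
  ssleaf :: "real^3 \<Rightarrow> (real^3) set"

definition linear_flow :: "lorenz \<Rightarrow> real \<Rightarrow> real^3 \<Rightarrow> real^3" where
  "linear_flow L t u =
     vector [exp (lam_u L * t) * u $ 1, exp (lam_ss L * t) * u $ 2, exp (lam_s L * t) * u $ 3]"

definition transversal :: "lorenz \<Rightarrow> real \<Rightarrow> real^3" where
  "transversal L s = chart L (vector [s, 0, 1])"

definition flat_section :: "lorenz \<Rightarrow> (real^3) set" where
  "flat_section L = {chart L (vector [a, b, 1]) | a b. \<bar>a\<bar> \<le> 1 \<and> \<bar>b\<bar> \<le> 1}"

definition flat_sing :: "lorenz \<Rightarrow> (real^3) set" where
  "flat_sing L = {chart L (vector [0, b, 1]) | b. \<bar>b\<bar> \<le> 1}"

definition region :: "lorenz \<Rightarrow> (real^3) set" where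
  "region L = swept_region (flow L) (flat_section L) (flat_sing L)"

definition attractor :: "lorenz \<Rightarrow> (real^3) set" where
  "attractor L = (\<Inter>t\<in>{0<..}. flow L t ` region L)"

definition linearizable :: "lorenz \<Rightarrow> bool" where
  "linearizable L \<longleftrightarrow> (\<exists>S. {u. \<forall>i. \<bar>u $ i\<bar> \<le> 1} \<subseteq> S \<and> C1_holder_diffeo (hexp L) (chart L) S \<and>
     chart L 0 = 0 \<and>
     (\<exists>A P. (vf L has_derivative A) (at 0) \<and> (chart L has_derivative P) (at 0) \<and>
        A (P (axis 1 1)) = lam_u L *\<^sub>R P (axis 1 1) \<and>
        A (P (axis 2 1)) = lam_ss L *\<^sub>R P (axis 2 1) \<and>
        A (P (axis 3 1)) = lam_s L *\<^sub>R P (axis 3 1)) \<and>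
     (\<forall>u t. 0 \<le> t \<and> (\<forall>s\<in>{0..t}. linear_flow L s u \<in> S) \<longrightarrow>
        flow L t (chart L u) = chart L (linear_flow L t u)))"

definition geometric_lorenz :: "lorenz \<Rightarrow> bool" where
  "geometric_lorenz L \<longleftrightarrow>
     smooth_on (vf L) UNIV \<and> is_flow (vf L) (flow L) \<and> vf L 0 = 0 \<and>
     lam_ss L < lam_s L \<and> lam_s L < 0 \<and> - lam_s L < lam_u L \<and>
     0 < hexp L \<and> hexp L \<le> 1 \<and> linearizable L \<and>
     (\<exists>N p. lorenz_section (hexp L) (flow L) (transversal L) (flat_section L) (flat_sing L) N p \<and>
        compact N \<and> (\<exists>B. open B \<and> transversal L 0 \<in> B \<and> flat_section L \<inter> B \<subseteq> N) \<and>
        (\<forall>s\<in>{-1..1}. smooth_curve {x \<in> N. p x = s}))"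

definition strongly_dissipative :: "lorenz \<Rightarrow> bool" where
  "strongly_dissipative L \<longleftrightarrow>
     (\<exists>\<delta>>0. \<forall>x\<in>region L. divergence (vf L) x \<le> - \<delta>) \<and> lam_u L + lam_ss L < lam_s L"

text \<open>From now on the cross-section is the union of the strong stable leaves through the transversal,
  and the stable leaf of a point is its strong stable leaf.\<close>

definition section_of :: "lorenz \<Rightarrow> (real^3) set" where
  "section_of L = (\<Union>s\<in>{-1..1}. ssleaf L (transversal L s))"

definition sing :: "lorenz \<Rightarrow> (real^3) set" where
  "sing L = ssleaf L (transversal L 0)"

definition proj :: "lorenz \<Rightarrow> real^3 \<Rightarrow> real" where
  "proj L x = (THE s. s \<in> {-1..1} \<and> x \<in> ssleaf L (transversal L s))"

definition ret :: "lorenz \<Rightarrow> real^3 \<Rightarrow> real" where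
  "ret L = return_time (flow L) (section_of L)"

definition pmap :: "lorenz \<Rightarrow> real^3 \<Rightarrow> real^3" where
  "pmap L = poincare_map (flow L) (section_of L)"

definition pmap_inv :: "lorenz \<Rightarrow> real^3 \<Rightarrow> real^3" where
  "pmap_inv L = inv_into (section_of L - sing L) (pmap L)"

definition qmap :: "lorenz \<Rightarrow> real \<Rightarrow> real" where
  "qmap L s = proj L (pmap L (transversal L s))"

text \<open>\<open>\<rho>\<close> is of class \<open>C\<close> to the \<open>1 + e\<close> on \<open>{-1..1} - {0}\<close>, and behaves like \<open>- ln \<bar>s\<bar> / \<theta>\<close> at \<open>0\<close>.\<close>

definition log_singularity :: "real \<Rightarrow> real \<Rightarrow> (real \<Rightarrow> real) \<Rightarrow> bool" where
  "log_singularity e \<theta> \<rho> \<longleftrightarrow> (\<exists>\<rho>' C.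
     (\<forall>s\<in>{-1..1} - {0}. (\<rho> has_real_derivative \<rho>' s) (at s within {-1..1}) \<and>
        \<bar>\<rho>' s\<bar> \<le> C / \<bar>s\<bar> \<and> \<bar>\<rho> s + ln \<bar>s\<bar> / \<theta>\<bar> \<le> C) \<and>
     (\<forall>K. compact K \<and> K \<subseteq> {-1..1} - {0} \<longrightarrow>
        (\<exists>H. \<forall>s\<in>K. \<forall>t\<in>K. \<bar>\<rho>' s - \<rho>' t\<bar> \<le> H * \<bar>s - t\<bar> powr e)))"

definition lorenz_setting :: "lorenz \<Rightarrow> bool" where
  "lorenz_setting L \<longleftrightarrow>
     geometric_lorenz L \<and> strongly_dissipative L \<and>
     strong_stable_foliation (hexp L) (flow L) (region L) (ssleaf L) \<and>
     (\<forall>s\<in>{-1..1}. \<forall>t\<in>{-1..1}. transversal L t \<in> ssleaf L (transversal L s) \<longrightarrow> t = s) \<and>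
     lorenz_section (hexp L) (flow L) (transversal L) (section_of L) (sing L) (section_of L) (proj L) \<and>
     (\<forall>x\<in>section_of L - sing L. \<forall>x'\<in>ssleaf L x. ret L x' = ret L x) \<and>
     log_singularity (hexp L) (lam_u L) (\<lambda>s. ret L (transversal L s))"


section \<open>Unstable manifolds and the temporal distortion function\<close>

text \<open>A local unstable manifold over the open interval \<open>J\<close>: a curve in the attractor, parametrized by
  its projection, with all backward images under the Poincare map being curves, too, and with
  exponential backward contraction.\<close>

definition unstable_curve :: "lorenz \<Rightarrow> real set \<Rightarrow> (real^3) set \<Rightarrow> bool" where
  "unstable_curve L J W \<longleftrightarrow>
     open J \<and> is_interval J \<and> J \<noteq> {} \<and> J \<subseteq> {-1..1} \<and>
     (\<exists>\<gamma>. W = \<gamma> ` J \<and> C1_holder (hexp L) \<gamma> J \<and>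
        (\<forall>s\<in>J. \<gamma> s \<in> section_of L \<inter> attractor L \<and> proj L (\<gamma> s) = s) \<and>
        (\<forall>n. (\<forall>s\<in>J. (pmap_inv L ^^ n) (\<gamma> s) \<in> pmap L ` (section_of L - sing L)) \<and>
             continuous_on J (\<lambda>s. (pmap_inv L ^^ n) (\<gamma> s))) \<and>
        (\<exists>C \<kappa>. 0 < \<kappa> \<and> \<kappa> < 1 \<and> (\<forall>n. \<forall>s\<in>J. \<forall>t\<in>J.
           dist ((pmap_inv L ^^ n) (\<gamma> s)) ((pmap_inv L ^^ n) (\<gamma> t)) \<le> C * \<kappa> ^ n)))"

text \<open>The unstable manifold of \<open>y\<close> over \<open>J\<close>; since the unstable curve over \<open>J\<close> through \<open>y\<close> is unique if
  it exists, this is that curve, and it is empty if there is none.\<close>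

definition unstable_manifold :: "lorenz \<Rightarrow> real set \<Rightarrow> real^3 \<Rightarrow> (real^3) set" where
  "unstable_manifold L J y = \<Union>{W. unstable_curve L J W \<and> y \<in> W}"

definition same_unstable :: "lorenz \<Rightarrow> real^3 \<Rightarrow> real^3 \<Rightarrow> bool" where
  "same_unstable L y z \<longleftrightarrow> (\<exists>J W. unstable_curve L J W \<and> y \<in> W \<and> z \<in> W)"

text \<open>The bracket is formed with an unstable curve over any interval, which makes it (and the temporal
  distortion function) independent of inducing schemes; the point does not depend on the interval.\<close>

definition bracket_defined :: "lorenz \<Rightarrow> real^3 \<Rightarrow> real^3 \<Rightarrow> bool" where
  "bracket_defined L y z \<longleftrightarrow> (\<exists>!w. same_unstable L y w \<and> w \<in> ssleaf L z)"

definition bracket :: "lorenz \<Rightarrow> real^3 \<Rightarrow> real^3 \<Rightarrow> real^3" where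
  "bracket L y z = (THE w. same_unstable L y w \<and> w \<in> ssleaf L z)"

definition D0_term :: "lorenz \<Rightarrow> real^3 \<Rightarrow> real^3 \<Rightarrow> nat \<Rightarrow> real" where
  "D0_term L y z j = ret L ((pmap_inv L ^^ j) y) - ret L ((pmap_inv L ^^ j) z)"

definition D0 :: "lorenz \<Rightarrow> real^3 \<Rightarrow> real^3 \<Rightarrow> real" where
  "D0 L y z = (\<Sum>j. D0_term L y z (Suc j))"

definition distortion :: "lorenz \<Rightarrow> real^3 \<Rightarrow> real^3 \<Rightarrow> real" where
  "distortion L y z = D0 L y (bracket L y z) + D0 L z (bracket L z y)"

definition distortion_defined :: "lorenz \<Rightarrow> real^3 \<Rightarrow> real^3 \<Rightarrow> bool" where
  "distortion_defined L y z \<longleftrightarrow> bracket_defined L y z \<and> bracket_defined L z y \<and>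
     summable (\<lambda>j. D0_term L y (bracket L y z) (Suc j)) \<and>
     summable (\<lambda>j. D0_term L z (bracket L z y) (Suc j))"

definition distortion_values :: "lorenz \<Rightarrow> (real^3) set \<Rightarrow> real set" where
  "distortion_values L A = {distortion L y z | y z. y \<in> A \<and> z \<in> A \<and> distortion_defined L y z}"

text \<open>The temporal distortion function at \<open>(f\<^sup>l a, f\<^sup>l b)\<close>, where \<open>[f\<^sup>l a, f\<^sup>l b] = f\<^sup>l [a, b]\<close>.\<close>

definition shifted_distortion :: "lorenz \<Rightarrow> nat \<Rightarrow> real^3 \<Rightarrow> real^3 \<Rightarrow> real" where
  "shifted_distortion L l a b =
     D0 L ((pmap L ^^ l) a) ((pmap L ^^ l) (bracket L a b)) +
     D0 L ((pmap L ^^ l) b) ((pmap L ^^ l) (bracket L b a))"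

text \<open>For \<open>p = f\<^sup>l y\<close>, the curve \<open>W\<^sup>u(p) = f\<^sup>l W\<^sup>u(y)\<close>, the image being taken where \<open>f\<^sup>l\<close> is defined.\<close>

definition shifted_manifold :: "lorenz \<Rightarrow> real set \<Rightarrow> nat \<Rightarrow> real^3 \<Rightarrow> (real^3) set" where
  "shifted_manifold L J l y =
     (pmap L ^^ l) ` {a \<in> unstable_manifold L J y. iterates_avoid (pmap L) (sing L) l a}"

definition distortion_along :: "lorenz \<Rightarrow> nat \<Rightarrow> real^3 \<Rightarrow> real^3 \<Rightarrow> real" where
  "distortion_along L l y' q = shifted_distortion L l ((pmap_inv L ^^ l) q) y'"


section \<open>Full-branch inducing schemes\<close>

record scheme =
  base :: "real set"
  itime :: "real \<Rightarrow> nat"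
  part :: "real set set"

definition induced_qmap :: "lorenz \<Rightarrow> scheme \<Rightarrow> real \<Rightarrow> real" where
  "induced_qmap L S s = (qmap L ^^ itime S s) s"

definition induced_map :: "lorenz \<Rightarrow> scheme \<Rightarrow> real^3 \<Rightarrow> real^3" where
  "induced_map L S x = (pmap L ^^ itime S (proj L x)) x"

definition itime_sum :: "lorenz \<Rightarrow> scheme \<Rightarrow> nat \<Rightarrow> real \<Rightarrow> nat" where
  "itime_sum L S n s = (\<Sum>j<n. itime S ((induced_qmap L S ^^ j) s))"

definition same_cylinder :: "lorenz \<Rightarrow> scheme \<Rightarrow> nat \<Rightarrow> real \<Rightarrow> real \<Rightarrow> bool" where
  "same_cylinder L S n s t \<longleftrightarrow>
     (\<forall>j<n. \<exists>a\<in>part S. (induced_qmap L S ^^ j) s \<in> a \<and> (induced_qmap L S ^^ j) t \<in> a)"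

definition inducing_scheme :: "lorenz \<Rightarrow> scheme \<Rightarrow> bool" where
  "inducing_scheme L S \<longleftrightarrow>
     (let fb = qmap L; Fb = induced_qmap L S in
      open (base S) \<and> is_interval (base S) \<and> base S \<noteq> {} \<and> base S \<subseteq> {-1..1} \<and>
      (\<forall>s\<in>base S. 0 < itime S s) \<and>
      countable (part S) \<and> disjoint (part S) \<and> negligible (base S - \<Union>(part S)) \<and>
      (\<forall>a\<in>part S. open a \<and> is_interval a \<and> a \<noteq> {} \<and> a \<subseteq> base S \<and>
         (\<exists>k. \<forall>s\<in>a. itime S s = k) \<and>
         C1_holder_diffeo (hexp L) Fb a \<and> Fb ` a = base S) \<and>
      (\<exists>\<kappa>>1. \<forall>s\<in>\<Union>(part S). \<bar>deriv Fb s\<bar> \<ge> \<kappa>) \<and>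
      (\<exists>c\<^sub>0 \<theta>. c\<^sub>0 > 0 \<and> 0 < \<theta> \<and> \<theta> < 1 \<and>
         (\<forall>n s t. 1 \<le> n \<and> s \<in> base S \<and> t \<in> base S \<and> same_cylinder L S n s t \<longrightarrow>
            (\<forall>i < itime_sum L S n s.
               \<bar>(fb ^^ i) t - (fb ^^ i) s\<bar>
                 \<le> c\<^sub>0 * \<theta> ^ (itime_sum L S n s - i) * \<bar>(Fb ^^ n) t - (Fb ^^ n) s\<bar> \<and>
               \<bar>(fb ^^ i) s\<bar> \<ge> \<theta> powr (real (itime_sum L S n s - i) / 2)) \<and>
            \<bar>deriv (Fb ^^ n) s / deriv (Fb ^^ n) t - 1\<bar> \<le> c\<^sub>0 * \<bar>(Fb ^^ n) s - (Fb ^^ n) t\<bar>)))"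

text \<open>The union of the stable leaves through the points of \<open>B \<subseteq> {-1..1}\<close> on the transversal.\<close>

definition saturate :: "lorenz \<Rightarrow> real set \<Rightarrow> (real^3) set" where
  "saturate L B = (\<Union>s\<in>B. ssleaf L (transversal L s))"

definition part_leaves :: "lorenz \<Rightarrow> scheme \<Rightarrow> (real^3) set set" where
  "part_leaves L S = saturate L ` part S"

definition periodic_point :: "lorenz \<Rightarrow> scheme \<Rightarrow> real^3 \<Rightarrow> bool" where
  "periodic_point L S q \<longleftrightarrow>
     (\<exists>n\<ge>1. (induced_map L S ^^ n) q = q \<and> (\<forall>j<n. (induced_map L S ^^ j) q \<in> \<Union>(part_leaves L S)))"

definition finite_subsystem :: "lorenz \<Rightarrow> scheme \<Rightarrow> (real^3) set \<Rightarrow> (real^3) set \<Rightarrow> (real^3) set" where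
  "finite_subsystem L S a\<^sub>1 a\<^sub>2 =
     (\<Inter>n. {x \<in> saturate L (base S). (induced_map L S ^^ n) x \<in> a\<^sub>1 \<union> a\<^sub>2})"

end

theory Submission
  imports Defs
begin

text \<open>The finite subsystem \<open>A\<^sub>0\<close> is a union of stable leaves, over a Cantor set \<open>K\<close> generated by two branches
  of the quotient map.  Fix \<open>v\<^sub>0 \<in> V\<close> over a point of \<open>K\<close>, and let \<open>w\<^sub>0\<close> be the point of the unstable curve of
  \<open>p'\<close> on the stable leaf of \<open>v\<^sub>0\<close>.  For every \<open>v \<in> V\<close> over \<open>K\<close> near \<open>v\<^sub>0\<close>, both \<open>v\<close> and \<open>w\<^sub>0\<close> lie in
  \<open>A\<^sub>0\<close>, and telescoping the sums gives \<open>D(v, w\<^sub>0) = g(v) - g(v\<^sub>0)\<close>.  As \<open>g\<close> is a \<open>C\<^sup>1\<close> diffeomorphism on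
  \<open>V\<close>, the values of \<open>D\<close> contain an image of a piece of \<open>K\<close> under a map that contracts distances by at
  most a constant factor, and \<open>K\<close> has positive lower box dimension because the branches have bounded
  derivative.\<close>

section \<open>Box dimension and two-branch Cantor sets\<close>

text \<open>The telescoping rests on the bracket \<open>[v, p']\<close> being the same point for all
  \<open>v\<close>, while \<open>[v, w\<^sub>0] = v\<^sub>0\<close> and
  \<open>[w\<^sub>0, v] = [p', v]\<close>: in \<open>g(v) - g(v\<^sub>0)\<close> the common
  reference points cancel in both sums. Three obstacles shape the rest. Convergence: the return time
  blows up at the singular leaf, so \<open>D_0\<close> is an infinite sum that has to be shown to
  converge. Each curve used contains a periodic point, whose backward orbit is finite and thus stays
  away from that leaf; all other points are compared with it. Cutting: iterates of the Poincare map
  may cut a curve at the singular leaf, so the argument is confined to small pieces of curve around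
  \<open>v\<^sub>0\<close> and \<open>w\<^sub>0\<close>. Hence \<open>K\<close> must have enough
  separated points in every neighbourhood of some point \<open>x\<^sub>0\<close>, and
  \<open>v\<^sub>0\<close> is taken over such an \<open>x\<^sub>0\<close>. Adjacency: the two
  branches are disjoint open intervals that may share an endpoint, so the two halves of
  \<open>K\<close> need not be a positive distance apart. A gap is gained by cutting one branch once
  more.\<close>

lemma covering_number_ge_card:
  fixes A :: "'a::metric_space set"
  assumes "finite P" "P \<subseteq> A" and sep: "\<And>x y. x \<in> P \<Longrightarrow> y \<in> P \<Longrightarrow> x \<noteq> y \<Longrightarrow> d < dist x y"
  shows "enat (card P) \<le> covering_number A d"
  unfolding covering_number_def
proof (rule Inf_greatest, clarify)
  fix \<C> :: "'a set set"
  assume C: "finite \<C>" "A \<subseteq> \<Union>\<C>" "\<forall>C\<in>\<C>. bounded C \<and> diameter C \<le> d"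
  have "\<forall>x\<in>P. \<exists>C. C \<in> \<C> \<and> x \<in> C" using C(2) assms(2) by blast
  then obtain h where h: "\<forall>x\<in>P. h x \<in> \<C> \<and> x \<in> h x" by metis
  have "inj_on h P"
  proof (rule inj_onI, rule ccontr)
    fix x y assume xy: "x \<in> P" "y \<in> P" "h x = h y" "x \<noteq> y"
    then have "dist x y \<le> diameter (h x)" using h C(3) by (metis diameter_bounded_bound)
    also have "\<dots> \<le> d" using h C(3) xy(1) by blast
    finally show False using sep[OF xy(1,2,4)] by simp
  qed
  then have "card P \<le> card \<C>" using h C(1) by (intro card_inj_on_le[of h]) auto
  then show "enat (card P) \<le> enat (card \<C>)" by simp
qed

text \<open>At scale \<open>d\<close> one takes a level \<open>n\<close> whose separation
  \<open>c * \<mu> ^ n\<close> still exceeds \<open>d\<close>. This \<open>n\<close> is proportional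
  to \<open>- ln d\<close>, so \<open>2 ^ n\<close> grows like a negative power of \<open>d\<close>.
  The bound obtained is \<open>ln 2 / (4 * m)\<close> with \<open>m = - ln \<mu>\<close>.\<close>

lemma lower_box_dim_pos:
  fixes A :: "'a::metric_space set"
  assumes "0 < c" "0 < \<mu>" "\<mu> < 1"
    and P: "\<And>n::nat. \<exists>P. finite P \<and> P \<subseteq> A \<and> card P = 2 ^ n \<and>
      (\<forall>x\<in>P. \<forall>y\<in>P. x \<noteq> y \<longrightarrow> c * \<mu> ^ n \<le> dist x y)"
  shows "lower_box_dim A > 0"
proof -
  define m where "m = - ln \<mu>"
  have m: "m > 0" using assms(2,3) by (simp add: m_def)
  \<comment> \<open>Below this threshold \<open>x = - ln d\<close> exceeds \<open>4 * m\<close>, so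
    that rounding down costs at most half of \<open>x / (2 * m)\<close>, and it exceeds
    \<open>- 2 * ln c\<close>: one half of the exponent \<open>x\<close> is spent on
    \<open>\<mu> ^ n\<close>, the other half pays for \<open>c\<close>.\<close>
  define b where "b = exp (- max 1 (max (4 * m) (1 - 2 * ln c)))"
  have b: "b > 0" by (simp add: b_def)
  have "ereal (ln 2 / (4 * m)) \<le> (case covering_number A d of
            enat n \<Rightarrow> ereal (ln (real n) / (- ln d)) | \<infinity> \<Rightarrow> \<infinity>)"
    if d: "0 < d" "d < b" for d
  proof -
    define x where "x = - ln d"
    have "ln d < ln b" using d by simp
    then have x: "x > 1" "x > 4 * m" "x > - 2 * ln c" unfolding x_def b_def ln_exp by auto
    have dx: "d = exp (- x)" using d by (simp add: x_def)
    define n where "n = nat \<lfloor>x / (2 * m)\<rfloor>"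
    have n1: "real n \<le> x / (2 * m)" using x m by (simp add: n_def)
    have "real n \<ge> x / (2 * m) - 1" unfolding n_def by linarith
    moreover have "x / (2 * m) - 1 \<ge> x / (4 * m)" using x m by (simp add: field_simps)
    ultimately have n2: "real n \<ge> x / (4 * m)" by linarith
    have "c * \<mu> ^ n = exp (ln c - m * real n)"
    proof -
      have "\<mu> ^ n = exp (real n * ln \<mu>)" using assms(2) by (simp add: exp_of_nat_mult)
      moreover have "exp (ln c) = c" using assms(1) by simp
      ultimately have "c * \<mu> ^ n = exp (ln c) * exp (real n * ln \<mu>)" by simp
      also have "\<dots> = exp (ln c - m * real n)" unfolding exp_add[symmetric] by (simp add: m_def mult.commute)
      finally show ?thesis .
    qed
    moreover have "m * real n \<le> x / 2" using n1 m by (simp add: field_simps)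
    ultimately have *: "d < c * \<mu> ^ n" using x dx by simp
    obtain P where P: "finite P" "P \<subseteq> A" "card P = 2 ^ n"
      "\<forall>x\<in>P. \<forall>y\<in>P. x \<noteq> y \<longrightarrow> c * \<mu> ^ n \<le> dist x y" using P[of n] by blast
    have "enat (2 ^ n) \<le> covering_number A d"
      unfolding P(3)[symmetric]
    proof (rule covering_number_ge_card[OF P(1,2)])
      fix x y assume "x \<in> P" "y \<in> P" "x \<noteq> y"
      then have "c * \<mu> ^ n \<le> dist x y" using P(4) by blast
      then show "d < dist x y" using * by linarith
    qed
    show ?thesis
    proof (cases "covering_number A d")
      case (enat k)
      then have "2 ^ n \<le> k" using \<open>enat (2 ^ n) \<le> _\<close> by simp
      then have "(2::real) ^ n \<le> real k" by (metis of_nat_le_iff of_nat_numeral of_nat_power)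
      then have "ln ((2::real) ^ n) \<le> ln (real k)" by (intro ln_mono) auto
      then have "real n * ln 2 \<le> ln (real k)" by (simp add: ln_realpow)
      moreover have "x / (4 * m) * ln 2 \<le> real n * ln 2" using n2 by (intro mult_right_mono) auto
      ultimately have "ln 2 / (4 * m) * x \<le> ln (real k)" by (simp add: mult.commute)
      then have "ln 2 / (4 * m) \<le> ln (real k) / x" using x by (simp add: pos_le_divide_eq)
      then show ?thesis using enat by (simp add: x_def)
    qed auto
  qed
  then have "\<forall>\<^sub>F d in at_right 0. ereal (ln 2 / (4 * m)) \<le> (case covering_number A d of
            enat n \<Rightarrow> ereal (ln (real n) / (- ln d)) | \<infinity> \<Rightarrow> \<infinity>)"
    using b by (intro eventually_at_rightI[of 0 b]) (simp_all only: greaterThanLessThan_iff)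
  then have "ereal (ln 2 / (4 * m)) \<le> lower_box_dim A"
    unfolding lower_box_dim_def by (rule Liminf_bounded)
  moreover have "ereal (ln 2 / (4 * m)) > 0" using m by simp
  ultimately show ?thesis by (rule order.strict_trans2[rotated])
qed

text \<open>The points are the images of one point under all words of length \<open>n\<close> in the
  two maps. Each common first letter of two words costs a factor \<open>\<mu>\<close>; the first
  letter in which they differ provides the gap \<open>\<eta>\<close>.\<close>

lemma separated_points_of_two_contractions:
  fixes \<phi>\<^sub>1 \<phi>\<^sub>2 :: "real \<Rightarrow> real"
  assumes "K \<noteq> {}" "\<phi>\<^sub>1 ` K \<subseteq> K" "\<phi>\<^sub>2 ` K \<subseteq> K" "0 < \<eta>" "0 < \<mu>" "\<mu> < 1"
    and gap: "\<And>x y. x \<in> K \<Longrightarrow> y \<in> K \<Longrightarrow> \<eta> \<le> \<bar>\<phi>\<^sub>1 x - \<phi>\<^sub>2 y\<bar>"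
    and co1: "\<And>x y. x \<in> K \<Longrightarrow> y \<in> K \<Longrightarrow> \<mu> * \<bar>x - y\<bar> \<le> \<bar>\<phi>\<^sub>1 x - \<phi>\<^sub>1 y\<bar>"
    and co2: "\<And>x y. x \<in> K \<Longrightarrow> y \<in> K \<Longrightarrow> \<mu> * \<bar>x - y\<bar> \<le> \<bar>\<phi>\<^sub>2 x - \<phi>\<^sub>2 y\<bar>"
  shows "\<exists>P. finite P \<and> P \<subseteq> K \<and> card P = 2 ^ n \<and>
      (\<forall>x\<in>P. \<forall>y\<in>P. x \<noteq> y \<longrightarrow> \<eta> * \<mu> ^ n \<le> \<bar>x - y\<bar>)"
proof (induction n)
  case 0
  obtain x where "x \<in> K" using assms(1) by blast
  then show ?case by (intro exI[of _ "{x}"]) auto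
next
  case (Suc n)
  then obtain P where P: "finite P" "P \<subseteq> K" "card P = 2 ^ n"
    and P4: "\<forall>x\<in>P. \<forall>y\<in>P. x \<noteq> y \<longrightarrow> \<eta> * \<mu> ^ n \<le> \<bar>x - y\<bar>" by (elim exE conjE)
  have inj: "inj_on \<phi> P" if "\<And>x y. x \<in> K \<Longrightarrow> y \<in> K \<Longrightarrow> \<mu> * \<bar>x - y\<bar> \<le> \<bar>\<phi> x - \<phi> y\<bar>" for \<phi> :: "real \<Rightarrow> real"
  proof (rule inj_onI)
    fix x y assume "x \<in> P" "y \<in> P" "\<phi> x = \<phi> y"
    then have "\<mu> * \<bar>x - y\<bar> \<le> 0" using that[of x y] P(2) by auto
    then show "x = y" using \<open>0 < \<mu>\<close> by (simp add: mult_le_0_iff)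
  qed
  have disj: "\<phi>\<^sub>1 ` P \<inter> \<phi>\<^sub>2 ` P = {}"
  proof (rule ccontr)
    assume "\<not> ?thesis"
    then obtain x y where "x \<in> P" "y \<in> P" "\<phi>\<^sub>1 x = \<phi>\<^sub>2 y" by blast
    then show False using gap[of x y] P(2) assms(4) by auto
  qed
  have step: "\<eta> * \<mu> ^ Suc n \<le> \<bar>\<phi> x - \<phi> y\<bar>"
    if "\<And>x y. x \<in> K \<Longrightarrow> y \<in> K \<Longrightarrow> \<mu> * \<bar>x - y\<bar> \<le> \<bar>\<phi> x - \<phi> y\<bar>" "x \<in> P" "y \<in> P" "\<phi> x \<noteq> \<phi> y"
    for \<phi> :: "real \<Rightarrow> real" and x y
  proof -
    have "x \<noteq> y" using that(4) by auto
    have "\<eta> * \<mu> ^ Suc n = \<mu> * (\<eta> * \<mu> ^ n)" by simp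
    also have "\<dots> \<le> \<mu> * \<bar>x - y\<bar>" using P4 that(2,3) \<open>x \<noteq> y\<close> \<open>0 < \<mu>\<close> by simp
    also have "\<dots> \<le> \<bar>\<phi> x - \<phi> y\<bar>" using that(2,3) P(2) by (intro that(1)) auto
    finally show ?thesis .
  qed
  have "\<mu> ^ Suc n \<le> 1" using assms by (intro power_le_one) auto
  then have "\<eta> * \<mu> ^ Suc n \<le> \<eta> * 1" using \<open>0 < \<eta>\<close> by (intro mult_left_mono) auto
  then have gap': "\<eta> * \<mu> ^ Suc n \<le> \<bar>\<phi>\<^sub>1 x - \<phi>\<^sub>2 y\<bar>" "\<eta> * \<mu> ^ Suc n \<le> \<bar>\<phi>\<^sub>2 y - \<phi>\<^sub>1 x\<bar>"
    if "x \<in> P" "y \<in> P" for x y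
  proof -
    have "\<eta> \<le> \<bar>\<phi>\<^sub>1 x - \<phi>\<^sub>2 y\<bar>" using gap[of x y] that P(2) by blast
    then show "\<eta> * \<mu> ^ Suc n \<le> \<bar>\<phi>\<^sub>1 x - \<phi>\<^sub>2 y\<bar>" "\<eta> * \<mu> ^ Suc n \<le> \<bar>\<phi>\<^sub>2 y - \<phi>\<^sub>1 x\<bar>"
      using \<open>\<eta> * \<mu> ^ Suc n \<le> \<eta> * 1\<close> by linarith+
  qed
  have "\<forall>x\<in>\<phi>\<^sub>1 ` P \<union> \<phi>\<^sub>2 ` P. \<forall>y\<in>\<phi>\<^sub>1 ` P \<union> \<phi>\<^sub>2 ` P. x \<noteq> y \<longrightarrow> \<eta> * \<mu> ^ Suc n \<le> \<bar>x - y\<bar>"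
  proof (intro ballI impI)
    fix x y assume x: "x \<in> \<phi>\<^sub>1 ` P \<union> \<phi>\<^sub>2 ` P" and y: "y \<in> \<phi>\<^sub>1 ` P \<union> \<phi>\<^sub>2 ` P" and ne: "x \<noteq> y"
    obtain a where a: "a \<in> P" "x = \<phi>\<^sub>1 a \<or> x = \<phi>\<^sub>2 a" using x by blast
    obtain b where b: "b \<in> P" "y = \<phi>\<^sub>1 b \<or> y = \<phi>\<^sub>2 b" using y by blast
    show "\<eta> * \<mu> ^ Suc n \<le> \<bar>x - y\<bar>"
        using a(2) b(2)
    proof (elim disjE)
      assume "x = \<phi>\<^sub>1 a" "y = \<phi>\<^sub>1 b"
      then show ?thesis using step[of \<phi>\<^sub>1 a b] co1 a b ne by simp
    next
      assume "x = \<phi>\<^sub>2 a" "y = \<phi>\<^sub>2 b"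
      then show ?thesis using step[of \<phi>\<^sub>2 a b] co2 a b ne by simp
    qed (use gap'[OF a(1) b(1)] gap'[OF b(1) a(1)] in simp_all)
  qed
  moreover have "card (\<phi>\<^sub>1 ` P \<union> \<phi>\<^sub>2 ` P) = 2 ^ Suc n"
    using P(1,3) disj by (simp add: card_Un_disjoint card_image inj[OF co1] inj[OF co2])
  moreover have "\<phi>\<^sub>1 ` P \<union> \<phi>\<^sub>2 ` P \<subseteq> K" using assms(2,3) P(2) by blast
  ultimately show ?case using P(1) by (intro exI[of _ "\<phi>\<^sub>1 ` P \<union> \<phi>\<^sub>2 ` P"]) auto
qed

section \<open>Two full branches of an expanding interval map\<close>

lemma disjoint_intervals_ordered:
  fixes A B :: "real set"
  assumes "is_interval A" "is_interval B" "A \<inter> B = {}"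
  shows "(\<forall>x\<in>A. \<forall>y\<in>B. x < y) \<or> (\<forall>x\<in>A. \<forall>y\<in>B. y < x)"
proof (rule ccontr)
  assume "\<not> ?thesis"
  then have "\<exists>x\<in>A. \<exists>y\<in>B. y \<le> x" "\<exists>x\<in>A. \<exists>y\<in>B. x \<le> y"
    unfolding de_Morgan_disj ball_simps not_less by blast+
  then obtain x y x' y' where h: "x \<in> A" "y \<in> B" "y \<le> x" "x' \<in> A" "y' \<in> B" "x' \<le> y'"
    by blast
  have I: "\<And>a b c. a \<in> A \<Longrightarrow> c \<in> A \<Longrightarrow> a \<le> b \<Longrightarrow> b \<le> c \<Longrightarrow> b \<in> A"
     "\<And>a b c. a \<in> B \<Longrightarrow> c \<in> B \<Longrightarrow> a \<le> b \<Longrightarrow> b \<le> c \<Longrightarrow> b \<in> B"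
    using assms(1,2) unfolding is_interval_1 by blast+
  have n: "y \<notin> A" "x' \<notin> B" using h assms(3) by auto
  have "y < x'" using I(1)[of x' x y] h n(1) by linarith
  then show False using I(2)[of y y' x'] n(2) h by linarith
qed

lemma interval_image_contraction:
  fixes \<phi> :: "real \<Rightarrow> real"
  assumes "is_interval S" "\<And>u v. u \<in> S \<Longrightarrow> v \<in> S \<Longrightarrow> \<bar>\<phi> u - \<phi> v\<bar> \<le> \<bar>u - v\<bar>"
  shows "is_interval (\<phi> ` S)"
proof -
  have "continuous_on S \<phi>"
    unfolding continuous_on_iff dist_real_def
    using assms(2) by (meson order.strict_trans1)
  then show ?thesis
    using assms(1) connected_continuous_image is_interval_connected_1 by blast
qed

text \<open>Cutting \<open>b\<^sub>1\<close> once more gives three consecutive pieces: the images of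
  \<open>b\<close> and of \<open>b'\<close> under \<open>\<phi>\<^sub>1\<close>, and then
  \<open>b\<^sub>2\<close>. The outer two are the targets of \<open>\<psi>\<^sub>1\<close> and
  \<open>\<phi>\<^sub>2\<close>; they are a definite distance apart, so these two maps generate
  separated points. The middle one is the target of \<open>\<psi>\<close>, whose fixed point is
  \<open>x\<^sub>0\<close>; powers of \<open>\<psi>\<close> carry the separated points close to
  \<open>x\<^sub>0\<close>.\<close>

lemma two_ordered_full_branches_separated:
  fixes F :: "real \<Rightarrow> real"
  assumes I: "is_interval I" "bounded I"
    and b1: "open b\<^sub>1" "is_interval b\<^sub>1" "b\<^sub>1 \<noteq> {}" "b\<^sub>1 \<subseteq> I" "F ` b\<^sub>1 = I"
    and b2: "open b\<^sub>2" "is_interval b\<^sub>2" "b\<^sub>2 \<noteq> {}" "b\<^sub>2 \<subseteq> I" "F ` b\<^sub>2 = I"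
    and ord: "\<And>x y. x \<in> b\<^sub>1 \<Longrightarrow> y \<in> b\<^sub>2 \<Longrightarrow> x < y"
    and \<kappa>: "1 < \<kappa>"
    and exp1: "\<And>s t. s \<in> b\<^sub>1 \<Longrightarrow> t \<in> b\<^sub>1 \<Longrightarrow> \<kappa> * \<bar>s - t\<bar> \<le> \<bar>F s - F t\<bar> \<and> \<bar>F s - F t\<bar> \<le> M * \<bar>s - t\<bar>"
    and exp2: "\<And>s t. s \<in> b\<^sub>2 \<Longrightarrow> t \<in> b\<^sub>2 \<Longrightarrow> \<kappa> * \<bar>s - t\<bar> \<le> \<bar>F s - F t\<bar> \<and> \<bar>F s - F t\<bar> \<le> M * \<bar>s - t\<bar>"
  defines "K \<equiv> {s \<in> I. \<forall>n. (F ^^ n) s \<in> b\<^sub>1 \<union> b\<^sub>2}"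
  shows "\<exists>x\<^sub>0\<in>K. \<forall>\<delta>>0. \<exists>c \<mu>. 0 < c \<and> 0 < \<mu> \<and> \<mu> < 1 \<and>
    (\<forall>n::nat. \<exists>P. finite P \<and> P \<subseteq> K \<inter> ball x\<^sub>0 \<delta> \<and> card P = 2 ^ n \<and>
      (\<forall>x\<in>P. \<forall>y\<in>P. x \<noteq> y \<longrightarrow> c * \<mu> ^ n \<le> \<bar>x - y\<bar>))"
proof -
  define \<phi>\<^sub>1 where "\<phi>\<^sub>1 = inv_into b\<^sub>1 F"
  define \<phi>\<^sub>2 where "\<phi>\<^sub>2 = inv_into b\<^sub>2 F"
  have \<phi>: "\<phi>\<^sub>1 u \<in> b\<^sub>1" "F (\<phi>\<^sub>1 u) = u" "\<phi>\<^sub>2 u \<in> b\<^sub>2" "F (\<phi>\<^sub>2 u) = u" if "u \<in> I" for u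
    using that b1(5) b2(5) unfolding \<phi>\<^sub>1_def \<phi>\<^sub>2_def
    by (auto intro: inv_into_into f_inv_into_f)
  have \<phi>I: "\<phi>\<^sub>1 u \<in> I" "\<phi>\<^sub>2 u \<in> I" if "u \<in> I" for u using \<phi>[OF that] b1(4) b2(4) by auto
  obtain s where s: "s \<in> b\<^sub>1" using b1(3) by blast
  obtain t where t: "t \<in> b\<^sub>1" "s < t"
  proof -
    obtain e where e: "e > 0" "ball s e \<subseteq> b\<^sub>1" using b1(1) s by (meson openE)
    then have "s + e / 2 \<in> b\<^sub>1" by (intro subsetD[OF e(2)]) (auto simp: dist_real_def)
    then show ?thesis using that e(1) by (metis half_gt_zero less_add_same_cancel1)
  qed
  have "\<kappa> * \<bar>s - t\<bar> \<le> M * \<bar>s - t\<bar>" using exp1[OF s t(1)] by linarith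
  then have M: "1 < M" using t(2) \<kappa> by simp
  have lo: "\<bar>u - v\<bar> / M \<le> \<bar>\<phi>\<^sub>1 u - \<phi>\<^sub>1 v\<bar>" "\<bar>u - v\<bar> / M \<le> \<bar>\<phi>\<^sub>2 u - \<phi>\<^sub>2 v\<bar>" if "u \<in> I" "v \<in> I" for u v
    using exp1[OF \<phi>(1)[OF that(1)] \<phi>(1)[OF that(2)]] exp2[OF \<phi>(3)[OF that(1)] \<phi>(3)[OF that(2)]] M \<phi>[OF that(1)] \<phi>[OF that(2)]
    by (simp_all add: pos_divide_le_eq mult.commute)
  have up: "\<bar>\<phi>\<^sub>1 u - \<phi>\<^sub>1 v\<bar> \<le> \<bar>u - v\<bar> / \<kappa>" "\<bar>\<phi>\<^sub>2 u - \<phi>\<^sub>2 v\<bar> \<le> \<bar>u - v\<bar> / \<kappa>" if "u \<in> I" "v \<in> I" for u v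
    using exp1[OF \<phi>(1)[OF that(1)] \<phi>(1)[OF that(2)]] exp2[OF \<phi>(3)[OF that(1)] \<phi>(3)[OF that(2)]] \<kappa> \<phi>[OF that(1)] \<phi>[OF that(2)]
    by (simp_all add: pos_le_divide_eq mult.commute)
  have le: "\<bar>u - v\<bar> / \<kappa> \<le> \<bar>u - v\<bar>" for u v :: real
  proof -
    have "\<bar>u - v\<bar> * 1 \<le> \<bar>u - v\<bar> * \<kappa>" using \<kappa> by (intro mult_left_mono) auto
    then show ?thesis using \<kappa> by (simp add: pos_divide_le_eq)
  qed
  have \<phi>K: "\<phi>\<^sub>1 u \<in> K" "\<phi>\<^sub>2 u \<in> K" if u: "u \<in> K" for u
  proof -
    have uI: "u \<in> I" and un: "\<And>n. (F ^^ n) u \<in> b\<^sub>1 \<union> b\<^sub>2" using u by (auto simp: K_def)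
    have "(F ^^ n) w \<in> b\<^sub>1 \<union> b\<^sub>2" if "w \<in> b\<^sub>1 \<union> b\<^sub>2" "F w = u" for n w
      using that un by (cases n) (simp_all add: funpow_swap1 del: funpow.simps(2) add: funpow_Suc_right)
    then show "\<phi>\<^sub>1 u \<in> K" "\<phi>\<^sub>2 u \<in> K" using \<phi>[OF uI] \<phi>I[OF uI] by (auto simp: K_def)
  qed
  have KI: "K \<subseteq> I" by (auto simp: K_def)
  have iv: "is_interval (\<phi>\<^sub>1 ` b)" if "is_interval b" "b \<subseteq> I" for b
    using that up(1) le by (intro interval_image_contraction) (meson order.trans subsetD)+
  have dj: "\<phi>\<^sub>1 ` b\<^sub>1 \<inter> \<phi>\<^sub>1 ` b\<^sub>2 = {}"
  proof (rule ccontr)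
    assume "\<not> ?thesis"
    then obtain u v where uv: "u \<in> b\<^sub>1" "v \<in> b\<^sub>2" "\<phi>\<^sub>1 u = \<phi>\<^sub>1 v" by blast
    then have "u = v" using \<phi>(2) b1(4) b2(4) by (metis subsetD)
    then show False using ord[OF uv(1,2)] by simp
  qed
  \<comment> \<open>This absorbs the orientation of \<open>\<phi>\<^sub>1\<close>: \<open>b\<close>
    is the one of the two intervals that \<open>\<phi>\<^sub>1\<close> sends to the left, and
    \<open>\<beta>\<close>, \<open>\<beta>'\<close> are the inverse branches into \<open>b\<close>,
    \<open>b'\<close>.\<close>
  obtain b b' \<beta> \<beta>' where A: "\<And>x y. x \<in> \<phi>\<^sub>1 ` b \<Longrightarrow> y \<in> \<phi>\<^sub>1 ` b' \<Longrightarrow> x < y"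
    and \<beta>: "(b, \<beta>) \<in> {(b\<^sub>1, \<phi>\<^sub>1), (b\<^sub>2, \<phi>\<^sub>2)}" "(b', \<beta>') \<in> {(b\<^sub>1, \<phi>\<^sub>1), (b\<^sub>2, \<phi>\<^sub>2)}"
  proof -
    consider "\<forall>x\<in>\<phi>\<^sub>1 ` b\<^sub>1. \<forall>y\<in>\<phi>\<^sub>1 ` b\<^sub>2. x < y" | "\<forall>x\<in>\<phi>\<^sub>1 ` b\<^sub>1. \<forall>y\<in>\<phi>\<^sub>1 ` b\<^sub>2. y < x"
      using disjoint_intervals_ordered[OF iv[OF b1(2,4)] iv[OF b2(2,4)] dj] by argo
    then show ?thesis
    proof cases
      case 1 then show ?thesis by (intro that[of b\<^sub>1 b\<^sub>2 \<phi>\<^sub>1 \<phi>\<^sub>2]) (auto simp del: image_iff)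
    next
      case 2 then show ?thesis by (intro that[of b\<^sub>2 b\<^sub>1 \<phi>\<^sub>2 \<phi>\<^sub>1]) (auto simp del: image_iff)
    qed
  qed
  have \<beta>p: "\<beta> u \<in> b" "\<beta>' u \<in> b'" "\<beta> u \<in> I" "\<beta>' u \<in> I" "F (\<beta>' u) = u" if "u \<in> I" for u
    using \<beta> \<phi>[OF that] \<phi>I[OF that] by auto
  have \<beta>lo: "\<bar>u - v\<bar> / M \<le> \<bar>\<beta> u - \<beta> v\<bar>" "\<bar>u - v\<bar> / M \<le> \<bar>\<beta>' u - \<beta>' v\<bar>"
    "\<bar>\<beta>' u - \<beta>' v\<bar> \<le> \<bar>u - v\<bar>" if "u \<in> I" "v \<in> I" for u v
    using \<beta> lo[OF that] order.trans[OF up(1)[OF that] le] order.trans[OF up(2)[OF that] le] by auto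
  have \<beta>K: "\<beta> u \<in> K" "\<beta>' u \<in> K" if "u \<in> K" for u using \<beta> \<phi>K[OF that] by auto
  have b': "open b'" "b' \<noteq> {}" "b' \<subseteq> I" using \<beta>(2) b1 b2 by auto
  define \<psi> where "\<psi> = (\<lambda>u. \<phi>\<^sub>1 (\<beta>' u))"
  define \<psi>\<^sub>1 where "\<psi>\<^sub>1 = (\<lambda>u. \<phi>\<^sub>1 (\<beta> u))"
  \<comment> \<open>Each inverse branch shrinks distances by at most the factor \<open>M\<close>,
    and both \<open>\<psi>\<close> and \<open>\<psi>\<^sub>1\<close> apply two of them. The single
    branch \<open>\<phi>\<^sub>2\<close> satisfies this weaker bound as well.\<close>
  define \<mu> where "\<mu> = 1 / M / M"
  have \<mu>: "0 < \<mu>" "\<mu> < 1" "\<mu> \<le> 1 / M"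
    using M less_1_mult[of M M] by (simp_all add: \<mu>_def field_simps)
  obtain u u' where u: "u \<in> \<phi>\<^sub>1 ` b'" "u' \<in> \<phi>\<^sub>1 ` b'" "u < u'"
  proof -
    obtain s where s: "s \<in> b'" using b'(2) by blast
    obtain e where e: "e > 0" "ball s e \<subseteq> b'" using b'(1) s by (meson openE)
    then have t: "s + e / 2 \<in> b'" by (intro subsetD[OF e(2)]) (auto simp: dist_real_def)
    have "\<phi>\<^sub>1 s \<noteq> \<phi>\<^sub>1 (s + e / 2)" using \<phi>(2) s t b'(3) e(1)
      by (metis add_cancel_left_right half_gt_zero less_irrefl subsetD)
    then show ?thesis using that s t by (metis image_eqI linorder_neqE_linordered_idom)
  qed
  have c1: "\<mu> * \<bar>x - y\<bar> \<le> \<bar>\<psi>\<^sub>1 x - \<psi>\<^sub>1 y\<bar>" if "x \<in> I" "y \<in> I" for x y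
  proof -
    have "\<mu> * \<bar>x - y\<bar> = \<bar>x - y\<bar> / M / M" by (simp add: \<mu>_def)
    also have "\<dots> \<le> \<bar>\<beta> x - \<beta> y\<bar> / M" using \<beta>lo(1)[OF that] M by (intro divide_right_mono) auto
    also have "\<dots> \<le> \<bar>\<psi>\<^sub>1 x - \<psi>\<^sub>1 y\<bar>" unfolding \<psi>\<^sub>1_def by (intro lo(1) \<beta>p that)
    finally show ?thesis .
  qed
  have c0: "\<mu> * \<bar>x - y\<bar> \<le> \<bar>\<psi> x - \<psi> y\<bar>" if "x \<in> I" "y \<in> I" for x y
  proof -
    have "\<mu> * \<bar>x - y\<bar> = \<bar>x - y\<bar> / M / M" by (simp add: \<mu>_def)
    also have "\<dots> \<le> \<bar>\<beta>' x - \<beta>' y\<bar> / M" using \<beta>lo(2)[OF that] M by (intro divide_right_mono) auto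
    also have "\<dots> \<le> \<bar>\<psi> x - \<psi> y\<bar>" unfolding \<psi>_def by (intro lo(1) \<beta>p that)
    finally show ?thesis .
  qed
  have c2: "\<mu> * \<bar>x - y\<bar> \<le> \<bar>\<phi>\<^sub>2 x - \<phi>\<^sub>2 y\<bar>" if "x \<in> I" "y \<in> I" for x y
    using mult_right_mono[OF \<mu>(3), of "\<bar>x - y\<bar>"] lo(2)[OF that] by auto
  have contr: "\<bar>\<psi> x - \<psi> y\<bar> \<le> 1 / \<kappa> * \<bar>x - y\<bar>" if "x \<in> I" "y \<in> I" for x y
  proof -
    have "\<bar>\<psi> x - \<psi> y\<bar> \<le> \<bar>\<beta>' x - \<beta>' y\<bar> / \<kappa>" unfolding \<psi>_def by (intro up(1) \<beta>p that)
    also have "\<dots> \<le> \<bar>x - y\<bar> / \<kappa>" using \<beta>lo(3)[OF that] \<kappa> by (intro divide_right_mono) auto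
    finally show ?thesis by simp
  qed
  obtain z where z: "z \<in> b\<^sub>2" using b2(3) by blast
  have zI: "z \<in> I" using z b2(4) by blast
  \<comment> \<open>\<open>I\<close> need not be closed, so the fixed point theorem is applied on
    \<open>{a..z}\<close>: the values of \<open>\<psi>\<close> lie in the middle piece, hence to the
    right of \<open>\<psi>\<^sub>1 z\<close> and to the left of \<open>z\<close>, a point of
    \<open>b\<^sub>2\<close>.\<close>
  define a where "a = \<psi>\<^sub>1 z"
  have aI: "a \<in> I" unfolding a_def \<psi>\<^sub>1_def by (intro \<phi>I \<beta>p zI)
  have acI: "{a..z} \<subseteq> I" by (rule subsetI, rule mem_is_interval_1_I[OF I(1) aI zI]) simp_all
  have mid: "a < \<psi> x \<and> \<psi> x < z" if "x \<in> I" for x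
    unfolding a_def \<psi>\<^sub>1_def \<psi>_def
    using A[OF imageI[OF \<beta>p(1)[OF zI]] imageI[OF \<beta>p(2)[OF that]]] ord[OF \<phi>(1)[OF \<beta>p(4)[OF that]] z] ..
  have az: "a < z" using mid[OF zI] by linarith
  have "\<exists>!x\<in>{a..z}. \<psi> x = x"
  proof (rule Banach_fix)
    show "\<psi> ` {a..z} \<subseteq> {a..z}" using mid acI by (force simp: less_imp_le)
    show "dist (\<psi> x) (\<psi> y) \<le> 1 / \<kappa> * dist x y" if "x \<in> {a..z}" "y \<in> {a..z}" for x y
      unfolding dist_real_def using that acI by (intro contr) auto
  qed (use \<kappa> az in \<open>auto simp: complete_eq_closed\<close>)
  then obtain x\<^sub>0 where x0: "x\<^sub>0 \<in> {a..z}" "\<psi> x\<^sub>0 = x\<^sub>0" by blast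
  have x0I: "x\<^sub>0 \<in> I" using x0 acI by blast
  have Fx0: "F x\<^sub>0 = \<beta>' x\<^sub>0" using x0(2) \<phi>(2)[OF \<beta>p(4)[OF x0I]] by (simp add: \<psi>_def)
  have in1: "x\<^sub>0 \<in> b\<^sub>1" using x0(2) \<phi>(1)[OF \<beta>p(4)[OF x0I]] by (simp add: \<psi>_def)
  have in2: "\<beta>' x\<^sub>0 \<in> b\<^sub>1 \<union> b\<^sub>2" using \<beta>p(2)[OF x0I] \<beta>(2) by auto
  \<comment> \<open>\<open>F\<close> exchanges \<open>x\<^sub>0\<close> and
    \<open>\<beta>' x\<^sub>0\<close>, and both lie in the two branches.\<close>
  have "(F ^^ n) x\<^sub>0 \<in> {x\<^sub>0, \<beta>' x\<^sub>0}" for n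
    by (induction n) (use Fx0 \<beta>p(5)[OF x0I] in auto)
  then have x0K: "x\<^sub>0 \<in> K" unfolding K_def using x0I in1 in2 by (smt (verit) UnI1 insertE mem_Collect_eq singletonD)
  have \<psi>K: "\<psi> x \<in> K" "\<psi>\<^sub>1 x \<in> K" if "x \<in> K" for x unfolding \<psi>_def \<psi>\<^sub>1_def by (intro \<phi>K \<beta>K that)+
  \<comment> \<open>Both \<open>u\<close> and \<open>u'\<close> are in the middle piece, so they
    separate the two images.\<close>
  have gap: "u' - u \<le> \<bar>\<psi>\<^sub>1 x - \<phi>\<^sub>2 y\<bar>" if "x \<in> K" "y \<in> K" for x y
  proof -
    have xy: "x \<in> I" "y \<in> I" using that KI by auto
    have "\<psi>\<^sub>1 x < u" unfolding \<psi>\<^sub>1_def using \<beta>p(1)[OF xy(1)] u by (intro A) auto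
    moreover have "u' < \<phi>\<^sub>2 y"
      using u(2) b'(3) \<phi>(1) \<phi>(3)[OF xy(2)] by (intro ord) auto
    ultimately show ?thesis by linarith
  qed
  have sep: "\<exists>P. finite P \<and> P \<subseteq> K \<and> card P = 2 ^ n \<and>
      (\<forall>x\<in>P. \<forall>y\<in>P. x \<noteq> y \<longrightarrow> (u' - u) * \<mu> ^ n \<le> \<bar>x - y\<bar>)" for n
    using x0K \<psi>K(2) \<phi>K(2) u(3) \<mu>(1,2) gap
    by (intro separated_points_of_two_contractions[of K \<psi>\<^sub>1 \<phi>\<^sub>2] c1 c2 subsetD[OF KI]) auto
  obtain D where D: "\<And>x. x \<in> I \<Longrightarrow> \<bar>x - x\<^sub>0\<bar> \<le> D"
    using I(2) unfolding bounded_any_center[of I x\<^sub>0] dist_real_def by (metis abs_minus_commute)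
  have D0: "D \<ge> 0" using D[OF x0I] by simp
  have itK: "(\<psi> ^^ m) x \<in> K" if "x \<in> K" for m x by (induction m) (use that \<psi>K in auto)
  have itup: "\<bar>(\<psi> ^^ m) x - x\<^sub>0\<bar> \<le> (1 / \<kappa>) ^ m * D" if x: "x \<in> K" for m x
  proof (induction m)
    case 0 then show ?case using D x KI by auto
  next
    case (Suc m)
    have "\<bar>(\<psi> ^^ Suc m) x - x\<^sub>0\<bar> = \<bar>\<psi> ((\<psi> ^^ m) x) - \<psi> x\<^sub>0\<bar>" by (simp add: x0(2))
    also have "\<dots> \<le> 1 / \<kappa> * \<bar>(\<psi> ^^ m) x - x\<^sub>0\<bar>" using itK[OF x] KI x0I by (intro contr) auto
    also have "\<dots> \<le> 1 / \<kappa> * ((1 / \<kappa>) ^ m * D)" using Suc \<kappa> by (intro mult_left_mono) auto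
    finally show ?case by simp
  qed
  have itlo: "\<mu> ^ m * \<bar>x - y\<bar> \<le> \<bar>(\<psi> ^^ m) x - (\<psi> ^^ m) y\<bar>" if xy: "x \<in> K" "y \<in> K" for m x y
  proof (induction m)
    case (Suc m)
    have "\<mu> ^ Suc m * \<bar>x - y\<bar> \<le> \<mu> * \<bar>(\<psi> ^^ m) x - (\<psi> ^^ m) y\<bar>"
      using Suc \<mu>(1) by (simp add: mult.assoc)
    also have "\<dots> \<le> \<bar>(\<psi> ^^ Suc m) x - (\<psi> ^^ Suc m) y\<bar>"
      using c0[of "(\<psi> ^^ m) x" "(\<psi> ^^ m) y"] itK[OF xy(1)] itK[OF xy(2)] KI by auto
    finally show ?case .
  qed simp
  have "\<exists>c \<mu>. 0 < c \<and> 0 < \<mu> \<and> \<mu> < 1 \<and>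
    (\<forall>n::nat. \<exists>P. finite P \<and> P \<subseteq> K \<inter> ball x\<^sub>0 \<delta> \<and> card P = 2 ^ n \<and>
      (\<forall>x\<in>P. \<forall>y\<in>P. x \<noteq> y \<longrightarrow> c * \<mu> ^ n \<le> \<bar>x - y\<bar>))" if \<delta>: "\<delta> > 0" for \<delta>
  proof -
    \<comment> \<open>Enough applications of \<open>\<psi>\<close> bring all of \<open>K\<close>
      within \<open>\<delta>\<close> of \<open>x\<^sub>0\<close>. They cost the fixed factor
      \<open>\<mu> ^ m\<close>, which goes into the constant \<open>c\<close>; the rate
      \<open>\<mu>\<close> stays the same.\<close>
    have "(\<lambda>m. (1 / \<kappa>) ^ m * D) \<longlonglongrightarrow> 0 * D" using \<kappa> by (intro tendsto_mult LIMSEQ_power_zero tendsto_const) auto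
    then have "\<forall>\<^sub>F m in sequentially. (1 / \<kappa>) ^ m * D < \<delta>" using \<delta> by (intro order_tendstoD) auto
    then obtain m where m: "(1 / \<kappa>) ^ m * D < \<delta>" by (meson eventually_sequentially order.refl)
    show ?thesis
    proof (rule exI[of _ "\<mu> ^ m * (u' - u)"], rule exI[of _ \<mu>], intro conjI allI)
      fix n
      obtain P where P: "finite P" "P \<subseteq> K" "card P = 2 ^ n"
        "\<forall>x\<in>P. \<forall>y\<in>P. x \<noteq> y \<longrightarrow> (u' - u) * \<mu> ^ n \<le> \<bar>x - y\<bar>" using sep[of n] by (elim exE conjE)
      have lo: "\<mu> ^ m * (u' - u) * \<mu> ^ n \<le> \<bar>(\<psi> ^^ m) x - (\<psi> ^^ m) y\<bar>" if "x \<in> P" "y \<in> P" "x \<noteq> y" for x y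
      proof -
        have "\<mu> ^ m * ((u' - u) * \<mu> ^ n) \<le> \<mu> ^ m * \<bar>x - y\<bar>" using P(4) that \<mu>(1) by (intro mult_left_mono) auto
        also have "\<dots> \<le> \<bar>(\<psi> ^^ m) x - (\<psi> ^^ m) y\<bar>" using that P(2) by (intro itlo) auto
        finally show ?thesis by (simp add: mult.assoc)
      qed
      have pos: "\<mu> ^ m * (u' - u) * \<mu> ^ n > 0" using \<mu>(1) u(3) by simp
      have "inj_on (\<psi> ^^ m) P" by (rule inj_onI, rule ccontr) (use lo pos in fastforce)
      then have "card ((\<psi> ^^ m) ` P) = 2 ^ n" by (simp add: card_image P(3))
      moreover have "(\<psi> ^^ m) ` P \<subseteq> K \<inter> ball x\<^sub>0 \<delta>"
      proof safe
        fix x assume "x \<in> P"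
        then have x: "x \<in> K" using P(2) by blast
        show "(\<psi> ^^ m) x \<in> K" by (rule itK[OF x])
        show "(\<psi> ^^ m) x \<in> ball x\<^sub>0 \<delta>" using itup[OF x, of m] m by (simp add: dist_real_def abs_minus_commute)
      qed
      moreover have "\<forall>x\<in>(\<psi> ^^ m) ` P. \<forall>y\<in>(\<psi> ^^ m) ` P. x \<noteq> y \<longrightarrow> \<mu> ^ m * (u' - u) * \<mu> ^ n \<le> \<bar>x - y\<bar>"
      proof (intro ballI impI)
        fix x y assume xy: "x \<in> (\<psi> ^^ m) ` P" "y \<in> (\<psi> ^^ m) ` P" "x \<noteq> y"
        then obtain x' y' where x'y': "x' \<in> P" "x = (\<psi> ^^ m) x'" "y' \<in> P" "y = (\<psi> ^^ m) y'" by blast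
        then have "x' \<noteq> y'" using xy(3) by blast
        then show "\<mu> ^ m * (u' - u) * \<mu> ^ n \<le> \<bar>x - y\<bar>" using lo[OF x'y'(1,3)] x'y'(2,4) by simp
      qed
      ultimately show "\<exists>P. finite P \<and> P \<subseteq> K \<inter> ball x\<^sub>0 \<delta> \<and> card P = 2 ^ n \<and>
         (\<forall>x\<in>P. \<forall>y\<in>P. x \<noteq> y \<longrightarrow> \<mu> ^ m * (u' - u) * \<mu> ^ n \<le> \<bar>x - y\<bar>)"
        using P(1) by (intro exI[of _ "(\<psi> ^^ m) ` P"] conjI finite_imageI)
    qed (use \<mu> u(3) in auto)
  qed
  then show ?thesis using x0K by blast
qed

lemma two_full_branches_separated:
  fixes F :: "real \<Rightarrow> real"
  assumes I: "is_interval I" "bounded I"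
    and b1: "open b\<^sub>1" "is_interval b\<^sub>1" "b\<^sub>1 \<noteq> {}" "b\<^sub>1 \<subseteq> I" "F ` b\<^sub>1 = I"
    and b2: "open b\<^sub>2" "is_interval b\<^sub>2" "b\<^sub>2 \<noteq> {}" "b\<^sub>2 \<subseteq> I" "F ` b\<^sub>2 = I"
    and dj: "b\<^sub>1 \<inter> b\<^sub>2 = {}"
    and \<kappa>: "1 < \<kappa>"
    and exp1: "\<And>s t. s \<in> b\<^sub>1 \<Longrightarrow> t \<in> b\<^sub>1 \<Longrightarrow> \<kappa> * \<bar>s - t\<bar> \<le> \<bar>F s - F t\<bar> \<and> \<bar>F s - F t\<bar> \<le> M * \<bar>s - t\<bar>"
    and exp2: "\<And>s t. s \<in> b\<^sub>2 \<Longrightarrow> t \<in> b\<^sub>2 \<Longrightarrow> \<kappa> * \<bar>s - t\<bar> \<le> \<bar>F s - F t\<bar> \<and> \<bar>F s - F t\<bar> \<le> M * \<bar>s - t\<bar>"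
  defines "K \<equiv> {s \<in> I. \<forall>n. (F ^^ n) s \<in> b\<^sub>1 \<union> b\<^sub>2}"
  shows "\<exists>x\<^sub>0\<in>K. \<forall>\<delta>>0. \<exists>c \<mu>. 0 < c \<and> 0 < \<mu> \<and> \<mu> < 1 \<and>
    (\<forall>n::nat. \<exists>P. finite P \<and> P \<subseteq> K \<inter> ball x\<^sub>0 \<delta> \<and> card P = 2 ^ n \<and>
      (\<forall>x\<in>P. \<forall>y\<in>P. x \<noteq> y \<longrightarrow> c * \<mu> ^ n \<le> \<bar>x - y\<bar>))"
proof -
  consider "\<forall>x\<in>b\<^sub>1. \<forall>y\<in>b\<^sub>2. x < y" | "\<forall>x\<in>b\<^sub>1. \<forall>y\<in>b\<^sub>2. y < x"
    using disjoint_intervals_ordered[OF b1(2) b2(2) dj] by argo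
  then show ?thesis
  proof cases
    case 1
    then show ?thesis unfolding K_def
      by (intro two_ordered_full_branches_separated[OF I b1 b2 _ \<kappa> exp1 exp2]) auto
  next
    case 2
    then show ?thesis unfolding K_def Un_commute[of b\<^sub>1]
      by (intro two_ordered_full_branches_separated[OF I b2 b1 _ \<kappa> exp2 exp1]) auto
  qed
qed

section \<open>Hoelder calculus of curves\<close>

definition holder_on :: "real \<Rightarrow> (real \<Rightarrow> 'a::real_normed_vector) \<Rightarrow> real set \<Rightarrow> bool" where
  "holder_on e g J \<longleftrightarrow> (\<exists>C. \<forall>s\<in>J. \<forall>t\<in>J. norm (g s - g t) \<le> C * \<bar>s - t\<bar> powr e)"

text \<open>\<open>C1_holder\<close> bounds the derivative on compact subsets only. Here the
  derivative is named and one Hoelder constant serves all of \<open>J\<close>, so that bounds can be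
  carried through compositions and changes of parameter.\<close>

definition holder_curve ::
  "real \<Rightarrow> (real \<Rightarrow> 'a::real_normed_vector) \<Rightarrow> (real \<Rightarrow> 'a) \<Rightarrow> real set \<Rightarrow> bool" where
  "holder_curve e \<gamma> \<gamma>' J \<longleftrightarrow>
     (\<forall>s\<in>J. (\<gamma> has_vector_derivative \<gamma>' s) (at s)) \<and> holder_on e \<gamma>' J"

lemma holder_onE:
  assumes "holder_on e g J"
  obtains C where "C \<ge> 0" "\<And>s t. s \<in> J \<Longrightarrow> t \<in> J \<Longrightarrow> norm (g s - g t) \<le> C * \<bar>s - t\<bar> powr e"
proof -
  obtain C where C: "\<And>s t. s \<in> J \<Longrightarrow> t \<in> J \<Longrightarrow> norm (g s - g t) \<le> C * \<bar>s - t\<bar> powr e"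
    using assms unfolding holder_on_def by blast
  have "norm (g s - g t) \<le> \<bar>C\<bar> * \<bar>s - t\<bar> powr e" if "s \<in> J" "t \<in> J" for s t
    by (rule order.trans[OF C[OF that]]) (intro mult_right_mono, auto)
  then show ?thesis using that[of "\<bar>C\<bar>"] by simp
qed

lemma holder_on_bounded:
  assumes "holder_on e g J" "bounded J" "0 \<le> e"
  obtains M where "M \<ge> 0" "\<And>s. s \<in> J \<Longrightarrow> norm (g s) \<le> M"
proof (cases "J = {}")
  case False
  then obtain t where t: "t \<in> J" by blast
  obtain C where C: "C \<ge> 0" "\<And>s t. s \<in> J \<Longrightarrow> t \<in> J \<Longrightarrow> norm (g s - g t) \<le> C * \<bar>s - t\<bar> powr e"
    using assms(1) by (rule holder_onE) blast
  obtain D where D: "\<And>s. s \<in> J \<Longrightarrow> \<bar>s - t\<bar> \<le> D"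
    using assms(2) unfolding bounded_any_center[of J t] dist_real_def by (metis abs_minus_commute)
  have "norm (g s) \<le> norm (g t) + C * D powr e" if s: "s \<in> J" for s
  proof -
    have "norm (g s) \<le> norm (g t) + norm (g s - g t)" by (metis norm_triangle_sub add.commute)
    also have "norm (g s - g t) \<le> C * \<bar>s - t\<bar> powr e" by (rule C(2)[OF s t])
    also have "\<dots> \<le> C * D powr e" using D[OF s] C(1) assms(3) by (intro mult_left_mono powr_mono2) auto
    finally show ?thesis by simp
  qed
  then show ?thesis using that[of "norm (g t) + C * D powr e"] C(1) by simp
qed (use that[of 0] in auto)

lemma holder_curve_lipschitz:
  assumes "holder_curve e \<gamma> \<gamma>' J" "bounded J" "convex J" "0 \<le> e"
  obtains M where "M \<ge> 0" "\<And>s t. s \<in> J \<Longrightarrow> t \<in> J \<Longrightarrow> norm (\<gamma> s - \<gamma> t) \<le> M * \<bar>s - t\<bar>"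
proof -
  obtain M where M: "M \<ge> 0" "\<And>s. s \<in> J \<Longrightarrow> norm (\<gamma>' s) \<le> M"
    using assms(1) unfolding holder_curve_def by (metis holder_on_bounded[OF _ assms(2,4)])
  have "norm (\<gamma> s - \<gamma> t) \<le> M * norm (s - t)" if "s \<in> J" "t \<in> J" for s t
  proof (rule differentiable_bound[OF assms(3) _ _ that])
    fix x assume x: "x \<in> J"
    show "(\<gamma> has_derivative (\<lambda>h. h *\<^sub>R \<gamma>' x)) (at x within J)"
      using assms(1) x unfolding holder_curve_def has_vector_derivative_def
      by (meson has_derivative_at_withinI)
    show "onorm (\<lambda>h. h *\<^sub>R \<gamma>' x) \<le> M"
    proof (rule onorm_le)
      show "norm (h *\<^sub>R \<gamma>' x) \<le> M * norm h" for h
        using mult_right_mono[OF M(2)[OF x], of "\<bar>h\<bar>"] by (simp add: mult.commute)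
    qed
  qed
  then show ?thesis using that M(1) by simp
qed

lemma holder_curve_subset: "holder_curve e \<gamma> \<gamma>' J \<Longrightarrow> J' \<subseteq> J \<Longrightarrow> holder_curve e \<gamma> \<gamma>' J'"
  unfolding holder_curve_def holder_on_def by blast

lemma powr_le_of_lipschitz:
  fixes e M :: real
  assumes "0 \<le> x" "x \<le> M * \<bar>s - t\<bar>" "0 \<le> M" "0 \<le> e"
  shows "x powr e \<le> M powr e * \<bar>s - t\<bar> powr e"
proof -
  have "x powr e \<le> (M * \<bar>s - t\<bar>) powr e" using assms by (intro powr_mono2) auto
  then show ?thesis using assms by (simp add: powr_mult)
qed

lemma C1_holderE:
  fixes G :: "'a::euclidean_space \<Rightarrow> 'b::euclidean_space"
  assumes "C1_holder e G B" "compact K" "K \<subseteq> B"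
  obtains G' :: "'a \<Rightarrow> 'a \<Rightarrow>\<^sub>L 'b" and C where "C \<ge> 0"
    "\<And>x. x \<in> B \<Longrightarrow> (G has_derivative blinfun_apply (G' x)) (at x)"
    "\<And>x y. x \<in> K \<Longrightarrow> y \<in> K \<Longrightarrow> norm (G' x - G' y) \<le> C * dist x y powr e"
proof -
  obtain G' :: "'a \<Rightarrow> 'a \<Rightarrow>\<^sub>L 'b" where G': "\<forall>x\<in>B. (G has_derivative blinfun_apply (G' x)) (at x)"
    "\<forall>K. compact K \<and> K \<subseteq> B \<longrightarrow> (\<exists>C. \<forall>x\<in>K. \<forall>y\<in>K. norm (G' x - G' y) \<le> C * dist x y powr e)"
    using assms(1) unfolding C1_holder_def by (elim exE conjE)
  obtain C where C: "\<forall>x\<in>K. \<forall>y\<in>K. norm (G' x - G' y) \<le> C * dist x y powr e"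
    using G'(2) assms(2,3) by auto
  have "norm (G' x - G' y) \<le> \<bar>C\<bar> * dist x y powr e" if "x \<in> K" "y \<in> K" for x y
  proof -
    have "norm (G' x - G' y) \<le> C * dist x y powr e" using C that by blast
    also have "\<dots> \<le> \<bar>C\<bar> * dist x y powr e" by (intro mult_right_mono) auto
    finally show ?thesis .
  qed
  then show ?thesis using that[of "\<bar>C\<bar>" G'] G'(1) by simp
qed

text \<open>On a bounded convex \<open>J\<close> the curve \<open>u\<close> is Lipschitz, so
  \<open>G'\<close> along \<open>u\<close> is Hoelder with the same exponent, and the derivative of
  the composite pairs two bounded Hoelder functions.\<close>

lemma holder_curve_compose:
  fixes u :: "real \<Rightarrow> 'a::euclidean_space" and G :: "'a \<Rightarrow> 'b::euclidean_space"
  assumes u: "holder_curve e u u' J" and J: "bounded J" "convex J" and e: "0 \<le> e"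
    and G: "C1_holder e G B" and K: "compact K" "K \<subseteq> B" "u ` J \<subseteq> K"
  shows "\<exists>w'. holder_curve e (\<lambda>s. G (u s)) w' J"
proof -
  obtain G' :: "'a \<Rightarrow> 'a \<Rightarrow>\<^sub>L 'b" and C0 where "C0 \<ge> 0"
    and G': "\<And>x. x \<in> B \<Longrightarrow> (G has_derivative blinfun_apply (G' x)) (at x)"
    and C0: "\<And>x y. x \<in> K \<Longrightarrow> y \<in> K \<Longrightarrow> norm (G' x - G' y) \<le> C0 * dist x y powr e"
    by (rule C1_holderE[OF G K(1,2)]) (rule that)
  obtain M where M: "M \<ge> 0" "\<And>s t. s \<in> J \<Longrightarrow> t \<in> J \<Longrightarrow> norm (u s - u t) \<le> M * \<bar>s - t\<bar>"
    using holder_curve_lipschitz[OF u J e] by blast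
  have "holder_on e (\<lambda>s. G' (u s)) J"
    unfolding holder_on_def
  proof (intro exI ballI)
    fix s t assume st: "s \<in> J" "t \<in> J"
    have "norm (G' (u s) - G' (u t)) \<le> C0 * dist (u s) (u t) powr e" using st K(3) by (intro C0) auto
    also have "\<dots> \<le> \<bar>C0\<bar> * dist (u s) (u t) powr e" by (intro mult_right_mono) auto
    also have "\<dots> \<le> \<bar>C0\<bar> * (M powr e * \<bar>s - t\<bar> powr e)"
      using M(2)[OF st] M(1) e by (intro mult_left_mono powr_le_of_lipschitz) (auto simp: dist_norm)
    finally show "norm (G' (u s) - G' (u t)) \<le> \<bar>C0\<bar> * M powr e * \<bar>s - t\<bar> powr e" by (simp add: mult.assoc)
  qed
  then obtain C1 M1 where C1: "C1 \<ge> 0" "\<And>s t. s \<in> J \<Longrightarrow> t \<in> J \<Longrightarrow> norm (G' (u s) - G' (u t)) \<le> C1 * \<bar>s - t\<bar> powr e"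
    and M1: "M1 \<ge> 0" "\<And>s. s \<in> J \<Longrightarrow> norm (G' (u s)) \<le> M1"
    by (metis holder_onE holder_on_bounded[OF _ J(1) e])
  have "holder_on e u' J" using u unfolding holder_curve_def by blast
  then obtain C2 M2 where C2: "C2 \<ge> 0" "\<And>s t. s \<in> J \<Longrightarrow> t \<in> J \<Longrightarrow> norm (u' s - u' t) \<le> C2 * \<bar>s - t\<bar> powr e"
    and M2: "M2 \<ge> 0" "\<And>s. s \<in> J \<Longrightarrow> norm (u' s) \<le> M2"
    by (metis holder_onE holder_on_bounded[OF _ J(1) e])
  have "holder_curve e (\<lambda>s. G (u s)) (\<lambda>s. G' (u s) (u' s)) J"
    unfolding holder_curve_def holder_on_def
  proof (intro conjI exI ballI)
    fix s assume s: "s \<in> J"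
    have "(u has_derivative (\<lambda>h. h *\<^sub>R u' s)) (at s)"
      using u s unfolding holder_curve_def has_vector_derivative_def by blast
    moreover have "(G has_derivative blinfun_apply (G' (u s))) (at (u s))" using s K by (intro G') auto
    ultimately have "((\<lambda>s. G (u s)) has_derivative (\<lambda>h. G' (u s) (h *\<^sub>R u' s))) (at s)"
      by (rule has_derivative_compose)
    then show "((\<lambda>s. G (u s)) has_vector_derivative G' (u s) (u' s)) (at s)"
      unfolding has_vector_derivative_def by (simp add: blinfun.scaleR_right)
  next
    fix s t assume st: "s \<in> J" "t \<in> J"
    have "G' (u s) (u' s) - G' (u t) (u' t) = (G' (u s) - G' (u t)) (u' s) + G' (u t) (u' s - u' t)"
      by (simp add: blinfun.diff_left blinfun.diff_right)
    then have "norm (G' (u s) (u' s) - G' (u t) (u' t))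
        \<le> norm (G' (u s) - G' (u t)) * norm (u' s) + norm (G' (u t)) * norm (u' s - u' t)"
      by (metis norm_triangle_le add_mono norm_blinfun)
    also have "\<dots> \<le> (C1 * \<bar>s - t\<bar> powr e) * M2 + M1 * (C2 * \<bar>s - t\<bar> powr e)"
      using C1 C2 M1 M2 st by (intro add_mono mult_mono) auto
    finally show "norm (G' (u s) (u' s) - G' (u t) (u' t)) \<le> (C1 * M2 + M1 * C2) * \<bar>s - t\<bar> powr e"
      by (simp add: algebra_simps)
  qed
  then show ?thesis by blast
qed

lemma C1_holder_of_holder_curve:
  fixes \<gamma> :: "real \<Rightarrow> 'a::euclidean_space"
  assumes "holder_curve e \<gamma> \<gamma>' J"
  shows "C1_holder e \<gamma> J"
  unfolding C1_holder_def
proof (intro exI[of _ "\<lambda>s. blinfun_scaleR_left (\<gamma>' s)"] conjI ballI allI impI)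
  fix s assume "s \<in> J"
  then show "(\<gamma> has_derivative blinfun_apply (blinfun_scaleR_left (\<gamma>' s))) (at s)"
    using assms unfolding holder_curve_def has_vector_derivative_def by simp
next
  fix K assume K: "compact K \<and> K \<subseteq> J"
  obtain C where C: "\<And>s t. s \<in> J \<Longrightarrow> t \<in> J \<Longrightarrow> norm (\<gamma>' s - \<gamma>' t) \<le> C * \<bar>s - t\<bar> powr e"
    using assms unfolding holder_curve_def holder_on_def by blast
  have "norm (blinfun_scaleR_left v - blinfun_scaleR_left w) \<le> norm (v - w)" for v w :: 'a
    by (rule norm_blinfun_bound) (simp_all add: blinfun.diff_left mult.commute flip: scaleR_diff_right)
  then show "\<exists>C. \<forall>x\<in>K. \<forall>y\<in>K. norm (blinfun_scaleR_left (\<gamma>' x) - blinfun_scaleR_left (\<gamma>' y)) \<le> C * dist x y powr e"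
    using C K unfolding dist_real_def by (meson order.trans subsetD)
qed

lemma holder_curve_of_C1_holder:
  fixes \<gamma> :: "real \<Rightarrow> 'a::euclidean_space"
  assumes "C1_holder e \<gamma> S" "J \<subseteq> K" "compact K" "K \<subseteq> S"
  shows "\<exists>\<gamma>'. holder_curve e \<gamma> \<gamma>' J"
proof -
  obtain h' :: "real \<Rightarrow> real \<Rightarrow>\<^sub>L 'a" and C where "C \<ge> 0"
    and h': "\<And>x. x \<in> S \<Longrightarrow> (\<gamma> has_derivative blinfun_apply (h' x)) (at x)"
    and C: "\<And>x y. x \<in> K \<Longrightarrow> y \<in> K \<Longrightarrow> norm (h' x - h' y) \<le> C * dist x y powr e"
    by (rule C1_holderE[OF assms(1,3,4)]) (rule that)
  have "holder_curve e \<gamma> (\<lambda>s. h' s 1) J"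
    unfolding holder_curve_def holder_on_def
  proof (intro conjI exI ballI)
    fix s assume "s \<in> J"
    then have "(\<gamma> has_derivative blinfun_apply (h' s)) (at s)" using assms by (intro h') auto
    moreover have "blinfun_apply (h' s) = (\<lambda>h. h *\<^sub>R h' s 1)"
      by (rule ext) (simp flip: blinfun.scaleR_right)
    ultimately show "(\<gamma> has_vector_derivative h' s 1) (at s)" unfolding has_vector_derivative_def by simp
  next
    fix s t assume "s \<in> J" "t \<in> J"
    then have "norm (h' s - h' t) \<le> C * dist s t powr e" using assms by (intro C) auto
    then show "norm (h' s 1 - h' t 1) \<le> C * \<bar>s - t\<bar> powr e"
      using norm_blinfun[of "h' s - h' t" 1] by (simp add: blinfun.diff_left dist_real_def)
  qed
  then show ?thesis by blast
qed

section \<open>Lipschitz and Hoelder bounds for differentiable maps\<close>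

lemma Ck_on_1_lipschitz:
  fixes A :: "'a::euclidean_space \<Rightarrow> 'b::real_normed_vector"
  assumes "Ck_on 1 A B" "compact K" "convex K" "K \<subseteq> B"
  obtains M where "M \<ge> 0" "\<And>x y. x \<in> K \<Longrightarrow> y \<in> K \<Longrightarrow> norm (A x - A y) \<le> M * norm (x - y)"
proof -
  have A: "\<And>x. x \<in> B \<Longrightarrow> A differentiable (at x)"
      "\<And>v. continuous_on B (\<lambda>x. frechet_derivative A (at x) v)"
    using assms(1) by auto
  have "\<exists>C. \<forall>x\<in>K. norm (frechet_derivative A (at x) v) \<le> C" for v
  proof -
    have "bounded ((\<lambda>x. frechet_derivative A (at x) v) ` K)"
      using A(2) assms(2,4) by (meson compact_continuous_image compact_imp_bounded continuous_on_subset)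
    then show ?thesis unfolding bounded_iff by auto
  qed
  then obtain C where C: "\<And>v x. x \<in> K \<Longrightarrow> norm (frechet_derivative A (at x) v) \<le> C v" by metis
  \<comment> \<open>\<open>Ck_on\<close> controls one direction at a time; the operator norm of the
    derivative is bounded by the sum of its norms on the basis vectors.\<close>
  define M where "M = (\<Sum>b\<in>Basis. \<bar>C b\<bar>)"
  have "norm (A x - A y) \<le> M * norm (x - y)" if "x \<in> K" "y \<in> K" for x y
  proof (rule differentiable_bound[OF assms(3) _ _ that])
    fix z assume z: "z \<in> K"
    have d: "(A has_derivative frechet_derivative A (at z)) (at z)"
      using A(1) z assms(4) frechet_derivative_works by blast
    then show "(A has_derivative frechet_derivative A (at z)) (at z within K)"
      by (rule has_derivative_at_withinI)
    have "onorm (frechet_derivative A (at z)) \<le> (\<Sum>b\<in>Basis. norm (frechet_derivative A (at z) b))"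
      by (rule onorm_componentwise[OF has_derivative_bounded_linear[OF d]])
    also have "\<dots> \<le> M" unfolding M_def by (intro sum_mono) (meson C[OF z] abs_ge_self order.trans)
    finally show "onorm (frechet_derivative A (at z)) \<le> M" .
  qed
  then show ?thesis using that[of M] unfolding M_def by (simp add: sum_nonneg)
qed

text \<open>This serves to compose the smooth flow with curves that are merely of class C^(1+e). The
  derivative is Lipschitz on balls, and on a bounded set a Lipschitz bound is a Hoelder bound
  because \<open>e \<le> 1\<close>.\<close>

lemma smooth_on_imp_C1_holder:
  fixes G :: "'a::euclidean_space \<Rightarrow> 'b::euclidean_space"
  assumes "smooth_on G UNIV" "0 < e" "e \<le> 1"
  shows "C1_holder e G UNIV"
proof -
  have "Ck_on (Suc (Suc 0)) G UNIV" using assms(1) unfolding smooth_on_def by blast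
  then have G: "\<And>x. G differentiable (at x)" and G1: "\<And>v. Ck_on 1 (\<lambda>x. frechet_derivative G (at x) v) UNIV"
    by auto
  have d: "(G has_derivative frechet_derivative G (at x)) (at x)" for x
    using G frechet_derivative_works by blast
  define h' where "h' x = Blinfun (frechet_derivative G (at x))" for x
  have h': "blinfun_apply (h' x) = frechet_derivative G (at x)" for x
    unfolding h'_def using d by (intro bounded_linear_Blinfun_apply has_derivative_bounded_linear)
  show ?thesis unfolding C1_holder_def
  proof (intro exI[of _ h'] conjI ballI allI impI)
    fix x show "(G has_derivative blinfun_apply (h' x)) (at x)" using d by (simp add: h')
  next
    fix K :: "'a set" assume K: "compact K \<and> K \<subseteq> UNIV"
    then have "bounded K" using compact_imp_bounded by blast
    then obtain R where R: "K \<subseteq> cball 0 R" using bounded_subset_ballD[of K 0] ball_subset_cball by (metis order.trans)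
    have "\<exists>M. \<forall>x\<in>cball 0 R. \<forall>y\<in>cball 0 R.
        norm (frechet_derivative G (at x) v - frechet_derivative G (at y) v) \<le> M * norm (x - y)" for v
      using Ck_on_1_lipschitz[OF G1[of v], of "cball 0 R"] by (metis compact_cball convex_cball subset_UNIV)
    then obtain M where M: "\<And>v x y. x \<in> cball 0 R \<Longrightarrow> y \<in> cball 0 R \<Longrightarrow>
        norm (frechet_derivative G (at x) v - frechet_derivative G (at y) v) \<le> M v * norm (x - y)" by metis
    define C where "C = (\<Sum>b\<in>Basis. \<bar>M b\<bar>)"
    have C0: "C \<ge> 0" unfolding C_def by (intro sum_nonneg) auto
    have "norm (h' x - h' y) \<le> C * (2 * R) powr (1 - e) * dist x y powr e" if "x \<in> K" "y \<in> K" for x y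
    proof -
      have xy: "x \<in> cball 0 R" "y \<in> cball 0 R" using that R by auto
      have "norm (h' x - h' y) \<le> (\<Sum>b\<in>Basis. norm ((h' x - h' y) b))"
        unfolding norm_blinfun.rep_eq by (intro onorm_componentwise blinfun.bounded_linear_right)
      also have "\<dots> \<le> (\<Sum>b\<in>Basis. \<bar>M b\<bar> * norm (x - y))"
      proof (intro sum_mono)
        fix b
        have "norm ((h' x - h' y) b) \<le> M b * norm (x - y)" using M[OF xy, of b] by (simp add: blinfun.diff_left h')
        also have "\<dots> \<le> \<bar>M b\<bar> * norm (x - y)" by (intro mult_right_mono) auto
        finally show "norm ((h' x - h' y) b) \<le> \<bar>M b\<bar> * norm (x - y)" .
      qed
      also have "\<dots> = C * dist x y" by (simp add: C_def sum_distrib_right dist_norm)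
      also have "dist x y \<le> (2 * R) powr (1 - e) * dist x y powr e"
      proof (cases "x = y")
        case False
        then have "dist x y = dist x y powr (1 - e) * dist x y powr e"
          by (simp flip: powr_add)
        also have "\<dots> \<le> (2 * R) powr (1 - e) * dist x y powr e"
        proof (intro mult_right_mono powr_mono2)
          have "dist x y \<le> dist x 0 + dist 0 y" by (rule dist_triangle)
          then show "dist x y \<le> 2 * R" using xy by (simp add: dist_commute)
        qed (use assms in auto)
        finally show ?thesis .
      qed simp
      finally show ?thesis using C0 by (simp add: mult_left_mono mult.assoc)
    qed
    then show "\<exists>C. \<forall>x\<in>K. \<forall>y\<in>K. norm (h' x - h' y) \<le> C * dist x y powr e" by blast
  qed
qed

lemma C1_holder_lipschitz:
  fixes G :: "'a::euclidean_space \<Rightarrow> 'b::euclidean_space"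
  assumes "C1_holder e G B" "0 \<le> e" "compact K" "convex K" "K \<subseteq> B"
  obtains M where "M \<ge> 0" "\<And>x y. x \<in> K \<Longrightarrow> y \<in> K \<Longrightarrow> norm (G x - G y) \<le> M * norm (x - y)"
proof (cases "K = {}")
  case False
  then obtain x0 where x0: "x0 \<in> K" by blast
  obtain G' :: "'a \<Rightarrow> 'a \<Rightarrow>\<^sub>L 'b" and C0 where "C0 \<ge> 0"
    and G': "\<And>x. x \<in> B \<Longrightarrow> (G has_derivative blinfun_apply (G' x)) (at x)"
    and C0: "\<And>x y. x \<in> K \<Longrightarrow> y \<in> K \<Longrightarrow> norm (G' x - G' y) \<le> C0 * dist x y powr e"
    by (rule C1_holderE[OF assms(1,3,5)]) (rule that)
  obtain D where D: "\<And>x. x \<in> K \<Longrightarrow> dist x x0 \<le> D"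
    using compact_imp_bounded[OF assms(3)] unfolding bounded_any_center[of K x0] by (metis dist_commute)
  define M where "M = norm (G' x0) + \<bar>C0\<bar> * D powr e"
  have "norm (G x - G y) \<le> M * norm (x - y)" if "x \<in> K" "y \<in> K" for x y
  proof (rule differentiable_bound[OF assms(4) _ _ that])
    fix z assume z: "z \<in> K"
    then show "(G has_derivative blinfun_apply (G' z)) (at z within K)"
      using G' assms(5) by (meson has_derivative_at_withinI subsetD)
    have "norm (G' z) \<le> norm (G' x0) + norm (G' z - G' x0)" by (metis norm_triangle_sub add.commute)
    also have "norm (G' z - G' x0) \<le> C0 * dist z x0 powr e" by (rule C0[OF z x0])
    also have "\<dots> \<le> \<bar>C0\<bar> * D powr e" using D[OF z] assms(2) by (intro mult_mono powr_mono2) auto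
    finally show "onorm (blinfun_apply (G' z)) \<le> M" by (simp add: M_def norm_blinfun.rep_eq)
  qed
  then show ?thesis using that[of M] unfolding M_def by simp
qed (use that[of 0] in auto)

lemma holder_on_subset: "holder_on e g J \<Longrightarrow> J' \<subseteq> J \<Longrightarrow> holder_on e g J'"
  unfolding holder_on_def by blast

lemma C1_holder_differentiable:
  assumes "C1_holder e G B" "x \<in> B"
  shows "G differentiable (at x)"
proof -
  obtain h' where h': "\<forall>x\<in>B. (G has_derivative blinfun_apply (h' x)) (at x)"
    using assms(1) unfolding C1_holder_def by (elim exE conjE)
  show ?thesis unfolding differentiable_def by (rule exI, rule bspec[OF h' assms(2)])
qed

text \<open>Unstable curves are parametrized by their projection, so the image of one under the
  Poincare map needs a new parameter; \<open>v\<close> will be the projection along that image. The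
  lower bound on \<open>v'\<close> makes the inverse of \<open>v\<close> Lipschitz, and so the new
  derivative is again Hoelder.\<close>

lemma holder_curve_reparametrize:
  fixes v v' :: "real \<Rightarrow> real" and \<phi> :: "real \<Rightarrow> 'a::real_normed_vector"
  assumes \<phi>: "holder_curve e \<phi> \<phi>' J" and v: "holder_curve e v v' J"
    and J: "open J" "is_interval J" "bounded J" and e: "0 \<le> e"
    and m: "0 < m" "\<And>s. s \<in> J \<Longrightarrow> m \<le> \<bar>v' s\<bar>"
  shows "inj_on v J" "open (v ` J)" "is_interval (v ` J)"
    "\<exists>w'. holder_curve e (\<lambda>t. \<phi> (inv_into J v t)) w' (v ` J)"
    "\<And>t t'. t \<in> v ` J \<Longrightarrow> t' \<in> v ` J \<Longrightarrow> m * \<bar>inv_into J v t - inv_into J v t'\<bar> \<le> \<bar>t - t'\<bar>"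
proof -
  have dv: "(v has_real_derivative v' s) (at s)" if "s \<in> J" for s
    using v that unfolding holder_curve_def has_real_derivative_iff_has_vector_derivative by blast
  have lt: "m * \<bar>s - t\<bar> \<le> \<bar>v s - v t\<bar>" if "s \<in> J" "t \<in> J" "s < t" for s t
  proof -
    have "\<exists>z>s. z < t \<and> v t - v s = (t - s) * v' z"
      using that by (intro MVT2 dv) (auto intro: mem_is_interval_1_I[OF J(2) that(1,2)])
    then obtain z where z: "s < z" "z < t" "v t - v s = (t - s) * v' z" by blast
    have "z \<in> J" using z by (intro mem_is_interval_1_I[OF J(2) that(1,2)]) auto
    then have "m * \<bar>s - t\<bar> \<le> \<bar>v' z\<bar> * \<bar>s - t\<bar>" using m by (intro mult_right_mono) auto
    also have "\<dots> = \<bar>v s - v t\<bar>" unfolding abs_minus_commute[of "v s"] z(3) using that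
      by (simp add: abs_mult)
    finally show ?thesis .
  qed
  have exp: "m * \<bar>s - t\<bar> \<le> \<bar>v s - v t\<bar>" if "s \<in> J" "t \<in> J" for s t
    using lt[OF that] lt[OF that(2,1)] by (cases s t rule: linorder_cases) (auto simp: abs_minus_commute)
  show inj: "inj_on v J"
  proof (rule inj_onI)
    fix s t assume st: "s \<in> J" "t \<in> J" "v s = v t"
    then have "m * \<bar>s - t\<bar> \<le> 0" using exp[OF st(1,2)] by simp
    then show "s = t" using m(1) by (simp add: mult_le_0_iff)
  qed
  have cont: "continuous_on J v"
    using dv by (intro continuous_at_imp_continuous_on) (auto intro: DERIV_isCont)
  show op: "open (v ` J)" by (rule invariance_of_domain[OF cont J(1) inj])
  show iv: "is_interval (v ` J)"
    using connected_continuous_image[OF cont] J(2) by (simp add: is_interval_connected_1)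
  define \<psi> where "\<psi> = inv_into J v"
  have \<psi>J: "\<psi> t \<in> J" "v (\<psi> t) = t" if "t \<in> v ` J" for t
    using that unfolding \<psi>_def by (auto intro: inv_into_into f_inv_into_f)
  have lip: "m * \<bar>\<psi> t - \<psi> t'\<bar> \<le> \<bar>t - t'\<bar>" if "t \<in> v ` J" "t' \<in> v ` J" for t t'
    using exp[OF \<psi>J(1)[OF that(1)] \<psi>J(1)[OF that(2)]] \<psi>J(2)[OF that(1)] \<psi>J(2)[OF that(2)] by simp
  then show "\<And>t t'. t \<in> v ` J \<Longrightarrow> t' \<in> v ` J \<Longrightarrow> m * \<bar>inv_into J v t - inv_into J v t'\<bar> \<le> \<bar>t - t'\<bar>"
    unfolding \<psi>_def by blast
  have lip': "\<bar>\<psi> t - \<psi> t'\<bar> \<le> 1 / m * \<bar>t - t'\<bar>" if "t \<in> v ` J" "t' \<in> v ` J" for t t'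
    using lip[OF that] m(1) by (simp add: field_simps)
  have "continuous_on (v ` J) \<psi>"
  proof (rule lipschitz_on_continuous_on)
    show "(1 / m)-lipschitz_on (v ` J) \<psi>"
      using lip' m(1) by (intro lipschitz_onI) (auto simp: dist_real_def)
  qed
  then have cont\<psi>: "continuous (at t) \<psi>" if "t \<in> v ` J" for t
    using that continuous_on_eq_continuous_at[OF op] by blast
  have d\<psi>: "(\<psi> has_real_derivative inverse (v' (\<psi> t))) (at t)" if t: "t \<in> v ` J" for t
  proof (rule has_field_derivative_inverse_basic[OF _ _ cont\<psi>[OF t] op t])
    show "(v has_real_derivative v' (\<psi> t)) (at (\<psi> t))" by (rule dv[OF \<psi>J(1)[OF t]])
    show "v' (\<psi> t) \<noteq> 0" using m(1) m(2)[OF \<psi>J(1)[OF t]] by auto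
  qed (use \<psi>J in auto)
  have "holder_on e \<phi>' J" "holder_on e v' J" using \<phi> v unfolding holder_curve_def by auto
  then obtain C1 M1 C2 where C1: "C1 \<ge> 0" "\<And>s t. s \<in> J \<Longrightarrow> t \<in> J \<Longrightarrow> norm (\<phi>' s - \<phi>' t) \<le> C1 * \<bar>s - t\<bar> powr e"
    and M1: "M1 \<ge> 0" "\<And>s. s \<in> J \<Longrightarrow> norm (\<phi>' s) \<le> M1"
    and C2: "C2 \<ge> 0" "\<And>s t. s \<in> J \<Longrightarrow> t \<in> J \<Longrightarrow> norm (v' s - v' t) \<le> C2 * \<bar>s - t\<bar> powr e"
    by (metis holder_onE holder_on_bounded[OF _ J(3) e])
  have hk: "norm (inverse (v' s) *\<^sub>R \<phi>' s - inverse (v' t) *\<^sub>R \<phi>' t) \<le> (C2 / (m * m) * M1 + 1 / m * C1) * \<bar>s - t\<bar> powr e"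
    if st: "s \<in> J" "t \<in> J" for s t
  proof -
    have nz: "v' s \<noteq> 0" "v' t \<noteq> 0" using m(1) m(2)[OF st(1)] m(2)[OF st(2)] by auto
    have "inverse (v' s) - inverse (v' t) = (v' t - v' s) / (v' s * v' t)" using nz by (simp add: field_simps)
    then have "\<bar>inverse (v' s) - inverse (v' t)\<bar> = \<bar>v' s - v' t\<bar> / (\<bar>v' s\<bar> * \<bar>v' t\<bar>)"
      by (simp add: abs_mult abs_minus_commute)
    also have "\<dots> \<le> (C2 * \<bar>s - t\<bar> powr e) / (m * m)"
      using C2(2)[OF st] C2(1) m(1) m(2)[OF st(1)] m(2)[OF st(2)] by (intro frac_le mult_mono) auto
    finally have 1: "\<bar>inverse (v' s) - inverse (v' t)\<bar> \<le> C2 / (m * m) * \<bar>s - t\<bar> powr e" by simp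
    have 2: "\<bar>inverse (v' t)\<bar> \<le> 1 / m" using m(1) m(2)[OF st(2)] by (simp add: inverse_eq_divide frac_le)
    have "inverse (v' s) *\<^sub>R \<phi>' s - inverse (v' t) *\<^sub>R \<phi>' t
        = (inverse (v' s) - inverse (v' t)) *\<^sub>R \<phi>' s + inverse (v' t) *\<^sub>R (\<phi>' s - \<phi>' t)"
      by (simp add: algebra_simps)
    then have "norm (inverse (v' s) *\<^sub>R \<phi>' s - inverse (v' t) *\<^sub>R \<phi>' t)
        \<le> \<bar>inverse (v' s) - inverse (v' t)\<bar> * norm (\<phi>' s) + \<bar>inverse (v' t)\<bar> * norm (\<phi>' s - \<phi>' t)"
      by (metis norm_triangle_ineq norm_scaleR)
    also have "\<dots> \<le> (C2 / (m * m) * \<bar>s - t\<bar> powr e) * M1 + 1 / m * (C1 * \<bar>s - t\<bar> powr e)"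
      using 1 2 M1 C1 C2 st m(1) by (intro add_mono mult_mono) auto
    finally show ?thesis by (simp add: algebra_simps)
  qed
  have "holder_curve e (\<lambda>t. \<phi> (\<psi> t)) (\<lambda>t. inverse (v' (\<psi> t)) *\<^sub>R \<phi>' (\<psi> t)) (v ` J)"
    unfolding holder_curve_def holder_on_def
  proof (intro conjI exI ballI)
    fix t assume t: "t \<in> v ` J"
    have "(\<phi> has_vector_derivative \<phi>' (\<psi> t)) (at (\<psi> t))"
      using \<phi> \<psi>J(1)[OF t] unfolding holder_curve_def by blast
    then have "(\<phi> \<circ> \<psi> has_vector_derivative inverse (v' (\<psi> t)) *\<^sub>R \<phi>' (\<psi> t)) (at t)"
      using d\<psi>[OF t] unfolding has_real_derivative_iff_has_vector_derivative by (intro vector_diff_chain_at)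
    then show "((\<lambda>t. \<phi> (\<psi> t)) has_vector_derivative inverse (v' (\<psi> t)) *\<^sub>R \<phi>' (\<psi> t)) (at t)"
      by (simp add: comp_def)
  next
    fix t t' assume t: "t \<in> v ` J" "t' \<in> v ` J"
    let ?C = "C2 / (m * m) * M1 + 1 / m * C1"
    have C: "?C \<ge> 0" using C1(1) C2(1) M1(1) m(1) by simp
    have "norm (inverse (v' (\<psi> t)) *\<^sub>R \<phi>' (\<psi> t) - inverse (v' (\<psi> t')) *\<^sub>R \<phi>' (\<psi> t')) \<le> ?C * \<bar>\<psi> t - \<psi> t'\<bar> powr e"
      by (rule hk[OF \<psi>J(1)[OF t(1)] \<psi>J(1)[OF t(2)]])
    also have "\<dots> \<le> ?C * ((1 / m) powr e * \<bar>t - t'\<bar> powr e)"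
      using lip'[OF t] m(1) e C by (intro mult_left_mono powr_le_of_lipschitz) auto
    finally show "norm (inverse (v' (\<psi> t)) *\<^sub>R \<phi>' (\<psi> t) - inverse (v' (\<psi> t')) *\<^sub>R \<phi>' (\<psi> t'))
        \<le> ?C * (1 / m) powr e * \<bar>t - t'\<bar> powr e" by (simp only: mult.assoc)
  qed
  then show "\<exists>w'. holder_curve e (\<lambda>t. \<phi> (inv_into J v t)) w' (v ` J)" unfolding \<psi>_def by blast
qed

lemma holder_curve_Pair:
  assumes u: "holder_curve e u u' J" and w: "holder_curve e w w' J"
  shows "holder_curve e (\<lambda>s. (u s, w s)) (\<lambda>s. (u' s, w' s)) J"
proof -
  obtain C where C: "\<And>s t. s \<in> J \<Longrightarrow> t \<in> J \<Longrightarrow> norm (u' s - u' t) \<le> C * \<bar>s - t\<bar> powr e"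
    using u unfolding holder_curve_def holder_on_def by blast
  obtain D where D: "\<And>s t. s \<in> J \<Longrightarrow> t \<in> J \<Longrightarrow> norm (w' s - w' t) \<le> D * \<bar>s - t\<bar> powr e"
    using w unfolding holder_curve_def holder_on_def by blast
  show ?thesis
    unfolding holder_curve_def holder_on_def
  proof (intro conjI exI ballI)
    fix s assume "s \<in> J"
    then have "(u has_derivative (\<lambda>h. h *\<^sub>R u' s)) (at s)" "(w has_derivative (\<lambda>h. h *\<^sub>R w' s)) (at s)"
      using u w unfolding holder_curve_def has_vector_derivative_def by blast+
    then show "((\<lambda>s. (u s, w s)) has_vector_derivative (u' s, w' s)) (at s)"
      unfolding has_vector_derivative_def by (auto dest: has_derivative_Pair)
  next
    fix s t assume st: "s \<in> J" "t \<in> J"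
    have "norm ((u' s, w' s) - (u' t, w' t)) \<le> norm (u' s - u' t) + norm (w' s - w' t)"
      by (simp add: norm_Pair sqrt_sum_squares_le_sum)
    also have "\<dots> \<le> C * \<bar>s - t\<bar> powr e + D * \<bar>s - t\<bar> powr e" using C D st by (intro add_mono) auto
    finally show "norm ((u' s, w' s) - (u' t, w' t)) \<le> (C + D) * \<bar>s - t\<bar> powr e"
      by (simp add: distrib_right)
  qed
qed

lemma holder_curve_linear:
  assumes "bounded_linear T" and u: "holder_curve e u u' J"
  shows "holder_curve e (\<lambda>s. T (u s)) (\<lambda>s. T (u' s)) J"
proof -
  obtain C where C: "\<And>s t. s \<in> J \<Longrightarrow> t \<in> J \<Longrightarrow> norm (u' s - u' t) \<le> C * \<bar>s - t\<bar> powr e"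
    using u unfolding holder_curve_def holder_on_def by blast
  obtain B where B: "B \<ge> 0" "\<And>x. norm (T x) \<le> norm x * B"
    using bounded_linear.nonneg_bounded[OF assms(1)] by blast
  show ?thesis
    unfolding holder_curve_def holder_on_def
  proof (intro conjI exI ballI)
    fix s assume "s \<in> J"
    then show "((\<lambda>s. T (u s)) has_vector_derivative T (u' s)) (at s)"
      using u unfolding holder_curve_def by (auto intro: bounded_linear.has_vector_derivative[OF assms(1)])
  next
    fix s t assume st: "s \<in> J" "t \<in> J"
    have "norm (T (u' s) - T (u' t)) \<le> norm (u' s - u' t) * B"
      using B(2)[of "u' s - u' t"] by (simp add: linear_diff[OF bounded_linear.linear[OF assms(1)]])
    also have "\<dots> \<le> C * \<bar>s - t\<bar> powr e * B" using C[OF st] B(1) by (rule mult_right_mono)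
    finally show "norm (T (u' s) - T (u' t)) \<le> (C * B) * \<bar>s - t\<bar> powr e" by (simp add: mult_ac)
  qed
qed

lemma holder_curve_continuous_on: "holder_curve e u u' J \<Longrightarrow> continuous_on J u"
  unfolding holder_curve_def
  by (intro continuous_at_imp_continuous_on ballI) (auto intro: has_vector_derivative_continuous)

text \<open>Near \<open>h v\<^sub>0\<close> the inverse of \<open>h\<close> agrees with a C^1 map
  \<open>k\<close> on an open set of the ambient space. \<open>M\<close> is a Lipschitz constant of
  \<open>k\<close> on a ball, and continuity of \<open>h\<close> at \<open>v\<^sub>0\<close> brings
  the values of \<open>h\<close> into that ball.\<close>

lemma C1_diffeo_expands_locally:
  fixes h :: "'a::euclidean_space \<Rightarrow> 'b::euclidean_space"
  assumes V: "C1_diffeo_onto_image h V" "v\<^sub>0 \<in> V"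
  obtains M \<delta> where "0 \<le> M" "0 < \<delta>" "\<And>v v'. v \<in> V \<Longrightarrow> v' \<in> V \<Longrightarrow> dist v v\<^sub>0 < \<delta> \<Longrightarrow> dist v' v\<^sub>0 < \<delta> \<Longrightarrow> dist v v' \<le> M * dist (h v) (h v')"
proof -
  have D: "inj_on h V" "C1_subset h V" "C1_subset (inv_into V h) (h ` V)" using V(1) unfolding C1_diffeo_onto_image_def by auto
  obtain B k where B: "open B" "h v\<^sub>0 \<in> B" "Ck_on 1 k B" "\<forall>x\<in>h ` V \<inter> B. k x = inv_into V h x"
    using D(3) V(2) unfolding C1_subset_def by blast
  obtain B' k' where B': "open B'" "v\<^sub>0 \<in> B'" "Ck_on 1 k' B'" "\<forall>x\<in>V \<inter> B'. k' x = h x"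
    using D(2) V(2) unfolding C1_subset_def by blast
  obtain r where r: "0 < r" "cball (h v\<^sub>0) r \<subseteq> B" using B(1,2) by (meson open_contains_cball)
  obtain M where M: "M \<ge> 0" "\<And>x y. x \<in> cball (h v\<^sub>0) r \<Longrightarrow> y \<in> cball (h v\<^sub>0) r \<Longrightarrow> norm (k x - k y) \<le> M * norm (x - y)"
    by (rule Ck_on_1_lipschitz[OF B(3) compact_cball convex_cball r(2)]) (rule that)
  have "isCont k' v\<^sub>0" using B'(2,3) by (auto intro: differentiable_imp_continuous_within)
  then obtain \<delta>1 where \<delta>1: "\<delta>1 > 0" "\<And>v. dist v v\<^sub>0 < \<delta>1 \<Longrightarrow> dist (k' v) (k' v\<^sub>0) < r"
    using r(1) unfolding continuous_at_eps_delta by blast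
  obtain \<delta>2 where \<delta>2: "\<delta>2 > 0" "ball v\<^sub>0 \<delta>2 \<subseteq> B'" using B'(1,2) by (meson openE)
  have near: "h v \<in> cball (h v\<^sub>0) r" if "v \<in> V" "dist v v\<^sub>0 < min \<delta>1 \<delta>2" for v
  proof -
    have "v \<in> B'" using that(2) \<delta>2(2) by (auto simp: dist_commute)
    then show ?thesis using \<delta>1(2)[of v] that B'(2,4) V(2) by (simp add: dist_commute less_imp_le)
  qed
  have kh: "k (h v) = v" if "v \<in> V" "dist v v\<^sub>0 < min \<delta>1 \<delta>2" for v
    using near[OF that] B(4) r(2) that(1) inv_into_f_f[OF D(1) that(1)] by auto
  have "dist v v' \<le> M * dist (h v) (h v')"
    if "v \<in> V" "v' \<in> V" "dist v v\<^sub>0 < min \<delta>1 \<delta>2" "dist v' v\<^sub>0 < min \<delta>1 \<delta>2" for v v'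
    using M(2)[OF near[OF that(1,3)] near[OF that(2,4)]] kh[OF that(1,3)] kh[OF that(2,4)] by (simp add: dist_norm)
  then show ?thesis using that[OF M(1), of "min \<delta>1 \<delta>2"] \<delta>1(1) \<delta>2(1) by simp
qed

section \<open>The cross-section and its stable leaves\<close>

lemma same_sign_on_interval:
  fixes \<alpha> :: "real \<Rightarrow> real"
  assumes "continuous_on J \<alpha>" "is_interval J" "\<And>s. s \<in> J \<Longrightarrow> \<alpha> s \<noteq> 0" "s \<in> J" "t \<in> J"
  shows "0 < \<alpha> s * \<alpha> t"
proof (rule ccontr)
  assume "\<not> ?thesis"
  then have "(\<alpha> s \<le> 0 \<and> 0 \<le> \<alpha> t) \<or> (\<alpha> t \<le> 0 \<and> 0 \<le> \<alpha> s)" by (auto simp: not_less mult_le_0_iff)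
  moreover have "is_interval (\<alpha> ` J)"
    using connected_continuous_image[OF assms(1)] assms(2) by (simp add: is_interval_connected_1)
  ultimately have "0 \<in> \<alpha> ` J"
    using mem_is_interval_1_I[of "\<alpha> ` J" "\<alpha> s" "\<alpha> t" 0] mem_is_interval_1_I[of "\<alpha> ` J" "\<alpha> t" "\<alpha> s" 0]
      assms(4,5) by auto
  then show False using assms(3) by auto
qed

lemma return_time_first:
  assumes "t > 0" "Z t x \<in> S" "\<forall>s\<in>{0<..<t}. Z s x \<notin> S"
  shows "return_time Z S x = t"
  unfolding return_time_def
proof (rule cInf_eq_minimum)
  show "t \<in> {t. 0 < t \<and> Z t x \<in> S}" using assms by simp
  fix s assume "s \<in> {t. 0 < t \<and> Z t x \<in> S}"
  then show "t \<le> s" using assms(3) by (metis greaterThanLessThan_iff mem_Collect_eq not_le)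
qed

text \<open>Through closedness, this lets an orbit segment that starts on the section have a last
  visit to it.\<close>

lemma flat_section_compact: 
  assumes "C1_holder_diffeo e (chart L) S" "{u. \<forall>i. \<bar>u $ i\<bar> \<le> 1} \<subseteq> S"
  shows "compact (flat_section L)"
proof -
  have v: "vector [a, c, 1] = a *\<^sub>R axis 1 1 + c *\<^sub>R axis 2 1 + (axis 3 1 :: real^3)" for a c :: real
    by (simp add: vec_eq_iff forall_3 axis_def)
  have "continuous_on S (chart L)"
    using assms(1) unfolding C1_holder_diffeo_def C1_holder_def
    by (meson continuous_at_imp_continuous_on has_derivative_continuous)
  moreover have sub: "(\<lambda>(a, c). vector [a, c, 1] :: real^3) ` ({-1..1} \<times> {-1..1}) \<subseteq> S"
    using assms(2) by (force simp: forall_3)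
  ultimately have "continuous_on ((\<lambda>(a, c). vector [a, c, 1] :: real^3) ` ({-1..1} \<times> {-1..1})) (chart L)"
    by (rule continuous_on_subset)
  moreover have "continuous_on ({-1..1} \<times> {-1..1}) (\<lambda>(a, c). vector [a, c, 1] :: real^3)"
    unfolding v case_prod_unfold by (intro continuous_intros)
  ultimately have "compact (chart L ` (\<lambda>(a, c). vector [a, c, 1]) ` ({-1..1} \<times> {-1..1}))"
    by (intro compact_continuous_image compact_Times compact_Icc)
  moreover have "flat_section L = chart L ` (\<lambda>(a, c). vector [a, c, 1]) ` ({-1..1} \<times> {-1..1})"
    unfolding flat_section_def by (force simp: abs_le_iff)
  ultimately show ?thesis by simp
qed

lemma same_cylinder_one: "a \<in> part S \<Longrightarrow> s \<in> a \<Longrightarrow> t \<in> a \<Longrightarrow> same_cylinder L S 1 s t"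
  unfolding same_cylinder_def by auto

locale lorenz_attractor =
  fixes L :: lorenz
  assumes setting: "lorenz_setting L"
begin

abbreviation "X \<equiv> section_of L"
abbreviation "\<Gamma> \<equiv> sing L"
abbreviation "f \<equiv> pmap L"
abbreviation "b \<equiv> pmap_inv L"
abbreviation "p \<equiv> proj L"
abbreviation "\<sigma> \<equiv> transversal L"
abbreviation "e \<equiv> hexp L"
abbreviation "q \<equiv> qmap L"

lemma geometric: "geometric_lorenz L" using setting unfolding lorenz_setting_def by blast

lemma is_flow: "is_flow (vf L) (flow L)" using geometric unfolding geometric_lorenz_def by blast

lemma flow_zero: "flow L 0 x = x" using is_flow unfolding is_flow_def by blast

lemma flow_add: "flow L (s + t) x = flow L s (flow L t x)" using is_flow unfolding is_flow_def by blast

lemma flow_smooth: "smooth_on (\<lambda>(t, x). flow L t x) UNIV" using is_flow unfolding is_flow_def by blast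

lemma hexp_bounds: "0 < e" "e \<le> 1" using geometric unfolding geometric_lorenz_def by blast+

lemma flow_C1_holder: "C1_holder e (\<lambda>(t, x). flow L t x) UNIV"
  by (rule smooth_on_imp_C1_holder[OF flow_smooth hexp_bounds])

lemma flow_eq_iff: "flow L t x = y \<longleftrightarrow> x = flow L (- t) y"
  using flow_add[of t "- t" y] flow_add[of "- t" t x] flow_zero by auto

lemma flat_first_return:
  assumes "x \<in> flat_section L - flat_sing L"
  shows "\<exists>t>0. flow L t x \<in> flat_section L \<and> (\<forall>s\<in>{0<..<t}. flow L s x \<notin> flat_section L)"
proof -
  obtain N p' where "lorenz_section e (flow L) \<sigma> (flat_section L) (flat_sing L) N p'"
    using geometric unfolding geometric_lorenz_def by blast
  then have "\<forall>x\<in>flat_section L - flat_sing L. \<exists>t>0. flow L t x \<in> flat_section L \<and>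
      (\<forall>s\<in>{0<..<t}. flow L s x \<notin> flat_section L)"
    unfolding lorenz_section_def Let_def by (rule conjunct1)
  then show ?thesis using assms by (rule bspec)
qed

lemma flat_section_subset_region: "flat_section L \<subseteq> region L"
proof
  fix x assume x: "x \<in> flat_section L"
  have "x \<notin> flat_sing L \<longrightarrow> 0 \<le> return_time (flow L) (flat_section L) x"
    using flat_first_return[of x] x return_time_first[of _ "flow L" x "flat_section L"] by (metis DiffI less_imp_le)
  then show "x \<in> region L"
    unfolding region_def swept_region_def using x flow_zero[of x] by (metis (mono_tags, lifting) mem_Collect_eq order_refl)
qed

lemma section_properties: "lorenz_section e (flow L) \<sigma> X \<Gamma> X p"
  using setting unfolding lorenz_setting_def by blast

lemma qmap_eq: "(\<lambda>s. p (f (\<sigma> s))) = q" by (rule ext) (simp add: qmap_def)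

lemmas section_facts = section_properties[unfolded lorenz_section_def Let_def, folded pmap_def, unfolded qmap_eq]

section \<open>The section, its stable leaves and the Poincare map\<close>

lemma first_return: "x \<in> X - \<Gamma> \<Longrightarrow> \<exists>t>0. flow L t x \<in> X \<and> (\<forall>s\<in>{0<..<t}. flow L s x \<notin> X)"
  by (rule bspec[OF section_facts[THEN conjunct1]])

lemma proj_in: "x \<in> X \<Longrightarrow> p x \<in> {-1..1}"
  using section_facts[THEN conjunct2, THEN conjunct2, THEN conjunct1] by blast

lemma transversal_in: "s \<in> {-1..1} \<Longrightarrow> \<sigma> s \<in> X" "s \<in> {-1..1} \<Longrightarrow> p (\<sigma> s) = s"
  using section_facts[THEN conjunct2, THEN conjunct2, THEN conjunct2, THEN conjunct1] by blast+

lemma sing_iff: "x \<in> X \<Longrightarrow> x \<in> \<Gamma> \<longleftrightarrow> p x = 0"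
proof -
  have "{x \<in> X. p x = 0} = \<Gamma> \<inter> X" by (rule section_facts[THEN conjunct2, THEN conjunct2, THEN conjunct2, THEN conjunct2, THEN conjunct1])
  then show "x \<in> X \<Longrightarrow> x \<in> \<Gamma> \<longleftrightarrow> p x = 0" by blast
qed

lemma section_chart: "x \<in> X \<Longrightarrow> \<exists>B h. x \<in> B \<and> C1_holder_diffeo e h B \<and> (\<forall>z\<in>X \<inter> B. h z $ 1 = p z \<and> h z $ 3 = 0)"
  by (rule bspec[OF section_facts[THEN conjunct2, THEN conjunct2, THEN conjunct2, THEN conjunct2, THEN conjunct2, THEN conjunct1]])

lemma pmap_in: "x \<in> X - \<Gamma> \<Longrightarrow> f x \<in> X"
  using section_facts[THEN conjunct2, THEN conjunct2, THEN conjunct2, THEN conjunct2, THEN conjunct2, THEN conjunct2, THEN conjunct1] by blast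

lemma proj_pmap_cong: "x \<in> X - \<Gamma> \<Longrightarrow> x' \<in> X - \<Gamma> \<Longrightarrow> p x' = p x \<Longrightarrow> p (f x') = p (f x)"
  using section_facts[THEN conjunct2, THEN conjunct2, THEN conjunct2, THEN conjunct2, THEN conjunct2, THEN conjunct2, THEN conjunct1] by blast

lemma stable_contraction: "\<exists>C \<theta>\<^sub>0. 0 < \<theta>\<^sub>0 \<and> \<theta>\<^sub>0 < 1 \<and> (\<forall>x\<in>X. \<forall>x'\<in>X. \<forall>n. p x' = p x \<and> iterates_avoid f \<Gamma> n x \<longrightarrow>
            dist ((f ^^ n) x) ((f ^^ n) x') \<le> C * \<theta>\<^sub>0 ^ n)"
  by (rule section_facts[THEN conjunct2, THEN conjunct2, THEN conjunct2, THEN conjunct2, THEN conjunct2, THEN conjunct2, THEN conjunct2, THEN conjunct1])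

lemma qmap_expanding: "\<exists>c \<theta>\<^sub>1. c > 0 \<and> \<theta>\<^sub>1 > 1 \<and>
         (\<forall>n. \<forall>s\<in>{-1..1}. iterates_avoid q {0} n s \<longrightarrow>
            (\<exists>D. ((q ^^ n) has_real_derivative D) (at s within {-1..1}) \<and> \<bar>D\<bar> \<ge> c * \<theta>\<^sub>1 ^ n))"
  by (rule section_facts[THEN conjunct2, THEN conjunct2, THEN conjunct2, THEN conjunct2, THEN conjunct2, THEN conjunct2, THEN conjunct2, THEN conjunct2, THEN conjunct1])

lemma leaf_facts: "\<exists>R. region L \<subseteq> R \<and> (\<forall>x\<in>R. x \<in> ssleaf L x \<and> ssleaf L x \<subseteq> R \<and> (\<forall>y\<in>ssleaf L x. ssleaf L y = ssleaf L x))"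
proof -
  have "strong_stable_foliation e (flow L) (region L) (ssleaf L)"
    using setting unfolding lorenz_setting_def by blast
  then show ?thesis unfolding strong_stable_foliation_def 
  proof (elim exE conjE)
    fix R assume "region L \<subseteq> R"
      and R: "\<forall>x\<in>R. x \<in> ssleaf L x \<and> ssleaf L x \<subseteq> R \<and> connected (ssleaf L x) \<and> (\<forall>y\<in>ssleaf L x. ssleaf L y = ssleaf L x)"
    moreover have "\<forall>x\<in>R. x \<in> ssleaf L x \<and> ssleaf L x \<subseteq> R \<and> (\<forall>y\<in>ssleaf L x. ssleaf L y = ssleaf L x)"
    proof
      fix x assume x: "x \<in> R"
      show "x \<in> ssleaf L x \<and> ssleaf L x \<subseteq> R \<and> (\<forall>y\<in>ssleaf L x. ssleaf L y = ssleaf L x)"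
        using bspec[OF R x] by (elim conjE) (intro conjI)
    qed
    ultimately show ?thesis by (intro exI[of _ R] conjI)
  qed
qed

text \<open>The foliation is controlled only near the swept region; the transversal lies in the flat
  section and hence in that region.\<close>

lemma transversal_leaf:
  assumes s: "s \<in> {-1..1}"
  shows "\<sigma> s \<in> ssleaf L (\<sigma> s)" "y \<in> ssleaf L (\<sigma> s) \<Longrightarrow> ssleaf L y = ssleaf L (\<sigma> s)"
proof -
  have "\<sigma> s \<in> flat_section L" using s unfolding transversal_def flat_section_def by fastforce
  then have "\<sigma> s \<in> region L" using flat_section_subset_region by blast
  then show "\<sigma> s \<in> ssleaf L (\<sigma> s)" "y \<in> ssleaf L (\<sigma> s) \<Longrightarrow> ssleaf L y = ssleaf L (\<sigma> s)"
    using leaf_facts by blast+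
qed

lemma leaf_subset: "s \<in> {-1..1} \<Longrightarrow> ssleaf L (\<sigma> s) \<subseteq> X" unfolding section_of_def by blast

lemma proj_leaf:
  assumes s: "s \<in> {-1..1}" and x: "x \<in> ssleaf L (\<sigma> s)"
  shows "p x = s"
  unfolding proj_def
proof (rule the_equality)
  show "s \<in> {-1..1} \<and> x \<in> ssleaf L (\<sigma> s)" using assms by blast
  fix t assume t: "t \<in> {-1..1} \<and> x \<in> ssleaf L (\<sigma> t)"
  have "\<sigma> t \<in> ssleaf L (\<sigma> s)"
    using transversal_leaf(1)[of t] transversal_leaf(2)[of t x] transversal_leaf(2)[OF s x] t by metis
  then show "t = s" using setting s t unfolding lorenz_setting_def by blast
qed

lemma leaf_of: assumes "x \<in> X" shows "x \<in> ssleaf L (\<sigma> (p x))" "ssleaf L x = ssleaf L (\<sigma> (p x))"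
proof -
  obtain s where s: "s \<in> {-1..1}" "x \<in> ssleaf L (\<sigma> s)" using assms unfolding section_of_def by blast
  then have px: "p x = s" by (rule proj_leaf)
  show "x \<in> ssleaf L (\<sigma> (p x))" unfolding px by (rule s(2))
  show "ssleaf L x = ssleaf L (\<sigma> (p x))" unfolding px by (rule transversal_leaf(2)[OF s])
qed

lemma mem_leaf_iff: "x \<in> X \<Longrightarrow> w \<in> ssleaf L x \<longleftrightarrow> w \<in> X \<and> p w = p x"
  using leaf_of[of x] leaf_of[of w] proj_leaf[of "p x" w] proj_in[of x] leaf_subset[of "p x"] by auto

lemma saturate_iff: "B \<subseteq> {-1..1} \<Longrightarrow> x \<in> saturate L B \<longleftrightarrow> x \<in> X \<and> p x \<in> B"
proof
  assume B: "B \<subseteq> {-1..1}" and "x \<in> saturate L B"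
  then obtain s where s: "s \<in> B" "x \<in> ssleaf L (\<sigma> s)" unfolding saturate_def by blast
  then have "s \<in> {-1..1}" using B by blast
  then show "x \<in> X \<and> p x \<in> B" using s leaf_subset proj_leaf by blast
next
  assume "x \<in> X \<and> p x \<in> B"
  then show "x \<in> saturate L B" unfolding saturate_def using leaf_of(1) by blast
qed

lemma proj_pmap: assumes x: "x \<in> X - \<Gamma>" shows "p (f x) = q (p x)"
proof -
  have s: "p x \<in> {-1..1}" using x proj_in by blast
  then have "\<sigma> (p x) \<in> X - \<Gamma>" using x transversal_in[of "p x"] sing_iff[of x] sing_iff[of "\<sigma> (p x)"] by auto
  then have "p (f x) = p (f (\<sigma> (p x)))" using x transversal_in[of "p x"] s proj_pmap_cong by metis
  then show ?thesis by (simp add: qmap_def)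
qed

lemma ret_first:
  assumes "x \<in> X - \<Gamma>"
  shows "0 < ret L x" "flow L (ret L x) x \<in> X" "0 < s \<Longrightarrow> s < ret L x \<Longrightarrow> flow L s x \<notin> X"
proof -
  obtain t where t: "t > 0" "flow L t x \<in> X" "\<forall>s\<in>{0<..<t}. flow L s x \<notin> X" using first_return[OF assms] by blast
  then have "ret L x = t" unfolding ret_def by (rule return_time_first)
  then show "0 < ret L x" "flow L (ret L x) x \<in> X" "0 < s \<Longrightarrow> s < ret L x \<Longrightarrow> flow L s x \<notin> X" using t by auto
qed

lemma pmap_flow: "f x = flow L (ret L x) x" by (simp add: pmap_def poincare_map_def ret_def)

text \<open>Two points with the same image lie on one orbit. If their return times differed, the
  orbit of the point with the longer one would meet the section, at the other point, before its
  first return.\<close>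

lemma inj_pmap: "inj_on f (X - \<Gamma>)"
proof -
  have *: "x = y" if x: "x \<in> X - \<Gamma>" and y: "y \<in> X - \<Gamma>" and eq: "f x = f y" and le: "ret L x \<le> ret L y" for x y
  proof -
    have "x = flow L (- ret L x) (flow L (ret L y) y)"
      using eq unfolding pmap_flow flow_eq_iff by simp
    then have x': "x = flow L (ret L y - ret L x) y" by (simp flip: flow_add)
    have "ret L y - ret L x = 0"
    proof (rule ccontr)
      assume "ret L y - ret L x \<noteq> 0"
      then have "flow L (ret L y - ret L x) y \<notin> X" using le ret_first(1)[OF x] by (intro ret_first(3)[OF y]) auto
      then show False using x x' by simp
    qed
    then show ?thesis using x' flow_zero by simp
  qed
  show ?thesis
  proof (rule inj_onI)
    fix x y assume "x \<in> X - \<Gamma>" "y \<in> X - \<Gamma>" "f x = f y"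
    then show "x = y" using *[of x y] *[of y x] by (cases "ret L x \<le> ret L y") auto
  qed
qed

lemma pmap_inv_pmap: "x \<in> X - \<Gamma> \<Longrightarrow> b (f x) = x"
  unfolding pmap_inv_def by (rule inv_into_f_f[OF inj_pmap])

lemma pmap_inv: assumes "y \<in> f ` (X - \<Gamma>)" shows "b y \<in> X - \<Gamma>" "f (b y) = y"
  unfolding pmap_inv_def by (rule inv_into_into[OF assms], rule f_inv_into_f[OF assms])

lemma ret_proj: assumes "x \<in> X - \<Gamma>" shows "ret L x = ret L (\<sigma> (p x))"
proof -
  have "\<sigma> (p x) \<in> ssleaf L x" using assms mem_leaf_iff transversal_in proj_in by auto
  moreover have "\<forall>x\<in>X - \<Gamma>. \<forall>x'\<in>ssleaf L x. ret L x' = ret L x"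
    using setting unfolding lorenz_setting_def by (elim conjE)
  ultimately show ?thesis using assms by (metis (full_types))
qed

lemma closed_flat_section: "closed (flat_section L)"
proof -
  have "linearizable L" using geometric unfolding geometric_lorenz_def by (elim conjE)
  then obtain S where "{u. \<forall>i. \<bar>u $ i\<bar> \<le> 1} \<subseteq> S" "C1_holder_diffeo e (chart L) S"
    unfolding linearizable_def by (elim exE conjE)
  then show ?thesis using flat_section_compact compact_imp_closed by blast
qed

lemma continuous_flow_time: "continuous_on A (\<lambda>t. flow L t x)"
proof -
  have "((\<lambda>s. flow L s x) has_vector_derivative vf L (flow L t x)) (at t)" for t
    using is_flow unfolding is_flow_def by (elim conjE) (drule spec2)
  then show ?thesis
    by (intro continuous_at_imp_continuous_on ballI) (auto intro: has_vector_derivative_continuous)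
qed

text \<open>Follow an orbit from its last visit to the section.\<close>

lemma region_forward_invariant:
  assumes "u \<in> region L" "0 \<le> t"
  shows "flow L t u \<in> region L"
proof -
  obtain a x where u: "u = flow L a x" "x \<in> flat_section L" "0 \<le> a"
    using assms(1) unfolding region_def swept_region_def by blast
  define T where "T = t + a"
  have T: "0 \<le> T" "flow L t u = flow L T x" using u assms(2) flow_add by (auto simp: T_def)
  define H where "H = {s \<in> {0..T}. flow L s x \<in> flat_section L}"
  have "H = {0..T} \<inter> (\<lambda>s. flow L s x) -` flat_section L" unfolding H_def by blast
  then have "closed H"
    using continuous_closed_preimage[OF continuous_flow_time closed_atLeastAtMost closed_flat_section] by metis
  moreover have "bounded H" by (rule bounded_subset[of "{0..T}"]) (auto simp: H_def)
  ultimately have "compact H" by (simp add: compact_eq_bounded_closed)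
  moreover have "0 \<in> H" using u T flow_zero by (simp add: H_def)
  ultimately obtain r where r: "r \<in> H" "\<And>s. s \<in> H \<Longrightarrow> s \<le> r"
    using compact_attains_sup[of H] by blast
  define w where "w = flow L r x"
  have w: "w \<in> flat_section L" and rT: "0 \<le> r" "r \<le> T" using r(1) by (auto simp: H_def w_def)
  have fT: "flow L T x = flow L (T - r) w" unfolding w_def by (simp flip: flow_add)
  have "w \<notin> flat_sing L \<longrightarrow> T - r \<le> return_time (flow L) (flat_section L) w"
  proof
    assume "w \<notin> flat_sing L"
    then obtain t' where t': "t' > 0" "flow L t' w \<in> flat_section L" "\<forall>s\<in>{0<..<t'}. flow L s w \<notin> flat_section L"
      using flat_first_return[of w] w by blast
    have "T < t' + r"
    proof (rule ccontr)
      assume "\<not> T < t' + r"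
      then have "t' + r \<in> H" using t'(1,2) rT(1) by (simp add: H_def w_def flow_add)
      then show False using r(2) t'(1) by force
    qed
    then show "T - r \<le> return_time (flow L) (flat_section L) w"
      using return_time_first[where Z = "flow L", OF t'] by simp
  qed
  then show ?thesis
    unfolding T(2) fT region_def swept_region_def using w rT(2) by (auto intro!: exI[of _ "T - r"] exI[of _ w])
qed

text \<open>The flow maps commute, so forward invariance of the region passes to each of the sets
  whose intersection is the attractor.\<close>

lemma flow_attractor:
  assumes "x \<in> attractor L" "0 \<le> r"
  shows "flow L r x \<in> attractor L"
  unfolding attractor_def
proof (rule INT_I)
  fix t :: real assume "t \<in> {0<..}"
  then obtain u where u: "u \<in> region L" "x = flow L t u" using assms(1) unfolding attractor_def by blast
  have "flow L r x = flow L t (flow L r u)" unfolding u(2) flow_add[symmetric] by (simp add: add.commute)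
  then show "flow L r x \<in> flow L t ` region L" using region_forward_invariant[OF u(1) assms(2)] by blast
qed

lemma pmap_attractor: "x \<in> attractor L \<Longrightarrow> x \<in> X - \<Gamma> \<Longrightarrow> f x \<in> attractor L"
  unfolding pmap_flow using ret_first(1)[of x] by (intro flow_attractor) auto

section \<open>Regularity of the leaf projection and of the quotient map\<close>

lemma section_chart_ball:
  assumes "x \<in> X"
  obtains B and h :: "real^3 \<Rightarrow> real^3" and r where "open B" "C1_holder e h B" "0 < r" "cball x r \<subseteq> B" "\<And>z. z \<in> X \<Longrightarrow> z \<in> B \<Longrightarrow> h z $ 1 = p z"
proof -
  obtain B and h :: "real^3 \<Rightarrow> real^3" where B: "x \<in> B" "C1_holder_diffeo e h B" "\<forall>z\<in>X \<inter> B. h z $ 1 = p z \<and> h z $ 3 = 0"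
    using section_chart[OF assms] by blast
  then have o: "open B" "C1_holder e h B" unfolding C1_holder_diffeo_def by auto
  obtain r where "0 < r" "cball x r \<subseteq> B" using o(1) B(1) by (meson open_contains_cball)
  then show ?thesis using that[of B h r] o B(3) by blast
qed

text \<open>\<open>proj\<close> is given by a definite description; its regularity comes from the
  charts of the foliated section, where it is the first coordinate.\<close>

lemma proj_lipschitz:
  assumes "x \<in> X"
  obtains r M where "0 < r" "0 \<le> M" "\<And>z z'. z \<in> X \<Longrightarrow> z' \<in> X \<Longrightarrow> z \<in> ball x r \<Longrightarrow> z' \<in> ball x r \<Longrightarrow> \<bar>p z - p z'\<bar> \<le> M * dist z z'"
proof -
  obtain B and h :: "real^3 \<Rightarrow> real^3" and r where B: "open B" "C1_holder e h B" "0 < r" "cball x r \<subseteq> B" "\<And>z. z \<in> X \<Longrightarrow> z \<in> B \<Longrightarrow> h z $ 1 = p z"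
    using section_chart_ball[OF assms] by blast
  obtain M where M: "0 \<le> M" "\<And>y z. y \<in> cball x r \<Longrightarrow> z \<in> cball x r \<Longrightarrow> norm (h y - h z) \<le> M * norm (y - z)"
    using C1_holder_lipschitz[OF B(2) less_imp_le[OF hexp_bounds(1)] compact_cball convex_cball B(4)] by blast
  have "\<bar>p z - p z'\<bar> \<le> M * dist z z'" if "z \<in> X" "z' \<in> X" "z \<in> ball x r" "z' \<in> ball x r" for z z'
  proof -
    have c: "z \<in> cball x r" "z' \<in> cball x r" using that by auto
    then have "\<bar>p z - p z'\<bar> = \<bar>(h z - h z') $ 1\<bar>"
      using B(5)[OF that(1) subsetD[OF B(4)]] B(5)[OF that(2) subsetD[OF B(4)]] by simp
    also have "\<dots> \<le> norm (h z - h z')" by (rule component_le_norm_cart)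
    also have "\<dots> \<le> M * dist z z'" using M(2)[OF c] by (simp add: dist_norm)
    finally show ?thesis .
  qed
  then show ?thesis using that[of r M] B(3) M(1) by blast
qed

lemma proj_continuous: "continuous_on X p"
  unfolding continuous_on_iff
proof (intro ballI allI impI)
  fix x and \<epsilon> :: real assume x: "x \<in> X" and \<epsilon>: "0 < \<epsilon>"
  obtain r M where M: "0 < r" "0 \<le> M" "\<And>z z'. z \<in> X \<Longrightarrow> z' \<in> X \<Longrightarrow> z \<in> ball x r \<Longrightarrow> z' \<in> ball x r \<Longrightarrow> \<bar>p z - p z'\<bar> \<le> M * dist z z'"
    using proj_lipschitz[OF x] by blast
  define d where "d = min r (\<epsilon> / (M + 1))"
  have "dist (p x') (p x) < \<epsilon>" if "x' \<in> X" "dist x' x < d" for x'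
  proof -
    have "dist (p x') (p x) \<le> M * dist x' x"
      using M(1) that unfolding dist_real_def by (intro M(3)[OF that(1) x]) (auto simp: d_def dist_commute)
    also have "\<dots> \<le> (M + 1) * dist x' x" by (simp add: mult_right_mono)
    also have "\<dots> < \<epsilon>" using that(2) M(2) by (simp add: d_def pos_less_divide_eq mult.commute)
    finally show ?thesis .
  qed
  moreover have "d > 0" using M(1,2) \<epsilon> by (simp add: d_def)
  ultimately show "\<exists>d>0. \<forall>x'\<in>X. dist x' x < d \<longrightarrow> dist (p x') (p x) < \<epsilon>" by blast
qed

text \<open>This is uniform expansion for \<open>n = 1\<close>. As the constant \<open>c\<close> may
  be small, it keeps the derivative away from 0 but need not make it exceed 1.\<close>

lemma qmap_derivative:
  "\<exists>m>0. \<forall>s\<in>{-1..1} - {0}. \<exists>D. (q has_real_derivative D) (at s within {-1..1}) \<and> m \<le> \<bar>D\<bar>"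
proof -
  obtain c \<theta> where c: "c > 0" "\<theta> > 1" "\<forall>n. \<forall>s\<in>{-1..1}. iterates_avoid q {0} n s \<longrightarrow>
            (\<exists>D. ((q ^^ n) has_real_derivative D) (at s within {-1..1}) \<and> \<bar>D\<bar> \<ge> c * \<theta> ^ n)"
    using qmap_expanding by (elim exE conjE)
  have "\<exists>D. (q has_real_derivative D) (at s within {-1..1}) \<and> c * \<theta> \<le> \<bar>D\<bar>" if "s \<in> {-1..1} - {0}" for s
    using spec[OF c(3), of 1] that by (simp add: iterates_avoid_def)
  moreover have "c * \<theta> > 0" using c by simp
  ultimately show ?thesis by blast
qed

text \<open>The condition \<open>0 < s * t\<close> puts the whole segment between the two points on
  one side of 0, where the derivative has no zero and the mean value theorem applies.\<close>

lemma qmap_inj_side: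
  assumes "s \<in> {-1..1}" "t \<in> {-1..1}" "0 < s * t" "q s = q t"
  shows "s = t"
proof -
  have *: False if st: "s \<in> {-1..1}" "t \<in> {-1..1}" "0 < s * t" "q s = q t" "s < t" for s t
  proof -
    obtain m where m: "m > 0" "\<forall>s\<in>{-1..1} - {0}. \<exists>D. (q has_real_derivative D) (at s within {-1..1}) \<and> m \<le> \<bar>D\<bar>"
      using qmap_derivative by blast
    then obtain D where D: "\<And>s. s \<in> {-1..1} - {0} \<Longrightarrow> (q has_real_derivative D s) (at s within {-1..1}) \<and> m \<le> \<bar>D s\<bar>"
      by metis
    have sub: "z \<in> {-1..1} - {0}" if "s \<le> z" "z \<le> t" for z
      using that st(1-3) by (auto simp: zero_less_mult_iff not_less)
    have "{s..t} \<subseteq> {-1..1} - {0}" by (intro subsetI sub) simp_all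
    moreover have "continuous_on ({-1..1} - {0}) q"
      unfolding continuous_on_eq_continuous_within
      using D by (blast intro: DERIV_continuous continuous_within_subset)
    ultimately have cont: "continuous_on {s..t} q" by (rule continuous_on_subset[rotated])
    have der: "(q has_derivative (\<lambda>h. D z * h)) (at z)" if z: "s < z" "z < t" for z
    proof -
      have "(q has_real_derivative D z) (at z within {-1..1})" using D[OF sub, of z] z by auto
      moreover have "at z within {-1..1} = at z" using z st by (intro at_within_interior) auto
      ultimately show ?thesis unfolding has_field_derivative_def by simp
    qed
    have "\<exists>\<xi>>s. \<xi> < t \<and> q t - q s = D \<xi> * (t - s)"
      by (rule mvt[OF st(5) cont der]) auto
    then obtain \<xi> where \<xi>: "s < \<xi>" "\<xi> < t" "q t - q s = D \<xi> * (t - s)" by blast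
    then have "D \<xi> = 0" using st by simp
    then show False using D[OF sub[of \<xi>]] \<xi> m(1) by auto
  qed
  show ?thesis
    using *[OF assms] *[of t s] assms by (cases s t rule: linorder_cases) (auto simp: mult.commute)
qed

section \<open>Unstable curves and the bracket\<close>

text \<open>\<open>b\<close> is an arbitrary choice outside the image of the Poincare map, so
  backward iterates have a meaning only under this condition. The case \<open>n = 0\<close> puts
  \<open>w\<close> itself into the image.\<close>

definition backward :: "real^3 \<Rightarrow> bool" where
  "backward w \<longleftrightarrow> (\<forall>n. (b ^^ n) w \<in> f ` (X - \<Gamma>))"

lemma backwardD:
  assumes "backward w"
  shows "(b ^^ Suc n) w \<in> X - \<Gamma>" "f ((b ^^ Suc n) w) = (b ^^ n) w"
  using pmap_inv[of "(b ^^ n) w"] assms unfolding backward_def by auto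

lemma forward_backward:
  assumes "backward w" "i \<le> n"
  shows "(f ^^ i) ((b ^^ n) w) = (b ^^ (n - i)) w"
  using assms(2)
proof (induction i)
  case (Suc i)
  then have "(f ^^ Suc i) ((b ^^ n) w) = f ((b ^^ Suc (n - Suc i)) w)" by (simp add: Suc_diff_Suc)
  then show ?case using backwardD(2)[OF assms(1)] by simp
qed simp

lemma backward_avoid: "backward w \<Longrightarrow> iterates_avoid f \<Gamma> n ((b ^^ n) w)"
  unfolding iterates_avoid_def
proof (intro allI impI)
  fix i assume w: "backward w" "i < n"
  then have "(f ^^ i) ((b ^^ n) w) = (b ^^ Suc (n - Suc i)) w"
    by (simp add: forward_backward Suc_diff_Suc del: funpow.simps)
  then show "(f ^^ i) ((b ^^ n) w) \<notin> \<Gamma>" using backwardD(1)[OF w(1)] by (metis DiffD2)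
qed

lemma backward_forward:
  assumes "w \<in> X" "iterates_avoid f \<Gamma> n w" "i \<le> n"
  shows "(f ^^ i) w \<in> X" "(b ^^ i) ((f ^^ n) w) = (f ^^ (n - i)) w"
proof -
  have X: "(f ^^ j) w \<in> X" if "j \<le> n" for j
    using that
  proof (induction j)
    case (Suc j)
    then have "(f ^^ j) w \<in> X - \<Gamma>" using assms(2) unfolding iterates_avoid_def by auto
    then show ?case using pmap_in by simp
  qed (use assms in simp)
  then show "(f ^^ i) w \<in> X" using assms(3) by blast
  show "(b ^^ i) ((f ^^ n) w) = (f ^^ (n - i)) w"
    using assms(3)
  proof (induction i)
    case (Suc i)
    have "(f ^^ (n - Suc i)) w \<in> X - \<Gamma>" using X[of "n - Suc i"] Suc.prems assms(2) unfolding iterates_avoid_def by auto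
    then have "b (f ((f ^^ (n - Suc i)) w)) = (f ^^ (n - Suc i)) w" by (rule pmap_inv_pmap)
    moreover have "(f ^^ (n - i)) w = f ((f ^^ (n - Suc i)) w)"
      using Suc_diff_Suc[of i n] Suc.prems by (metis Suc_le_lessD comp_apply funpow.simps(2))
    moreover have "(b ^^ i) ((f ^^ n) w) = (f ^^ (n - i)) w" using Suc by simp
    ultimately show ?case by simp
  qed simp
qed

section \<open>Unstable curves and their uniqueness\<close>

lemma unstable_curveE:
  assumes "unstable_curve L J W"
  obtains \<gamma> where "W = \<gamma> ` J" "C1_holder e \<gamma> J"
    "\<And>s. s \<in> J \<Longrightarrow> \<gamma> s \<in> X" "\<And>s. s \<in> J \<Longrightarrow> \<gamma> s \<in> attractor L" "\<And>s. s \<in> J \<Longrightarrow> p (\<gamma> s) = s"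
    "\<And>s. s \<in> J \<Longrightarrow> backward (\<gamma> s)" "\<And>n. continuous_on J (\<lambda>s. (b ^^ n) (\<gamma> s))"
    "\<exists>C \<kappa>. 0 < \<kappa> \<and> \<kappa> < 1 \<and> (\<forall>n. \<forall>s\<in>J. \<forall>t\<in>J. dist ((b ^^ n) (\<gamma> s)) ((b ^^ n) (\<gamma> t)) \<le> C * \<kappa> ^ n)"
proof -
  obtain \<gamma> where \<gamma>: "W = \<gamma> ` J" "C1_holder e \<gamma> J"
    and 1: "\<forall>s\<in>J. \<gamma> s \<in> X \<inter> attractor L \<and> p (\<gamma> s) = s"
    and 2: "\<forall>n. (\<forall>s\<in>J. (b ^^ n) (\<gamma> s) \<in> f ` (X - \<Gamma>)) \<and> continuous_on J (\<lambda>s. (b ^^ n) (\<gamma> s))"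
    and 3: "\<exists>C \<kappa>. 0 < \<kappa> \<and> \<kappa> < 1 \<and> (\<forall>n. \<forall>s\<in>J. \<forall>t\<in>J. dist ((b ^^ n) (\<gamma> s)) ((b ^^ n) (\<gamma> t)) \<le> C * \<kappa> ^ n)"
    using assms unfolding unstable_curve_def by (elim conjE) (erule exE, elim conjE, rule that)
  have "backward (\<gamma> s)" if "s \<in> J" for s using 2 that unfolding backward_def by blast
  then show ?thesis using 1 2 by (intro that[OF \<gamma> _ _ _ _ _ 3]) blast+
qed

lemma unstable_curveD:
  assumes "unstable_curve L J W"
  shows "open J" "is_interval J" "J \<noteq> {}" "J \<subseteq> {-1..1}"
  using assms unfolding unstable_curve_def by auto

lemma unstable_curve_point:
  assumes "unstable_curve L J W" "w \<in> W"
  shows "w \<in> X" "backward w" "p w \<in> J"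
proof -
  obtain \<gamma> where "W = \<gamma> ` J" "\<And>s. s \<in> J \<Longrightarrow> \<gamma> s \<in> X" "\<And>s. s \<in> J \<Longrightarrow> p (\<gamma> s) = s"
    "\<And>s. s \<in> J \<Longrightarrow> backward (\<gamma> s)"
    by (rule unstable_curveE[OF assms(1)]) (rule that)
  then show "w \<in> X" "backward w" "p w \<in> J" using assms(2) by auto
qed

text \<open>Backward images of an unstable curve never meet the singular leaf, so they stay on one side of it,
  and on each side the quotient map is injective.\<close>

lemma backward_projections_agree:
  assumes W: "unstable_curve L J W" and W': "unstable_curve L J' W'"
    and v: "v \<in> W" "v' \<in> W'" "\<And>i. i \<le> n \<Longrightarrow> p ((b ^^ i) v) = p ((b ^^ i) v')"
    and w: "w \<in> W" "w' \<in> W'" "p w = p w'"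
  shows "p ((b ^^ n) w) = p ((b ^^ n) w')"
  using v(3)
proof (induction n)
  case 0
  then show ?case using w(3) by simp
next
  case (Suc n)
  have sgn: "0 < p ((b ^^ Suc n) w) * p ((b ^^ Suc n) v)"
    if W: "unstable_curve L J W" and v: "v \<in> W" and w: "w \<in> W" for J W v w
  proof -
    obtain \<gamma> where \<gamma>: "W = \<gamma> ` J" "\<And>s. s \<in> J \<Longrightarrow> backward (\<gamma> s)" "\<And>n. continuous_on J (\<lambda>s. (b ^^ n) (\<gamma> s))"
      by (rule unstable_curveE[OF W]) (rule that)
    obtain s t where st: "s \<in> J" "w = \<gamma> s" "t \<in> J" "v = \<gamma> t" using v w \<gamma>(1) by blast
    have bX: "(b ^^ Suc n) (\<gamma> s) \<in> X - \<Gamma>" if "s \<in> J" for s using backwardD(1)[OF \<gamma>(2)[OF that]] .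
    have "continuous_on J (\<lambda>s. p ((b ^^ Suc n) (\<gamma> s)))"
      by (rule continuous_on_compose2[OF proj_continuous \<gamma>(3)]) (use bX in blast)
    moreover have "p ((b ^^ Suc n) (\<gamma> s)) \<noteq> 0" if "s \<in> J" for s
      using bX[OF that] sing_iff[of "(b ^^ Suc n) (\<gamma> s)"] by simp
    ultimately show ?thesis
      unfolding st(2,4) by (rule same_sign_on_interval[OF _ unstable_curveD(2)[OF W] _ st(1,3)])
  qed
  have 1: "p ((b ^^ Suc n) v) = p ((b ^^ Suc n) v')" using Suc.prems by blast
  have 2: "p ((b ^^ n) w) = p ((b ^^ n) w')" using Suc.IH Suc.prems le_SucI by blast
  \<comment> \<open>The two curves are linked through \<open>v\<close> and \<open>v'\<close>, whose
    preimages at this level have equal projections; this puts the preimages of \<open>w\<close> and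
    \<open>w'\<close> on the same side.\<close>
  have same: "0 < p ((b ^^ Suc n) w) * p ((b ^^ Suc n) w')"
    using sgn[OF W v(1) w(1)] sgn[OF W' v(2) w(2)] unfolding 1 by (auto simp: zero_less_mult_iff)
  have bw: "(b ^^ Suc n) w \<in> X - \<Gamma>" "f ((b ^^ Suc n) w) = (b ^^ n) w"
    using backwardD[OF unstable_curve_point(2)[OF W w(1)]] .
  have bw': "(b ^^ Suc n) w' \<in> X - \<Gamma>" "f ((b ^^ Suc n) w') = (b ^^ n) w'"
    using backwardD[OF unstable_curve_point(2)[OF W' w(2)]] .
  have "q (p ((b ^^ Suc n) w)) = q (p ((b ^^ Suc n) w'))"
    using 2 proj_pmap[OF bw(1)] proj_pmap[OF bw'(1)] unfolding bw(2) bw'(2) by (simp only:)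
  then show ?case using bw(1) bw'(1) by (intro qmap_inj_side[OF _ _ same] proj_in) (simp_all only: Diff_iff)
qed

text \<open>At every depth \<open>n\<close> the backward images of \<open>w\<close> and
  \<open>w'\<close> lie on one stable leaf, and coming forward again contracts their distance to at
  most \<open>C * \<theta> ^ n\<close>. The curves may lie over different intervals, which makes the
  bracket independent of the interval.\<close>

lemma unstable_curve_unique:
  assumes W: "unstable_curve L J W" and W': "unstable_curve L J' W'"
    and v: "v \<in> W" "v \<in> W'" and w: "w \<in> W" "w' \<in> W'" "p w = p w'"
  shows "w = w'"
proof -
  obtain C \<theta> where \<theta>: "0 < \<theta>" "\<theta> < 1" and C: "\<forall>x\<in>X. \<forall>x'\<in>X. \<forall>n. p x' = p x \<and> iterates_avoid f \<Gamma> n x \<longrightarrow>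
            dist ((f ^^ n) x) ((f ^^ n) x') \<le> C * \<theta> ^ n" using stable_contraction by (elim exE conjE)
  have bw: "backward w" "backward w'" using unstable_curve_point(2) W W' w by blast+
  have bX: "(b ^^ n) w \<in> X" "(b ^^ n) w' \<in> X" for n
    using unstable_curve_point(1)[OF W w(1)] unstable_curve_point(1)[OF W' w(2)]
      backwardD(1)[OF bw(1)] backwardD(1)[OF bw(2)] by (cases n; auto)+
  have "dist w w' \<le> C * \<theta> ^ n" for n
  proof -
    have "p ((b ^^ n) w) = p ((b ^^ n) w')"
      by (rule backward_projections_agree[OF W W' v _ w]) simp
    then have "dist ((f ^^ n) ((b ^^ n) w)) ((f ^^ n) ((b ^^ n) w')) \<le> C * \<theta> ^ n"
      using C bX backward_avoid[OF bw(1)] by (metis (no_types))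
    then show ?thesis using forward_backward[OF bw(1), of n n] forward_backward[OF bw(2), of n n] by simp
  qed
  moreover have "(\<lambda>n. C * \<theta> ^ n) \<longlonglongrightarrow> C * 0"
    using \<theta> by (intro tendsto_mult tendsto_const LIMSEQ_power_zero) auto
  ultimately have "dist w w' \<le> 0" by (intro LIMSEQ_le_const[of "\<lambda>n. C * \<theta> ^ n"]) auto
  then show ?thesis by simp
qed

section \<open>Images of unstable curves\<close>

lemma unstable_curveI:
  assumes "open J" "is_interval J" "J \<noteq> {}" "J \<subseteq> {-1..1}" "C1_holder e \<gamma> J"
    "\<And>s. s \<in> J \<Longrightarrow> \<gamma> s \<in> X" "\<And>s. s \<in> J \<Longrightarrow> \<gamma> s \<in> attractor L" "\<And>s. s \<in> J \<Longrightarrow> p (\<gamma> s) = s"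
    "\<And>s. s \<in> J \<Longrightarrow> backward (\<gamma> s)" "\<And>n. continuous_on J (\<lambda>s. (b ^^ n) (\<gamma> s))"
    "0 < \<kappa>" "\<kappa> < 1" "\<And>n s t. s \<in> J \<Longrightarrow> t \<in> J \<Longrightarrow> dist ((b ^^ n) (\<gamma> s)) ((b ^^ n) (\<gamma> t)) \<le> C * \<kappa> ^ n"
  shows "unstable_curve L J (\<gamma> ` J)"
  unfolding unstable_curve_def
proof (intro conjI exI[of _ \<gamma>] allI ballI refl)
  show "(b ^^ n) (\<gamma> s) \<in> f ` (X - \<Gamma>)" if "s \<in> J" for n s
    using assms(9)[OF that] unfolding backward_def by blast
  show "\<exists>C \<kappa>. 0 < \<kappa> \<and> \<kappa> < 1 \<and> (\<forall>n. \<forall>s\<in>J. \<forall>t\<in>J. dist ((b ^^ n) (\<gamma> s)) ((b ^^ n) (\<gamma> t)) \<le> C * \<kappa> ^ n)"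
    by (rule exI[of _ C], rule exI[of _ \<kappa>]) (use assms(11-13) in simp)
qed (use assms(1-10) in simp_all)

lemma ret_regularity:
  obtains \<rho>' C where "0 \<le> C"
    "\<And>s. s \<in> {-1..1} - {0} \<Longrightarrow> ((\<lambda>s. ret L (\<sigma> s)) has_real_derivative \<rho>' s) (at s within {-1..1})"
    "\<And>s. s \<in> {-1..1} - {0} \<Longrightarrow> \<bar>\<rho>' s\<bar> \<le> C / \<bar>s\<bar>"
    "\<And>K. compact K \<Longrightarrow> K \<subseteq> {-1..1} - {0} \<Longrightarrow> holder_on e \<rho>' K"
proof -
  have "log_singularity e (lam_u L) (\<lambda>s. ret L (\<sigma> s))"
    using setting unfolding lorenz_setting_def by (elim conjE)
  then obtain \<rho>' C where 1: "\<forall>s\<in>{-1..1} - {0}. ((\<lambda>s. ret L (\<sigma> s)) has_real_derivative \<rho>' s) (at s within {-1..1}) \<and>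
        \<bar>\<rho>' s\<bar> \<le> C / \<bar>s\<bar> \<and> \<bar>ret L (\<sigma> s) + ln \<bar>s\<bar> / lam_u L\<bar> \<le> C"
    and 2: "\<forall>K. compact K \<and> K \<subseteq> {-1..1} - {0} \<longrightarrow>
        (\<exists>H. \<forall>s\<in>K. \<forall>t\<in>K. \<bar>\<rho>' s - \<rho>' t\<bar> \<le> H * \<bar>s - t\<bar> powr e)"
    unfolding log_singularity_def by (elim exE conjE)
  have "\<bar>\<rho>' s\<bar> \<le> \<bar>C\<bar> / \<bar>s\<bar>" if "s \<in> {-1..1} - {0}" for s
  proof -
    have "\<bar>\<rho>' s\<bar> \<le> C / \<bar>s\<bar>" using 1 that by blast
    also have "\<dots> \<le> \<bar>C\<bar> / \<bar>s\<bar>" by (intro divide_right_mono) auto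
    finally show ?thesis .
  qed
  moreover have "holder_on e \<rho>' K" if "compact K" "K \<subseteq> {-1..1} - {0}" for K
    using 2 that unfolding holder_on_def real_norm_def by blast
  ultimately show ?thesis using 1 by (intro that[of "\<bar>C\<bar>" \<rho>']) auto
qed

text \<open>Off the singular leaf the return time is of class C^(1+e), so flowing each point of a
  short piece around \<open>a\<close> for its return time gives a C^(1+e) curve. Its projection is
  the quotient map, with derivative bounded away from 0, and can therefore serve as parameter. Only
  a piece around \<open>f a\<close> is claimed, since the full image may be cut at the singular
  leaf.\<close>

lemma unstable_curve_pmap:
  assumes W: "unstable_curve L J W" and a: "a \<in> W" "a \<notin> \<Gamma>"
  obtains J' W' where "unstable_curve L J' W'" "f a \<in> W'" "W' \<subseteq> f ` (W - \<Gamma>)"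
proof -
  obtain \<gamma> where \<gamma>: "W = \<gamma> ` J" "C1_holder e \<gamma> J"
    "\<And>s. s \<in> J \<Longrightarrow> \<gamma> s \<in> X" "\<And>s. s \<in> J \<Longrightarrow> \<gamma> s \<in> attractor L" "\<And>s. s \<in> J \<Longrightarrow> p (\<gamma> s) = s"
    "\<And>s. s \<in> J \<Longrightarrow> backward (\<gamma> s)" "\<And>n. continuous_on J (\<lambda>s. (b ^^ n) (\<gamma> s))"
    and ctr: "\<exists>C \<kappa>. 0 < \<kappa> \<and> \<kappa> < 1 \<and> (\<forall>n. \<forall>s\<in>J. \<forall>t\<in>J. dist ((b ^^ n) (\<gamma> s)) ((b ^^ n) (\<gamma> t)) \<le> C * \<kappa> ^ n)"
    by (rule unstable_curveE[OF W]) (rule that)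
  note J = unstable_curveD[OF W]
  obtain s0 where s0: "s0 \<in> J" "a = \<gamma> s0" using a(1) \<gamma>(1) by blast
  have "s0 \<noteq> 0" using sing_iff[OF \<gamma>(3)[OF s0(1)]] \<gamma>(5)[OF s0(1)] a(2) s0(2) by auto
  then have "open (J - {0})" "s0 \<in> J - {0}" using J(1) s0(1) by (auto intro: open_Diff)
  then obtain d where d: "0 < d" "cball s0 d \<subseteq> J - {0}" by (meson open_contains_cball)
  have notsing: "\<gamma> s \<in> X - \<Gamma>" if "s \<in> J - {0}" for s using sing_iff[OF \<gamma>(3)] \<gamma>(3,5) that by auto
  define J1 where "J1 = ball s0 d"
  have J1: "J1 \<subseteq> J - {0}" using d(2) ball_subset_cball unfolding J1_def by blast
  have J1D: "s \<in> J - {0}" "s \<in> J" "s \<in> {-1..1} - {0}" if "s \<in> J1" for s using that J1 J(4) by blast+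
  have bJ1: "bounded J1" "convex J1" unfolding J1_def by auto
  obtain \<gamma>' where \<gamma>': "holder_curve e \<gamma> \<gamma>' J1"
    using holder_curve_of_C1_holder[OF \<gamma>(2), of J1 "cball s0 d"] d(2) ball_subset_cball[of s0 d] unfolding J1_def by auto
  define \<rho> where "\<rho> = (\<lambda>s. ret L (\<sigma> s))"
  have interior: "at s within {-1..1} = at s" if "s \<in> J" for s
    using J(1,4) that by (intro at_within_interior) (meson interiorI)
  obtain \<rho>' where "\<And>s. s \<in> {-1..1} - {0} \<Longrightarrow> ((\<lambda>s. ret L (\<sigma> s)) has_real_derivative \<rho>' s) (at s within {-1..1})"
    "\<And>K. compact K \<Longrightarrow> K \<subseteq> {-1..1} - {0} \<Longrightarrow> holder_on e \<rho>' K"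
    by (rule ret_regularity) (rule that)
  note \<rho>' = this[folded \<rho>_def]
  have \<rho>c: "holder_curve e \<rho> \<rho>' J1"
    unfolding holder_curve_def
  proof
    show "\<forall>s\<in>J1. (\<rho> has_vector_derivative \<rho>' s) (at s)"
    proof
      fix s assume "s \<in> J1"
      then have s: "s \<in> J" "s \<in> {-1..1} - {0}" by (rule J1D)+
      show "(\<rho> has_vector_derivative \<rho>' s) (at s)"
        using \<rho>'(1)[OF s(2)] unfolding interior[OF s(1)] has_real_derivative_iff_has_vector_derivative .
    qed
    have "holder_on e \<rho>' (cball s0 d)" using d(2) J(4) by (intro \<rho>'(2)) auto
    then show "holder_on e \<rho>' J1" unfolding J1_def by (rule holder_on_subset) (rule ball_subset_cball)
  qed
  define \<phi> where "\<phi> = (\<lambda>s. flow L (\<rho> s) (\<gamma> s))"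
  have uc: "holder_curve e (\<lambda>s. (\<rho> s, \<gamma> s)) (\<lambda>s. (\<rho>' s, \<gamma>' s)) J1"
    by (rule holder_curve_Pair[OF \<rho>c \<gamma>'])
  obtain M where M: "0 \<le> M" "\<And>s t. s \<in> J1 \<Longrightarrow> t \<in> J1 \<Longrightarrow> norm ((\<rho> s, \<gamma> s) - (\<rho> t, \<gamma> t)) \<le> M * \<bar>s - t\<bar>"
    by (rule holder_curve_lipschitz[OF uc bJ1 less_imp_le[OF hexp_bounds(1)]]) (rule that)
  have s0J1: "s0 \<in> J1" using d(1) by (simp add: J1_def)
  have "(\<lambda>s. (\<rho> s, \<gamma> s)) ` J1 \<subseteq> cball (\<rho> s0, \<gamma> s0) (M * d)"
  proof safe
    fix s assume s: "s \<in> J1"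
    have "M * \<bar>s0 - s\<bar> \<le> M * d" using M(1) s by (intro mult_left_mono) (auto simp: J1_def dist_real_def)
    then show "(\<rho> s, \<gamma> s) \<in> cball (\<rho> s0, \<gamma> s0) (M * d)" using M(2)[OF s0J1 s] by (simp add: dist_norm)
  qed
  then obtain \<phi>' where "holder_curve e (\<lambda>s. (\<lambda>(t, x). flow L t x) (\<rho> s, \<gamma> s)) \<phi>' J1"
    using holder_curve_compose[OF uc bJ1 less_imp_le[OF hexp_bounds(1)] flow_C1_holder compact_cball subset_UNIV] by blast
  then have \<phi>': "holder_curve e \<phi> \<phi>' J1" by (simp add: \<phi>_def)
  \<comment> \<open>The return time is constant on stable leaves, so its value at the point of the
    transversal over \<open>s\<close> is that at \<open>\<gamma> s\<close>.\<close>
  have \<phi>f: "\<phi> s = f (\<gamma> s)" if "s \<in> J1" for s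
    using ret_proj[OF notsing[OF J1D(1)[OF that]]] \<gamma>(5)[OF J1D(2)[OF that]] by (simp add: \<phi>_def \<rho>_def pmap_flow)
  have \<phi>X: "\<phi> s \<in> X" if "s \<in> J1" for s using \<phi>f[OF that] pmap_in[OF notsing[OF J1D(1)[OF that]]] by simp
  obtain B and h :: "real^3 \<Rightarrow> real^3" and r where B: "open B" "C1_holder e h B" "0 < r" "cball (\<phi> s0) r \<subseteq> B"
    "\<And>z. z \<in> X \<Longrightarrow> z \<in> B \<Longrightarrow> h z $ 1 = p z"
    using section_chart_ball[OF \<phi>X[OF s0J1]] by blast
  have "isCont \<phi> s0" using \<phi>' s0J1 unfolding holder_curve_def by (blast intro: has_vector_derivative_continuous)
  then obtain d2 where d2: "0 < d2" "\<And>s. dist s s0 < d2 \<Longrightarrow> dist (\<phi> s) (\<phi> s0) < r"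
    using B(3) unfolding continuous_at_eps_delta by blast
  define J2 where "J2 = ball s0 (min d d2)"
  have J2: "J2 \<subseteq> J1" "open J2" "convex J2" "bounded J2" "is_interval J2" "s0 \<in> J2"
    using d(1) d2(1) by (auto simp: J2_def J1_def is_interval_ball_real)
  have J2r: "\<phi> ` J2 \<subseteq> cball (\<phi> s0) r" using d2(2) by (force simp: J2_def dist_commute less_imp_le)
  have \<phi>2: "holder_curve e \<phi> \<phi>' J2" by (rule holder_curve_subset[OF \<phi>' J2(1)])
  obtain k' where k': "holder_curve e (\<lambda>s. h (\<phi> s)) k' J2"
    using holder_curve_compose[OF \<phi>2 J2(4,3) less_imp_le[OF hexp_bounds(1)] B(2) compact_cball B(4) J2r] by blast
  define v where "v = (\<lambda>s. h (\<phi> s) $ 1)"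
  define v' where "v' = (\<lambda>s. k' s $ 1)"
  have vc: "holder_curve e v v' J2"
    unfolding v_def v'_def by (rule holder_curve_linear[OF bounded_linear_vec_nth k'])
  have vp: "v s = p (\<phi> s)" if "s \<in> J2" for s
    unfolding v_def using that J2(1) J2r B(4) by (intro B(5) \<phi>X) auto
  have vq: "v s = q s" if "s \<in> J2" for s
  proof -
    have s: "s \<in> J1" using that J2(1) by blast
    show ?thesis using vp[OF that] \<phi>f[OF s] proj_pmap[OF notsing[OF J1D(1)[OF s]]] \<gamma>(5)[OF J1D(2)[OF s]] by simp
  qed
  obtain m where m: "m > 0" "\<forall>s\<in>{-1..1} - {0}. \<exists>D. (q has_real_derivative D) (at s within {-1..1}) \<and> m \<le> \<bar>D\<bar>"
    using qmap_derivative by blast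
  \<comment> \<open>The chart provides the Hoelder derivative \<open>v'\<close>, expansion of the
    quotient map provides the lower bound; the two functions coincide on the open set
    \<open>J2\<close>, hence so do their derivatives.\<close>
  have mv: "m \<le> \<bar>v' s\<bar>" if s: "s \<in> J2" for s
  proof -
    have sJ: "s \<in> J" "s \<in> {-1..1} - {0}" using s J2(1) J1D by blast+
    obtain D where D: "(q has_real_derivative D) (at s within {-1..1})" "m \<le> \<bar>D\<bar>" using m(2) sJ(2) by blast
    have "(q has_real_derivative D) (at s)" using D(1) unfolding interior[OF sJ(1)] .
    then have "(v has_real_derivative D) (at s)"
      by (rule has_field_derivative_transform_within_open[OF _ J2(2) s]) (simp add: vq)
    moreover have "(v has_real_derivative v' s) (at s)"
      using vc s unfolding holder_curve_def has_real_derivative_iff_has_vector_derivative by blast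
    ultimately have "D = v' s" by (rule DERIV_unique)
    then show ?thesis using D(2) by simp
  qed
  note rp = holder_curve_reparametrize[OF \<phi>2 vc J2(2,5,4) less_imp_le[OF hexp_bounds(1)] m(1) mv]
  define \<psi> where "\<psi> = inv_into J2 v"
  have \<psi>: "\<psi> t \<in> J2" "v (\<psi> t) = t" if "t \<in> v ` J2" for t
    using that unfolding \<psi>_def by (simp_all add: inv_into_into f_inv_into_f)
  have \<psi>J: "\<psi> t \<in> J - {0}" "\<psi> t \<in> J" "\<psi> t \<in> J1" if "t \<in> v ` J2" for t
    using \<psi>(1)[OF that] J2(1) J1D by blast+
  obtain w' where w': "holder_curve e (\<lambda>t. \<phi> (\<psi> t)) w' (v ` J2)" using rp(4) unfolding \<psi>_def by blast
  have \<psi>cont: "continuous_on (v ` J2) \<psi>"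
  proof (rule lipschitz_on_continuous_on)
    show "(1 / m)-lipschitz_on (v ` J2) \<psi>"
      using rp(5) m(1) unfolding \<psi>_def
      by (intro lipschitz_onI) (auto simp: dist_real_def pos_le_divide_eq mult.commute)
  qed
  obtain C0 \<kappa> where \<kappa>: "0 < \<kappa>" "\<kappa> < 1" and C0: "\<forall>n. \<forall>s\<in>J. \<forall>t\<in>J. dist ((b ^^ n) (\<gamma> s)) ((b ^^ n) (\<gamma> t)) \<le> C0 * \<kappa> ^ n"
    using ctr by (elim exE conjE)
  have bShift: "(b ^^ Suc n) (\<phi> (\<psi> t)) = (b ^^ n) (\<gamma> (\<psi> t))" if t: "t \<in> v ` J2" for n t
    using \<phi>f[OF \<psi>J(3)[OF t]] pmap_inv_pmap[OF notsing[OF \<psi>J(1)[OF t]]] by (simp add: funpow_Suc_right del: funpow.simps)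
  have curve: "unstable_curve L (v ` J2) ((\<lambda>t. \<phi> (\<psi> t)) ` v ` J2)"
  proof (rule unstable_curveI)
    show "open (v ` J2)" by (rule rp(2))
    show "is_interval (v ` J2)" by (rule rp(3))
    show "v ` J2 \<noteq> {}" using J2(6) by blast
    show "v ` J2 \<subseteq> {-1..1}" using vp proj_in[OF \<phi>X] J2(1) by fastforce
    show "C1_holder e (\<lambda>t. \<phi> (\<psi> t)) (v ` J2)" by (rule C1_holder_of_holder_curve[OF w'])
    show "0 < \<kappa>" "\<kappa> < 1" by (rule \<kappa>)+
    fix t assume t: "t \<in> v ` J2"
    have eq: "\<phi> (\<psi> t) = f (\<gamma> (\<psi> t))" by (rule \<phi>f[OF \<psi>J(3)[OF t]])
    show "\<phi> (\<psi> t) \<in> X" by (rule \<phi>X[OF \<psi>J(3)[OF t]])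
    show "\<phi> (\<psi> t) \<in> attractor L"
      unfolding eq by (rule pmap_attractor[OF \<gamma>(4)[OF \<psi>J(2)[OF t]] notsing[OF \<psi>J(1)[OF t]]])
    show "p (\<phi> (\<psi> t)) = t" using vp[OF \<psi>(1)[OF t]] \<psi>(2)[OF t] by simp
    show "backward (\<phi> (\<psi> t))"
      unfolding backward_def
    proof
      fix n show "(b ^^ n) (\<phi> (\<psi> t)) \<in> f ` (X - \<Gamma>)"
      proof (cases n)
        case 0 then show ?thesis using eq notsing[OF \<psi>J(1)[OF t]] by simp
      next
        case (Suc k)
        then show ?thesis using bShift[OF t, of k] \<gamma>(6)[OF \<psi>J(2)[OF t]] unfolding backward_def by (simp only:)
      qed
    qed
  next
    fix n show "continuous_on (v ` J2) (\<lambda>t. (b ^^ n) (\<phi> (\<psi> t)))"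
    proof (cases n)
      case 0 then show ?thesis using holder_curve_continuous_on[OF w'] by simp
    next
      case (Suc k)
      have "continuous_on (v ` J2) (\<lambda>t. (b ^^ k) (\<gamma> (\<psi> t)))"
        by (rule continuous_on_compose2[OF \<gamma>(7) \<psi>cont]) (use \<psi>J(2) in blast)
      then show ?thesis unfolding Suc by (simp only: bShift cong: continuous_on_cong)
    qed
  next
    fix n t t' assume t: "t \<in> v ` J2" "t' \<in> v ` J2"
    \<comment> \<open>For \<open>n = 0\<close> both points lie in a ball of radius \<open>r\<close>.
      For larger \<open>n\<close> one backward step leads to \<open>W\<close>, whose contraction
      then has one step less; this costs the factor \<open>1 / \<kappa>\<close>.\<close>
    show "dist ((b ^^ n) (\<phi> (\<psi> t))) ((b ^^ n) (\<phi> (\<psi> t'))) \<le> max (2 * r) (C0 / \<kappa>) * \<kappa> ^ n"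
    proof (cases n)
      case 0
      have "dist (\<phi> (\<psi> t)) (\<phi> (\<psi> t')) \<le> dist (\<phi> (\<psi> t)) (\<phi> s0) + dist (\<phi> (\<psi> t')) (\<phi> s0)"
        by (rule dist_triangle2)
      also have "\<dots> \<le> r + r" using J2r \<psi>(1)[OF t(1)] \<psi>(1)[OF t(2)] by (intro add_mono) (auto simp: dist_commute)
      finally show ?thesis using 0 by simp
    next
      case (Suc k)
      have "dist ((b ^^ k) (\<gamma> (\<psi> t))) ((b ^^ k) (\<gamma> (\<psi> t'))) \<le> C0 * \<kappa> ^ k"
        using C0 \<psi>J(2)[OF t(1)] \<psi>J(2)[OF t(2)] by blast
      also have "\<dots> = (C0 / \<kappa>) * \<kappa> ^ Suc k" using \<kappa>(1) by simp
      also have "\<dots> \<le> max (2 * r) (C0 / \<kappa>) * \<kappa> ^ Suc k" using \<kappa>(1) by (intro mult_right_mono) auto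
      finally show ?thesis unfolding Suc bShift[OF t(1)] bShift[OF t(2)] .
    qed
  qed
  have "f a \<in> (\<lambda>t. \<phi> (\<psi> t)) ` v ` J2"
  proof -
    have "\<psi> (v s0) = s0" unfolding \<psi>_def by (rule inv_into_f_f[OF rp(1) J2(6)])
    then show ?thesis using \<phi>f[OF s0J1] s0(2) J2(6) by force
  qed
  moreover have "(\<lambda>t. \<phi> (\<psi> t)) ` v ` J2 \<subseteq> f ` (W - \<Gamma>)"
  proof (rule image_subsetI)
    fix t assume t: "t \<in> v ` J2"
    have "\<gamma> (\<psi> t) \<in> W - \<Gamma>" using \<gamma>(1) notsing[OF \<psi>J(1)[OF t]] \<psi>J(2)[OF t] by blast
    then show "\<phi> (\<psi> t) \<in> f ` (W - \<Gamma>)" unfolding \<phi>f[OF \<psi>J(3)[OF t]] by blast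
  qed
  ultimately show ?thesis by (rule that[OF curve])
qed

lemma unstable_curve_pmap_iterate:
  assumes W: "unstable_curve L J W" and a: "a \<in> W" "iterates_avoid f \<Gamma> l a"
  obtains J' W' where "unstable_curve L J' W'" "(f ^^ l) a \<in> W'" "W' \<subseteq> (f ^^ l) ` {x \<in> W. iterates_avoid f \<Gamma> l x}"
  using a(2)
proof (induction l arbitrary: thesis)
  case 0
  show ?case by (rule "0.prems"(1)[OF W]) (use a in \<open>auto simp: iterates_avoid_def\<close>)
next
  case (Suc l)
  have "iterates_avoid f \<Gamma> l a" using Suc.prems(2) unfolding iterates_avoid_def by simp
  then obtain J1 W1 where W1: "unstable_curve L J1 W1" "(f ^^ l) a \<in> W1" "W1 \<subseteq> (f ^^ l) ` {x \<in> W. iterates_avoid f \<Gamma> l x}"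
    using Suc.IH by blast
  have "(f ^^ l) a \<notin> \<Gamma>" using Suc.prems(2) unfolding iterates_avoid_def by simp
  then obtain J2 W2 where W2: "unstable_curve L J2 W2" "f ((f ^^ l) a) \<in> W2" "W2 \<subseteq> f ` (W1 - \<Gamma>)"
    using unstable_curve_pmap[OF W1(1,2)] by blast
  have "W2 \<subseteq> (f ^^ Suc l) ` {x \<in> W. iterates_avoid f \<Gamma> (Suc l) x}"
  proof
    fix w assume "w \<in> W2"
    then obtain x where x: "x \<in> W" "iterates_avoid f \<Gamma> l x" "w = f ((f ^^ l) x)" "(f ^^ l) x \<notin> \<Gamma>"
      using W2(3) W1(3) by blast
    then have "iterates_avoid f \<Gamma> (Suc l) x" unfolding iterates_avoid_def by (auto simp: less_Suc_eq)
    then show "w \<in> (f ^^ Suc l) ` {x \<in> W. iterates_avoid f \<Gamma> (Suc l) x}" using x(1,3) by auto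
  qed
  then show ?case using Suc.prems(1)[OF W2(1)] W2(2) by simp
qed

section \<open>The temporal distortion function\<close>

text \<open>The derivative has size at most \<open>C / \<bar>s\<bar>\<close>. The conditions keep
  the segment between \<open>s\<close> and \<open>t\<close> on one side of the singularity and at
  distance at least \<open>d\<close> from it.\<close>

lemma ret_lipschitz:
  assumes d: "0 < d"
  obtains M where "0 \<le> M" "\<And>s t. s \<in> {-1..1} \<Longrightarrow> t \<in> {-1..1} \<Longrightarrow> d \<le> \<bar>s\<bar> \<Longrightarrow> d \<le> \<bar>t\<bar> \<Longrightarrow> 0 < s * t \<Longrightarrow>
    \<bar>ret L (\<sigma> s) - ret L (\<sigma> t)\<bar> \<le> M * \<bar>s - t\<bar>"
proof -
  obtain \<rho>' C where C: "0 \<le> C"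
    "\<And>s. s \<in> {-1..1} - {0} \<Longrightarrow> ((\<lambda>s. ret L (\<sigma> s)) has_real_derivative \<rho>' s) (at s within {-1..1})"
    "\<And>s. s \<in> {-1..1} - {0} \<Longrightarrow> \<bar>\<rho>' s\<bar> \<le> C / \<bar>s\<bar>"
    by (rule ret_regularity) (rule that)
  have main: "norm (ret L (\<sigma> s) - ret L (\<sigma> t)) \<le> C / d * norm (s - t)"
    if K: "K = {d..1} \<or> K = {-1..-d}" "s \<in> K" "t \<in> K" for K s t
  proof (rule differentiable_bound[OF _ _ _ K(2,3)])
    show "convex K" using K(1) by auto
    fix x assume x: "x \<in> K"
    then have x': "x \<in> {-1..1} - {0}" "d \<le> \<bar>x\<bar>" and sub: "K \<subseteq> {-1..1}" using K(1) d by auto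
    show "((\<lambda>s. ret L (\<sigma> s)) has_derivative (\<lambda>h. \<rho>' x * h)) (at x within K)"
      using C(2)[OF x'(1)] sub unfolding has_field_derivative_def by (rule has_derivative_subset)
    have "\<bar>\<rho>' x\<bar> \<le> C / \<bar>x\<bar>" by (rule C(3)[OF x'(1)])
    also have "\<dots> \<le> C / d" using x'(2) d C(1) by (intro divide_left_mono) auto
    finally have "\<bar>\<rho>' x\<bar> \<le> C / d" .
    then show "onorm (\<lambda>h. \<rho>' x * h) \<le> C / d"
      by (intro onorm_le) (simp add: abs_mult mult_right_mono del: times_divide_eq_left)
  qed
  have "\<bar>ret L (\<sigma> s) - ret L (\<sigma> t)\<bar> \<le> C / d * \<bar>s - t\<bar>"
    if "s \<in> {-1..1}" "t \<in> {-1..1}" "d \<le> \<bar>s\<bar>" "d \<le> \<bar>t\<bar>" "0 < s * t" for s t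
  proof -
    have "(s \<in> {d..1} \<and> t \<in> {d..1}) \<or> (s \<in> {-1..-d} \<and> t \<in> {-1..-d})"
      using that d by (auto simp: zero_less_mult_iff)
    then show ?thesis using main[of "{d..1}" s t] main[of "{-1..-d}" s t] unfolding real_norm_def by blast
  qed
  then show ?thesis using that[of "C / d"] C(1) d by simp
qed

text \<open>Radius and constant in \<open>proj_lipschitz\<close> depend on the point; finitely many
  points, such as those of a periodic backward orbit, admit common ones.\<close>

lemma proj_lipschitz_finite:
  assumes "finite Q" "Q \<subseteq> X"
  shows "\<exists>r>0. \<exists>M\<ge>0. \<forall>x\<in>Q. \<forall>z\<in>X \<inter> ball x r. \<forall>z'\<in>X \<inter> ball x r. \<bar>p z - p z'\<bar> \<le> M * dist z z'"
  using assms
proof (induction Q)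
  case empty
  show ?case by (rule exI[of _ 1]) auto
next
  case (insert x Q)
  then obtain r M where rM: "r > 0" "M \<ge> 0"
    "\<And>x z z'. x \<in> Q \<Longrightarrow> z \<in> X \<inter> ball x r \<Longrightarrow> z' \<in> X \<inter> ball x r \<Longrightarrow> \<bar>p z - p z'\<bar> \<le> M * dist z z'" by auto
  have "x \<in> X" using insert.prems by blast
  then obtain r1 M1 where rM1: "0 < r1" "0 \<le> M1" "\<And>z z'. z \<in> X \<Longrightarrow> z' \<in> X \<Longrightarrow> z \<in> ball x r1 \<Longrightarrow> z' \<in> ball x r1 \<Longrightarrow> \<bar>p z - p z'\<bar> \<le> M1 * dist z z'"
    by (rule proj_lipschitz) (rule that)
  have mono: "M * dist z z' \<le> max M M1 * dist z z'" "M1 * dist z z' \<le> max M M1 * dist z z'" for z z' :: "real^3"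
    by (intro mult_right_mono; simp)+
  have "\<bar>p z - p z'\<bar> \<le> max M M1 * dist z z'"
    if "w \<in> insert x Q" "z \<in> X \<inter> ball w (min r r1)" "z' \<in> X \<inter> ball w (min r r1)" for w z z'
  proof (cases "w = x")
    case True
    then have "\<bar>p z - p z'\<bar> \<le> M1 * dist z z'" using that by (intro rM1(3)) auto
    then show ?thesis using mono(2)[of z z'] by linarith
  next
    case False
    then have "\<bar>p z - p z'\<bar> \<le> M * dist z z'" using that by (intro rM(3)[of w]) auto
    then show ?thesis using mono(1)[of z z'] by linarith
  qed
  then show ?case using rM(1,2) rM1(1)
    by (intro exI[of _ "min r r1"] conjI exI[of _ "max M M1"] ballI) auto
qed

text \<open>Along a backward orbit that follows a finite set of points off the singular leaf, the logarithmic
  singularity of the return time is not felt, so the terms decay exponentially.\<close>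

lemma D0_term_summable_finite:
  assumes W: "unstable_curve L J W" "z \<in> W" "a \<in> W" and fin: "finite (range (\<lambda>n. (b ^^ n) z))"
  shows "summable (\<lambda>j. D0_term L a z (Suc j))"
proof -
  obtain \<gamma> where \<gamma>: "W = \<gamma> ` J" "\<exists>C \<kappa>. 0 < \<kappa> \<and> \<kappa> < 1 \<and> (\<forall>n. \<forall>s\<in>J. \<forall>t\<in>J. dist ((b ^^ n) (\<gamma> s)) ((b ^^ n) (\<gamma> t)) \<le> C * \<kappa> ^ n)"
    by (rule unstable_curveE[OF W(1)]) (rule that)
  then obtain C \<kappa> where \<kappa>: "0 < \<kappa>" "\<kappa> < 1" and "\<forall>n. \<forall>s\<in>J. \<forall>t\<in>J. dist ((b ^^ n) (\<gamma> s)) ((b ^^ n) (\<gamma> t)) \<le> C * \<kappa> ^ n"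
    by (elim exE conjE)
  then have C: "dist ((b ^^ n) a) ((b ^^ n) z) \<le> C * \<kappa> ^ n" for n using W(2,3) \<gamma>(1) by blast
  define A where "A j = (b ^^ Suc j) a" for j
  define Z where "Z j = (b ^^ Suc j) z" for j
  have AX: "A j \<in> X - \<Gamma>" and ZX: "Z j \<in> X - \<Gamma>" for j
    using backwardD(1)[OF unstable_curve_point(2)[OF W(1)]] W(2,3) unfolding A_def Z_def by blast+
  define Q where "Q = range Z"
  have "Q \<subseteq> range (\<lambda>n. (b ^^ n) z)" unfolding Q_def Z_def by blast
  then have finQ: "finite Q" using fin finite_subset by blast
  have QX: "Q \<subseteq> X - \<Gamma>" unfolding Q_def using ZX by blast
  define \<delta> where "\<delta> = Min ((\<lambda>x. \<bar>p x\<bar>) ` Q)"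
  have "\<delta> \<in> (\<lambda>x. \<bar>p x\<bar>) ` Q" unfolding \<delta>_def using finQ by (intro Min_in) (auto simp: Q_def)
  then have \<delta>: "0 < \<delta>" using QX sing_iff by auto
  have \<delta>le: "\<delta> \<le> \<bar>p (Z j)\<bar>" for j unfolding \<delta>_def using finQ by (intro Min_le) (auto simp: Q_def)
  obtain r M where rM: "r > 0" "M \<ge> 0"
    and M: "\<forall>x\<in>Q. \<forall>z\<in>X \<inter> ball x r. \<forall>z'\<in>X \<inter> ball x r. \<bar>p z - p z'\<bar> \<le> M * dist z z'"
    using proj_lipschitz_finite[OF finQ] QX by blast
  obtain M1 where M1: "0 \<le> M1" "\<And>s t. s \<in> {-1..1} \<Longrightarrow> t \<in> {-1..1} \<Longrightarrow> \<delta> / 2 \<le> \<bar>s\<bar> \<Longrightarrow> \<delta> / 2 \<le> \<bar>t\<bar> \<Longrightarrow> 0 < s * t \<Longrightarrow>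
    \<bar>ret L (\<sigma> s) - ret L (\<sigma> t)\<bar> \<le> M1 * \<bar>s - t\<bar>"
    by (rule ret_lipschitz[of "\<delta> / 2"]) (use \<delta> in simp, rule that)
  have lim: "(\<lambda>j. C * \<kappa> ^ Suc j) \<longlonglongrightarrow> C * 0"
    using \<kappa> by (intro tendsto_mult tendsto_const LIMSEQ_Suc LIMSEQ_power_zero) auto
  then have "(\<lambda>j. M * (C * \<kappa> ^ Suc j)) \<longlonglongrightarrow> M * (C * 0)" by (rule tendsto_mult[OF tendsto_const])
  then have "\<forall>\<^sub>F j in sequentially. M * (C * \<kappa> ^ Suc j) < \<delta> / 2" using \<delta> by (intro order_tendstoD) auto
  moreover have "\<forall>\<^sub>F j in sequentially. C * \<kappa> ^ Suc j < r" using lim rM(1) by (intro order_tendstoD) auto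
  \<comment> \<open>From some index on, \<open>A j\<close> is in the ball around \<open>Z j\<close>
    where the projection is Lipschitz, and its projection is within \<open>\<delta> / 2\<close> of
    that of \<open>Z j\<close>. Both projections are then on one side of 0 and at distance at least
    \<open>\<delta> / 2\<close> from it, where the return time is Lipschitz.\<close>
  ultimately have "\<forall>\<^sub>F j in sequentially. norm (D0_term L a z (Suc j)) \<le> M1 * (M * C * \<kappa>) * \<kappa> ^ j"
  proof eventually_elim
    case (elim j)
    have d: "dist (A j) (Z j) \<le> C * \<kappa> ^ Suc j" unfolding A_def Z_def by (rule C)
    then have "A j \<in> X \<inter> ball (Z j) r" "Z j \<in> X \<inter> ball (Z j) r" using elim(2) rM(1) AX[of j] ZX[of j] by (auto simp: dist_commute)
    then have "\<bar>p (A j) - p (Z j)\<bar> \<le> M * dist (A j) (Z j)" using M unfolding Q_def by blast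
    also have "\<dots> \<le> M * (C * \<kappa> ^ Suc j)" using d rM(2) by (rule mult_left_mono)
    finally have pd: "\<bar>p (A j) - p (Z j)\<bar> \<le> M * (C * \<kappa> ^ Suc j)" .
    then have near: "\<bar>p (A j) - p (Z j)\<bar> < \<delta> / 2" using elim(1) by linarith
    have "0 < p (A j) * p (Z j)"
    proof (cases "p (Z j) > 0")
      case True
      then have "p (A j) > 0" using near \<delta>le[of j] \<delta> by linarith
      then show ?thesis using True by simp
    next
      case False
      then have "p (A j) < 0" "p (Z j) < 0" using near \<delta>le[of j] \<delta> by linarith+
      then show ?thesis by (rule mult_neg_neg)
    qed
    then have "\<bar>ret L (\<sigma> (p (A j))) - ret L (\<sigma> (p (Z j)))\<bar> \<le> M1 * \<bar>p (A j) - p (Z j)\<bar>"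
    proof (rule M1(2)[rotated 4])
      show "\<delta> / 2 \<le> \<bar>p (A j)\<bar>" using near \<delta>le[of j] by linarith
      show "\<delta> / 2 \<le> \<bar>p (Z j)\<bar>" using \<delta>le[of j] \<delta> by linarith
      show "p (A j) \<in> {-1..1}" "p (Z j) \<in> {-1..1}" using proj_in AX[of j] ZX[of j] by blast+
    qed
    also have "\<dots> \<le> M1 * (M * (C * \<kappa> ^ Suc j))" using pd M1(1) by (rule mult_left_mono)
    finally show ?case unfolding D0_term_def A_def[symmetric] Z_def[symmetric] ret_proj[OF AX] ret_proj[OF ZX]
      by (simp add: mult_ac)
  qed
  then show ?thesis
    by (rule summable_comparison_test_ev) (intro summable_mult summable_geometric, use \<kappa> in simp)
qed

text \<open>Both \<open>a\<close> and \<open>c\<close> are compared with the reference point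
  \<open>z\<close>, and the terms for \<open>a\<close>, \<open>z\<close> and for \<open>c\<close>,
  \<open>z\<close> subtract to those for \<open>a\<close>, \<open>c\<close>. Applying the iterate
  \<open>l\<close> only puts finitely many terms in front.\<close>

lemma D0_term_summable:
  assumes W: "unstable_curve L J W" "z \<in> W" and fin: "finite (range (\<lambda>n. (b ^^ n) z))"
    and a: "a \<in> W" "iterates_avoid f \<Gamma> l a" and c: "c \<in> W" "iterates_avoid f \<Gamma> l c"
  shows "summable (\<lambda>j. D0_term L ((f ^^ l) a) ((f ^^ l) c) (Suc j))"
proof -
  have "summable (\<lambda>j. D0_term L a z (Suc j) - D0_term L c z (Suc j))"
    by (intro summable_diff D0_term_summable_finite[OF W(1,2) _ fin] a c)
  moreover have "(b ^^ Suc (j + l)) ((f ^^ l) x) = (b ^^ Suc j) x" if "x \<in> W" "iterates_avoid f \<Gamma> l x" for x j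
  proof -
    have "(b ^^ l) ((f ^^ l) x) = x" using backward_forward(2)[OF unstable_curve_point(1)[OF W(1) that(1)] that(2) order_refl] by simp
    then show ?thesis using funpow_add[of "Suc j" l b] by (simp only: add_Suc comp_apply)
  qed
  ultimately have "summable (\<lambda>j. D0_term L ((f ^^ l) a) ((f ^^ l) c) (Suc (j + l)))"
    unfolding D0_term_def by (simp only: a c) (simp add: algebra_simps)
  then show ?thesis by (rule summable_iff_shift[THEN iffD1])
qed

section \<open>Inducing schemes and the finite subsystem\<close>

lemma iterates_projection:
  assumes "x \<in> X" "\<And>i. i < n \<Longrightarrow> (q ^^ i) (p x) \<noteq> 0"
  shows "iterates_avoid f \<Gamma> n x" "(f ^^ n) x \<in> X" "p ((f ^^ n) x) = (q ^^ n) (p x)"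
proof -
  have "iterates_avoid f \<Gamma> n x \<and> (f ^^ n) x \<in> X \<and> p ((f ^^ n) x) = (q ^^ n) (p x)"
    using assms(2)
  proof (induction n)
    case 0
    then show ?case using assms(1) by (simp add: iterates_avoid_def)
  next
    case (Suc n)
    then have IH: "iterates_avoid f \<Gamma> n x" "(f ^^ n) x \<in> X" "p ((f ^^ n) x) = (q ^^ n) (p x)" by auto
    then have "(f ^^ n) x \<in> X - \<Gamma>" using Suc.prems[of n] sing_iff[of "(f ^^ n) x"] by auto
    then show ?case using IH pmap_in proj_pmap by (auto simp: iterates_avoid_def less_Suc_eq)
  qed
  then show "iterates_avoid f \<Gamma> n x" "(f ^^ n) x \<in> X" "p ((f ^^ n) x) = (q ^^ n) (p x)" by auto
qed

text \<open>Whether and when an orbit meets the singular leaf is decided by the orbit of its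
  projection under the quotient map.\<close>

lemma iterates_avoid_cong:
  assumes "x \<in> X" "x' \<in> X" "p x = p x'" "iterates_avoid f \<Gamma> n x"
  shows "iterates_avoid f \<Gamma> n x'" "i \<le> n \<Longrightarrow> p ((f ^^ i) x) = p ((f ^^ i) x')"
proof -
  have X: "(q ^^ i) (p x) \<noteq> 0" if "i < n" for i
    using that
  proof (induction i rule: less_induct)
    case (less i)
    have *: "(f ^^ i) x \<in> X" "p ((f ^^ i) x) = (q ^^ i) (p x)"
      using less by (intro iterates_projection assms(1); simp)+
    then show ?case using sing_iff assms(4) less.prems unfolding iterates_avoid_def by metis
  qed
  then show "iterates_avoid f \<Gamma> n x'" using assms by (intro iterates_projection(1)) auto
  show "p ((f ^^ i) x) = p ((f ^^ i) x')" if "i \<le> n"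
    using iterates_projection(3)[OF assms(1), of i] iterates_projection(3)[OF assms(2), of i] X that assms(3) by auto
qed

lemma unstable_curve_over:
  assumes "unstable_curve L J W" "s \<in> J"
  obtains w where "w \<in> W" "p w = s"
proof -
  obtain \<gamma> where "W = \<gamma> ` J" "\<And>s. s \<in> J \<Longrightarrow> p (\<gamma> s) = s"
    by (rule unstable_curveE[OF assms(1)]) (rule that)
  then show ?thesis using that assms(2) by blast
qed

lemma unstable_curve_eq:
  assumes "unstable_curve L J W" "unstable_curve L J W'" "v \<in> W" "v \<in> W'"
  shows "W \<subseteq> W'"
proof
  fix w assume w: "w \<in> W"
  obtain w' where "w' \<in> W'" "p w' = p w"
    using unstable_curve_over[OF assms(2) unstable_curve_point(3)[OF assms(1) w]] by blast
  then show "w \<in> W'" using unstable_curve_unique[OF assms w] by metis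
qed

text \<open>A candidate found on one curve is the bracket, because
  \<open>unstable_curve_unique\<close> excludes rivals on curves over any other interval. This
  applies both to the curves of a scheme and to pieces of their forward images.\<close>

lemma bracket_eq:
  assumes W: "unstable_curve L J W" "y \<in> W" "w \<in> W" and z: "z \<in> X" "p w = p z"
  shows "bracket_defined L y z" "bracket L y z = w"
proof -
  have w: "same_unstable L y w \<and> w \<in> ssleaf L z"
    using W z unstable_curve_point(1)[OF W(1,3)] mem_leaf_iff[OF z(1)] unfolding same_unstable_def by blast
  have u: "w' = w" if w': "same_unstable L y w' \<and> w' \<in> ssleaf L z" for w'
  proof -
    obtain J' W' where "unstable_curve L J' W'" "y \<in> W'" "w' \<in> W'" using w' unfolding same_unstable_def by blast
    moreover have "p w' = p w" using w' mem_leaf_iff[OF z(1)] z(2) by simp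
    ultimately show ?thesis using W by (intro unstable_curve_unique[of J' W' J W y])
  qed
  show "bracket_defined L y z" unfolding bracket_defined_def by (rule ex1I[of _ w]) (use w u in blast)+
  show "bracket L y z = w" unfolding bracket_def by (rule the_equality) (use w u in blast)+
qed

section \<open>Orbits and branches of an inducing scheme\<close>

lemma scheme_facts:
  assumes "inducing_scheme L S"
  shows "is_interval (base S)" "base S \<subseteq> {-1..1}" "\<And>s. s \<in> base S \<Longrightarrow> 0 < itime S s" "disjoint (part S)"
    "\<And>a. a \<in> part S \<Longrightarrow> open a \<and> is_interval a \<and> a \<noteq> {} \<and> a \<subseteq> base S \<and>
       C1_holder_diffeo e (induced_qmap L S) a \<and> induced_qmap L S ` a = base S"
    "\<exists>\<kappa>>1. \<forall>s\<in>\<Union>(part S). \<kappa> \<le> \<bar>deriv (induced_qmap L S) s\<bar>"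
    "\<exists>c\<^sub>0 \<theta>. 0 < \<theta> \<and> (\<forall>n s t. 1 \<le> n \<and> s \<in> base S \<and> t \<in> base S \<and> same_cylinder L S n s t \<longrightarrow>
       (\<forall>i < itime_sum L S n s. \<theta> powr (real (itime_sum L S n s - i) / 2) \<le> \<bar>(q ^^ i) s\<bar>) \<and>
       \<bar>deriv (induced_qmap L S ^^ n) s / deriv (induced_qmap L S ^^ n) t - 1\<bar>
         \<le> c\<^sub>0 * \<bar>(induced_qmap L S ^^ n) s - (induced_qmap L S ^^ n) t\<bar>)"
proof -
  note h = assms[unfolded inducing_scheme_def Let_def]
  show "is_interval (base S)" using h by (elim conjE)
  show "base S \<subseteq> {-1..1}" using h by (elim conjE)
  show "disjoint (part S)" using h by (elim conjE)
  show "0 < itime S s" if "s \<in> base S" for s using h that by (elim conjE) (drule (1) bspec)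
  have "\<forall>a\<in>part S. open a \<and> is_interval a \<and> a \<noteq> {} \<and> a \<subseteq> base S \<and> (\<exists>k. \<forall>s\<in>a. itime S s = k) \<and>
      C1_holder_diffeo e (induced_qmap L S) a \<and> induced_qmap L S ` a = base S"
    using h by (elim conjE) assumption
  then show "open a \<and> is_interval a \<and> a \<noteq> {} \<and> a \<subseteq> base S \<and>
       C1_holder_diffeo e (induced_qmap L S) a \<and> induced_qmap L S ` a = base S" if "a \<in> part S" for a
    using that by (auto dest!: bspec)
  show "\<exists>\<kappa>>1. \<forall>s\<in>\<Union>(part S). \<kappa> \<le> \<bar>deriv (induced_qmap L S) s\<bar>" using h by (elim conjE) assumption
  have "\<exists>c\<^sub>0 \<theta>. c\<^sub>0 > 0 \<and> 0 < \<theta> \<and> \<theta> < 1 \<and>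
         (\<forall>n s t. 1 \<le> n \<and> s \<in> base S \<and> t \<in> base S \<and> same_cylinder L S n s t \<longrightarrow>
            (\<forall>i < itime_sum L S n s.
               \<bar>(q ^^ i) t - (q ^^ i) s\<bar>
                 \<le> c\<^sub>0 * \<theta> ^ (itime_sum L S n s - i) * \<bar>(induced_qmap L S ^^ n) t - (induced_qmap L S ^^ n) s\<bar> \<and>
               \<bar>(q ^^ i) s\<bar> \<ge> \<theta> powr (real (itime_sum L S n s - i) / 2)) \<and>
            \<bar>deriv (induced_qmap L S ^^ n) s / deriv (induced_qmap L S ^^ n) t - 1\<bar> \<le> c\<^sub>0 * \<bar>(induced_qmap L S ^^ n) s - (induced_qmap L S ^^ n) t\<bar>)"
    using h by (elim conjE) assumption
  then obtain c\<^sub>0 \<theta> where "0 < \<theta>" and D: "\<forall>n s t. 1 \<le> n \<and> s \<in> base S \<and> t \<in> base S \<and> same_cylinder L S n s t \<longrightarrow>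
            (\<forall>i < itime_sum L S n s.
               \<bar>(q ^^ i) t - (q ^^ i) s\<bar>
                 \<le> c\<^sub>0 * \<theta> ^ (itime_sum L S n s - i) * \<bar>(induced_qmap L S ^^ n) t - (induced_qmap L S ^^ n) s\<bar> \<and>
               \<bar>(q ^^ i) s\<bar> \<ge> \<theta> powr (real (itime_sum L S n s - i) / 2)) \<and>
            \<bar>deriv (induced_qmap L S ^^ n) s / deriv (induced_qmap L S ^^ n) t - 1\<bar> \<le> c\<^sub>0 * \<bar>(induced_qmap L S ^^ n) s - (induced_qmap L S ^^ n) t\<bar>"
    by (elim exE conjE)
  show "\<exists>c\<^sub>0 \<theta>. 0 < \<theta> \<and> (\<forall>n s t. 1 \<le> n \<and> s \<in> base S \<and> t \<in> base S \<and> same_cylinder L S n s t \<longrightarrow>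
       (\<forall>i < itime_sum L S n s. \<theta> powr (real (itime_sum L S n s - i) / 2) \<le> \<bar>(q ^^ i) s\<bar>) \<and>
       \<bar>deriv (induced_qmap L S ^^ n) s / deriv (induced_qmap L S ^^ n) t - 1\<bar>
         \<le> c\<^sub>0 * \<bar>(induced_qmap L S ^^ n) s - (induced_qmap L S ^^ n) t\<bar>)"
  proof (rule exI[of _ c\<^sub>0], rule exI[of _ \<theta>], intro conjI allI impI)
    show "0 < \<theta>" by fact
    fix n s t assume st: "1 \<le> n \<and> s \<in> base S \<and> t \<in> base S \<and> same_cylinder L S n s t"
    note * = mp[OF spec[OF spec[OF spec[OF D]]] st]
    show "\<bar>deriv (induced_qmap L S ^^ n) s / deriv (induced_qmap L S ^^ n) t - 1\<bar>
         \<le> c\<^sub>0 * \<bar>(induced_qmap L S ^^ n) s - (induced_qmap L S ^^ n) t\<bar>" by (rule conjunct2[OF *])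
    fix i assume "i < itime_sum L S n s"
    then show "\<theta> powr (real (itime_sum L S n s - i) / 2) \<le> \<bar>(q ^^ i) s\<bar>" using conjunct1[OF *] by blast
  qed
qed

text \<open>The recurrence estimate of the scheme, for \<open>n = 1\<close> and
  \<open>t = s\<close>, bounds the iterates below by a power of \<open>\<theta>\<close>, which is
  positive.\<close>

lemma scheme_iterates_nonzero:
  assumes S: "inducing_scheme L S" and s: "s \<in> \<Union>(part S)" and i: "i < itime S s"
  shows "(q ^^ i) s \<noteq> 0"
proof -
  obtain a where a: "a \<in> part S" "s \<in> a" using s by blast
  then have "s \<in> base S" using scheme_facts(5)[OF S] by blast
  moreover have "same_cylinder L S 1 s s" by (rule same_cylinder_one[OF a a(2)])
  moreover have "itime_sum L S 1 s = itime S s" by (simp add: itime_sum_def)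
  moreover obtain \<theta> where \<theta>: "0 < \<theta>" "\<forall>n s. 1 \<le> n \<and> s \<in> base S \<and> same_cylinder L S n s s \<longrightarrow>
       (\<forall>i < itime_sum L S n s. \<theta> powr (real (itime_sum L S n s - i) / 2) \<le> \<bar>(q ^^ i) s\<bar>)"
    using scheme_facts(7)[OF S] by metis
  ultimately have "\<theta> powr (real (itime S s - i) / 2) \<le> \<bar>(q ^^ i) s\<bar>" using i by (metis order_refl)
  moreover have "0 < \<theta> powr (real (itime S s - i) / 2)" using \<theta>(1) by simp
  ultimately show ?thesis by auto
qed

lemma induced_map_projection:
  assumes S: "inducing_scheme L S" and x: "x \<in> X" "p x \<in> \<Union>(part S)"
  shows "iterates_avoid f \<Gamma> (itime S (p x)) x" "induced_map L S x \<in> X"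
    "p (induced_map L S x) = induced_qmap L S (p x)"
  using iterates_projection[OF x(1) scheme_iterates_nonzero[OF S x(2)]]
  unfolding induced_map_def induced_qmap_def by auto

text \<open>Membership follows from the quotient orbit alone; this is how points of two different
  unstable curves enter the subsystem together.\<close>

lemma finite_subsystem_mem:
  assumes S: "inducing_scheme L S" and a: "a\<^sub>1 \<in> part S" "a\<^sub>2 \<in> part S" and x: "x \<in> X" "p x \<in> base S"
    and o: "\<And>n. (induced_qmap L S ^^ n) (p x) \<in> a\<^sub>1 \<union> a\<^sub>2"
  shows "x \<in> finite_subsystem L S (saturate L a\<^sub>1) (saturate L a\<^sub>2)"
proof -
  have base: "a\<^sub>1 \<subseteq> {-1..1}" "a\<^sub>2 \<subseteq> {-1..1}" "base S \<subseteq> {-1..1}"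
    using scheme_facts(2,5)[OF S] a by (meson order_trans)+
  have "(induced_map L S ^^ n) x \<in> X \<and> p ((induced_map L S ^^ n) x) = (induced_qmap L S ^^ n) (p x)" for n
  proof (induction n)
    case (Suc n)
    then have "p ((induced_map L S ^^ n) x) \<in> \<Union>(part S)" using o[of n] a by auto
    then show ?case using induced_map_projection(2,3)[OF S] Suc by simp
  qed (use x in simp)
  then have "(induced_map L S ^^ n) x \<in> saturate L a\<^sub>1 \<union> saturate L a\<^sub>2" for n
    using o[of n] saturate_iff base by (metis Un_iff)
  moreover have "x \<in> saturate L (base S)" using x saturate_iff base(3) by blast
  ultimately show ?thesis unfolding finite_subsystem_def by blast
qed

text \<open>A period of the induced map is turned into a period \<open>N\<close> of the Poincare map
  along an orbit that misses the singular leaf. There \<open>b\<close> inverts the map, so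
  \<open>z\<close> has period \<open>N\<close> under \<open>b\<close>, too.\<close>

lemma periodic_backward_finite:
  assumes S: "inducing_scheme L S" and z: "periodic_point L S z" "z \<in> X"
  shows "finite (range (\<lambda>n. (b ^^ n) z))"
proof -
  obtain n where n: "n \<ge> 1" "(induced_map L S ^^ n) z = z" "\<And>j. j < n \<Longrightarrow> (induced_map L S ^^ j) z \<in> \<Union>(part_leaves L S)"
    using z(1) unfolding periodic_point_def by blast
  \<comment> \<open>\<open>N \<ge> m\<close> holds since inducing times are positive. For
    \<open>m = n\<close> it yields \<open>N \<ge> 1\<close>, as is needed for reducing exponents
    modulo \<open>N\<close>.\<close>
  have "\<exists>N\<ge>m. (f ^^ N) z = (induced_map L S ^^ m) z \<and> iterates_avoid f \<Gamma> N z" if "m \<le> n" for m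
    using that
  proof (induction m)
    case 0
    show ?case by (rule exI[of _ 0]) (simp add: iterates_avoid_def)
  next
    case (Suc m)
    then obtain N where N: "N \<ge> m" "(f ^^ N) z = (induced_map L S ^^ m) z" "iterates_avoid f \<Gamma> N z" by auto
    define x where "x = (f ^^ N) z"
    define k where "k = itime S (p x)"
    have "x \<in> \<Union>(part_leaves L S)" using n(3)[of m] Suc.prems N(2) by (simp add: x_def)
    then obtain a where a: "a \<in> part S" "x \<in> saturate L a" unfolding part_leaves_def by blast
    have ab: "a \<subseteq> base S" using scheme_facts(5)[OF S a(1)] by blast
    then have "a \<subseteq> {-1..1}" using scheme_facts(2)[OF S] by blast
    then have x: "x \<in> X" "p x \<in> a" using a(2) saturate_iff by blast+
    have "0 < k" unfolding k_def using x(2) ab by (intro scheme_facts(3)[OF S]) auto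
    have av: "iterates_avoid f \<Gamma> k x"
      unfolding k_def using x a(1) by (intro induced_map_projection(1)[OF S]) auto
    have "(f ^^ (k + N)) z = (induced_map L S ^^ Suc m) z"
      using N(2) by (simp add: funpow_add x_def k_def induced_map_def)
    moreover have "iterates_avoid f \<Gamma> (k + N) z"
      unfolding iterates_avoid_def
    proof (intro allI impI)
      fix i assume i: "i < k + N"
      show "(f ^^ i) z \<notin> \<Gamma>"
      proof (cases "i < N")
        case True then show ?thesis using N(3) unfolding iterates_avoid_def by blast
      next
        case False
        then have "(f ^^ i) z = (f ^^ (i - N)) x" using funpow_add[of "i - N" N f] by (simp add: x_def)
        moreover have "i - N < k" using False i by linarith
        ultimately show ?thesis using av unfolding iterates_avoid_def by simp
      qed
    qed
    ultimately show ?case using N(1) \<open>0 < k\<close> by (intro exI[of _ "k + N"]) auto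
  qed
  then obtain N where N: "N \<ge> n" "(f ^^ N) z = z" "iterates_avoid f \<Gamma> N z" using n(2) by (metis order_refl)
  then have bN: "(b ^^ N) z = z" using backward_forward(2)[OF z(2) N(3) order_refl] by simp
  have "(b ^^ m) z \<in> (\<lambda>i. (b ^^ i) z) ` {..<N}" for m
    using funpow_mod_eq[OF bN, of m] N(1) n(1) by (intro image_eqI[of _ _ "m mod N"]) auto
  then have "range (\<lambda>n. (b ^^ n) z) \<subseteq> (\<lambda>i. (b ^^ i) z) ` {..<N}" by blast
  then show ?thesis using finite_subset by blast
qed

text \<open>The lower bound is uniform expansion. For the upper bound
  \<open>C1_holder_diffeo\<close> does not suffice, as it controls the derivative on compact parts
  of the open interval only; the distortion estimate compares all derivatives with the one at
  \<open>s0\<close>.\<close>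

lemma scheme_branch_bounds:
  assumes S: "inducing_scheme L S"
  obtains \<kappa> where "1 < \<kappa>" "\<And>a. a \<in> part S \<Longrightarrow> \<exists>M. \<forall>s\<in>a. \<forall>t\<in>a. \<kappa> * \<bar>s - t\<bar> \<le> \<bar>induced_qmap L S s - induced_qmap L S t\<bar> \<and>
      \<bar>induced_qmap L S s - induced_qmap L S t\<bar> \<le> M * \<bar>s - t\<bar>"
proof -
  let ?F = "induced_qmap L S"
  obtain \<kappa> where \<kappa>: "1 < \<kappa>" "\<forall>s\<in>\<Union>(part S). \<kappa> \<le> \<bar>deriv ?F s\<bar>" using scheme_facts(6)[OF S] by blast
  obtain c where c: "\<forall>n s t. 1 \<le> n \<and> s \<in> base S \<and> t \<in> base S \<and> same_cylinder L S n s t \<longrightarrow>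
       \<bar>deriv (?F ^^ n) s / deriv (?F ^^ n) t - 1\<bar> \<le> c * \<bar>(?F ^^ n) s - (?F ^^ n) t\<bar>"
    using scheme_facts(7)[OF S] by metis
  have "\<exists>M. \<forall>s\<in>a. \<forall>t\<in>a. \<kappa> * \<bar>s - t\<bar> \<le> \<bar>?F s - ?F t\<bar> \<and> \<bar>?F s - ?F t\<bar> \<le> M * \<bar>s - t\<bar>" if a: "a \<in> part S" for a
  proof -
    have A: "open a" "is_interval a" "a \<noteq> {}" "a \<subseteq> base S" "C1_holder_diffeo e ?F a" "?F ` a = base S"
      using scheme_facts(5)[OF S a] by blast+
    obtain s0 where s0: "s0 \<in> a" using A(3) by blast
    \<comment> \<open>The 2 is the length of \<open>{-1..1}\<close>, which contains the values of
      the induced map.\<close>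
    define M where "M = (1 + \<bar>c\<bar> * 2) * \<bar>deriv ?F s0\<bar>"
    have der: "(?F has_real_derivative deriv ?F z) (at z)" if "z \<in> a" for z
    proof -
      have "?F differentiable (at z)"
        using A(5) that C1_holder_differentiable unfolding C1_holder_diffeo_def by blast
      then have "?F field_differentiable (at z)"
        by (simp add: field_differentiable_def real_differentiable_def)
      then show ?thesis by (simp add: field_differentiable_derivI)
    qed
    have up: "\<bar>deriv ?F z\<bar> \<le> M" if z: "z \<in> a" for z
    proof -
      have "\<bar>deriv ?F z / deriv ?F s0 - 1\<bar> \<le> c * \<bar>?F z - ?F s0\<bar>"
        using c[rule_format, of 1 z s0] same_cylinder_one[OF a z s0] z s0 A(4) by auto
      also have "\<dots> \<le> \<bar>c\<bar> * 2"
      proof -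
        have "?F z \<in> {-1..1}" "?F s0 \<in> {-1..1}" using A(6) z s0 scheme_facts(2)[OF S] by blast+
        then have "\<bar>?F z - ?F s0\<bar> \<le> 2" by auto
        then show ?thesis by (intro mult_mono) auto
      qed
      finally have "\<bar>deriv ?F z / deriv ?F s0\<bar> \<le> 1 + \<bar>c\<bar> * 2" by linarith
      moreover have "deriv ?F s0 \<noteq> 0" using \<kappa> s0 a by force
      ultimately show ?thesis by (simp add: M_def abs_divide pos_divide_le_eq)
    qed
    have lt: "\<kappa> * \<bar>s - t\<bar> \<le> \<bar>?F s - ?F t\<bar> \<and> \<bar>?F s - ?F t\<bar> \<le> M * \<bar>s - t\<bar>" if st: "s \<in> a" "t \<in> a" "s < t" for s t
    proof -
      have "\<exists>z>s. z < t \<and> ?F t - ?F s = (t - s) * deriv ?F z"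
        using st by (intro MVT2 der) (auto intro: mem_is_interval_1_I[OF A(2) st(1,2)])
      then obtain z where z: "s < z" "z < t" "?F t - ?F s = (t - s) * deriv ?F z" by blast
      have za: "z \<in> a" using z by (intro mem_is_interval_1_I[OF A(2) st(1,2)]) auto
      have eq: "\<bar>?F s - ?F t\<bar> = \<bar>deriv ?F z\<bar> * \<bar>s - t\<bar>"
        unfolding abs_minus_commute[of "?F s"] z(3) using st(3) by (simp add: abs_mult)
      show ?thesis unfolding eq using up[OF za] \<kappa>(2) za a by (intro conjI mult_right_mono) auto
    qed
    have "\<kappa> * \<bar>s - t\<bar> \<le> \<bar>?F s - ?F t\<bar> \<and> \<bar>?F s - ?F t\<bar> \<le> M * \<bar>s - t\<bar>" if "s \<in> a" "t \<in> a" for s t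
      using lt[OF that] lt[OF that(2,1)] by (cases s t rule: linorder_cases) (auto simp: abs_minus_commute)
    then show ?thesis by blast
  qed
  then show ?thesis by (rule that[OF \<kappa>(1)])
qed

section \<open>Dimension of the distortion values\<close>

text \<open>For \<open>v\<close> on the unstable curve of \<open>f\<^sup>l y\<close> and \<open>w\<^sub>0\<close> the point of the unstable curve of
  \<open>f\<^sup>l y'\<close> on the stable leaf of \<open>v\<^sub>0\<close>, the sums telescope to \<open>D(v, w\<^sub>0) = g(v) - g(v\<^sub>0)\<close>.  Since the
  finite subsystem is a union of stable leaves, it contains \<open>v\<close> and \<open>w\<^sub>0\<close> as soon as it contains the
  leaves of \<open>v\<close> and \<open>v\<^sub>0\<close>.\<close>

lemma distortion_difference:
  assumes per: "finite (range (\<lambda>n. (b ^^ n) z))" "finite (range (\<lambda>n. (b ^^ n) z'))"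
    and W: "unstable_curve L J W" "z \<in> W" and W': "unstable_curve L J W'" "z' \<in> W'"
    and y': "y' \<in> W'" "iterates_avoid f \<Gamma> l y'"
    and W1: "unstable_curve L J\<^sub>1 W\<^sub>1" "W\<^sub>1 \<subseteq> (f ^^ l) ` {x \<in> W. iterates_avoid f \<Gamma> l x}"
    and W2: "unstable_curve L J\<^sub>2 W\<^sub>2" "W\<^sub>2 \<subseteq> (f ^^ l) ` {x \<in> W'. iterates_avoid f \<Gamma> l x}"
    and a0: "a\<^sub>0 \<in> W" "iterates_avoid f \<Gamma> l a\<^sub>0" "(f ^^ l) a\<^sub>0 \<in> W\<^sub>1"
    and b0: "b\<^sub>0 \<in> W'" "iterates_avoid f \<Gamma> l b\<^sub>0" "(f ^^ l) b\<^sub>0 \<in> W\<^sub>2" "p b\<^sub>0 = p a\<^sub>0"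
    and v: "v \<in> W\<^sub>1" and w: "w \<in> W\<^sub>2" "p w = p v"
  shows "distortion_defined L v ((f ^^ l) b\<^sub>0)"
    "distortion L v ((f ^^ l) b\<^sub>0) = distortion_along L l y' v - distortion_along L l y' ((f ^^ l) a\<^sub>0)"
proof -
  let ?v0 = "(f ^^ l) a\<^sub>0" and ?w0 = "(f ^^ l) b\<^sub>0" and ?Y = "(f ^^ l) y'"
  note pt = unstable_curve_point(1)[OF W(1)] and pt' = unstable_curve_point(1)[OF W'(1)]
  \<comment> \<open>Both curves lie over the same interval, so \<open>W\<close> meets the leaf of
    \<open>y'\<close>. The point \<open>c\<^sub>0\<close> is the bracket of \<open>a\<close> and
    \<open>y'\<close> for every \<open>a\<close> in \<open>W\<close>, and hence cancels in
    differences.\<close>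
  obtain c\<^sub>0 where c0: "c\<^sub>0 \<in> W" "p c\<^sub>0 = p y'"
    using unstable_curve_over[OF W(1) unstable_curve_point(3)[OF W'(1) y'(1)]] by blast
  have c0l: "iterates_avoid f \<Gamma> l c\<^sub>0"
    by (rule iterates_avoid_cong(1)[OF pt'[OF y'(1)] pt[OF c0(1)] c0(2)[symmetric] y'(2)])
  let ?c = "(f ^^ l) c\<^sub>0"
  have ret_iter: "(b ^^ i) ((f ^^ l) x) = (f ^^ (l - i)) x" if "x \<in> X" "iterates_avoid f \<Gamma> l x" "i \<le> l" for x i
    by (rule backward_forward(2)[OF that])
  have pi: "p ((b ^^ i) ?v0) = p ((b ^^ i) ?w0)" if "i \<le> l" for i
    unfolding ret_iter[OF pt[OF a0(1)] a0(2) that] ret_iter[OF pt'[OF b0(1)] b0(2) that]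
    by (rule iterates_avoid_cong(2)[OF pt[OF a0(1)] pt'[OF b0(1)] b0(4)[symmetric] a0(2)]) simp
  have p0: "p ?v0 = p ?w0" using pi[of 0] by simp
  have g: "distortion_along L l y' ((f ^^ l) a) = D0 L ((f ^^ l) a) ?c + D0 L ?Y ((f ^^ l) b')"
    if a: "a \<in> W" "iterates_avoid f \<Gamma> l a" and b': "b' \<in> W'" "p b' = p a" for a b'
  proof -
    have "(b ^^ l) ((f ^^ l) a) = a" using ret_iter[OF pt[OF a(1)] a(2) order_refl] by simp
    moreover have "bracket L a y' = c\<^sub>0" by (rule bracket_eq(2)[OF W(1) a(1) c0(1) pt'[OF y'(1)] c0(2)])
    moreover have "bracket L y' a = b'" by (rule bracket_eq(2)[OF W'(1) y'(1) b'(1) pt[OF a(1)] b'(2)])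
    ultimately show ?thesis unfolding distortion_along_def shifted_distortion_def by simp
  qed
  obtain a where a: "a \<in> W" "iterates_avoid f \<Gamma> l a" "v = (f ^^ l) a" using v W1(2) by blast
  obtain b' where b': "b' \<in> W'" "iterates_avoid f \<Gamma> l b'" "w = (f ^^ l) b'" using w W2(2) by blast
  \<comment> \<open>\<open>distortion_along\<close> pulls its argument back \<open>l\<close> times,
    so the leaf shared by \<open>v\<close> and \<open>w\<close> has to be traced back, too. The
    quotient map is known to be injective only on each side of 0; the right side at each step is
    read off from the reference pair over \<open>x\<^sub>0\<close>, given by
    \<open>a\<^sub>0\<close> and \<open>b\<^sub>0\<close>.\<close>
  have "p ((b ^^ l) v) = p ((b ^^ l) w)"
    by (rule backward_projections_agree[OF W1(1) W2(1) a0(3) b0(3) pi v w(1) w(2)[symmetric]])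
  then have pab: "p b' = p a"
    using ret_iter[OF pt[OF a(1)] a(2) order_refl] ret_iter[OF pt'[OF b'(1)] b'(2) order_refl] unfolding a(3) b'(3) by simp
  have sW: "summable (\<lambda>j. D0_term L ((f ^^ l) x) ((f ^^ l) x') (Suc j))"
    if "x \<in> W" "iterates_avoid f \<Gamma> l x" "x' \<in> W" "iterates_avoid f \<Gamma> l x'" for x x'
    by (rule D0_term_summable[OF W per(1) that])
  have sW': "summable (\<lambda>j. D0_term L ((f ^^ l) x) ((f ^^ l) x') (Suc j))"
    if "x \<in> W'" "iterates_avoid f \<Gamma> l x" "x' \<in> W'" "iterates_avoid f \<Gamma> l x'" for x x'
    by (rule D0_term_summable[OF W' per(2) that])
  have br1: "bracket_defined L v ?w0" "bracket L v ?w0 = ?v0"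
    using bracket_eq[OF W1(1) v a0(3) unstable_curve_point(1)[OF W2(1) b0(3)] p0] .
  have br2: "bracket_defined L ?w0 v" "bracket L ?w0 v = w"
    using bracket_eq[OF W2(1) b0(3) w(1) unstable_curve_point(1)[OF W1(1) v] w(2)] .
  show "distortion_defined L v ?w0"
    unfolding distortion_defined_def br1(2) br2(2)
    using br1(1) br2(1) sW[OF a(1,2) a0(1,2)] sW'[OF b0(1,2) b'(1,2)] unfolding a(3) b'(3) by blast
  \<comment> \<open>Summability allows termwise subtraction, and the return times along the backward
    orbit of the common point cancel.\<close>
  have "D0 L v ?c - D0 L ?v0 ?c = D0 L v ?v0"
    unfolding D0_def a(3) suminf_diff[OF sW[OF a(1,2) c0(1) c0l] sW[OF a0(1,2) c0(1) c0l]]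
    by (simp add: D0_term_def)
  moreover have "D0 L ?Y w - D0 L ?Y ?w0 = D0 L ?w0 w"
    unfolding D0_def b'(3) suminf_diff[OF sW'[OF y' b'(1,2)] sW'[OF y' b0(1,2)]]
    by (simp add: D0_term_def)
  moreover have "distortion_along L l y' v = D0 L v ?c + D0 L ?Y w"
    unfolding a(3) b'(3) by (rule g[OF a(1,2) b'(1) pab])
  moreover have "distortion_along L l y' ?v0 = D0 L ?v0 ?c + D0 L ?Y ?w0"
    by (rule g[OF a0(1,2) b0(1,4)])
  ultimately show "distortion L v ?w0 = distortion_along L l y' v - distortion_along L l y' ?v0"
    unfolding distortion_def br1(2) br2(2) by linarith
qed

lemma subsystem_cantor_set:
  assumes S: "inducing_scheme L S" and a: "a\<^sub>1 \<in> part S" "a\<^sub>2 \<in> part S" "a\<^sub>1 \<noteq> a\<^sub>2"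
  defines "K \<equiv> {s \<in> base S. \<forall>n. (induced_qmap L S ^^ n) s \<in> a\<^sub>1 \<union> a\<^sub>2}"
  shows "\<exists>x\<^sub>0\<in>K. \<forall>\<delta>>0. \<exists>c \<mu>. 0 < c \<and> 0 < \<mu> \<and> \<mu> < 1 \<and>
    (\<forall>n::nat. \<exists>P. finite P \<and> P \<subseteq> K \<inter> ball x\<^sub>0 \<delta> \<and> card P = 2 ^ n \<and>
      (\<forall>x\<in>P. \<forall>y\<in>P. x \<noteq> y \<longrightarrow> c * \<mu> ^ n \<le> \<bar>x - y\<bar>))"
proof -
  let ?F = "induced_qmap L S"
  obtain \<kappa> where \<kappa>: "1 < \<kappa>" "\<And>a. a \<in> part S \<Longrightarrow> \<exists>M. \<forall>s\<in>a. \<forall>t\<in>a. \<kappa> * \<bar>s - t\<bar> \<le> \<bar>?F s - ?F t\<bar> \<and>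
      \<bar>?F s - ?F t\<bar> \<le> M * \<bar>s - t\<bar>"
    by (rule scheme_branch_bounds[OF S]) (rule that)
  obtain M1 where M1: "\<forall>s\<in>a\<^sub>1. \<forall>t\<in>a\<^sub>1. \<kappa> * \<bar>s - t\<bar> \<le> \<bar>?F s - ?F t\<bar> \<and> \<bar>?F s - ?F t\<bar> \<le> M1 * \<bar>s - t\<bar>"
    using \<kappa>(2)[OF a(1)] by blast
  obtain M2 where M2: "\<forall>s\<in>a\<^sub>2. \<forall>t\<in>a\<^sub>2. \<kappa> * \<bar>s - t\<bar> \<le> \<bar>?F s - ?F t\<bar> \<and> \<bar>?F s - ?F t\<bar> \<le> M2 * \<bar>s - t\<bar>"
    using \<kappa>(2)[OF a(2)] by blast
  have mx: "M1 * \<bar>s - t\<bar> \<le> max M1 M2 * \<bar>s - t\<bar>" "M2 * \<bar>s - t\<bar> \<le> max M1 M2 * \<bar>s - t\<bar>" for s t :: real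
    by (intro mult_right_mono; simp)+
  have dj: "a\<^sub>1 \<inter> a\<^sub>2 = {}" using scheme_facts(4)[OF S] a by (rule disjointD)
  have bd: "bounded (base S)" by (rule bounded_subset[OF bounded_closed_interval scheme_facts(2)[OF S]])
  have f1: "open a\<^sub>1" "is_interval a\<^sub>1" "a\<^sub>1 \<noteq> {}" "a\<^sub>1 \<subseteq> base S" "?F ` a\<^sub>1 = base S"
    using scheme_facts(5)[OF S a(1)] by blast+
  have f2: "open a\<^sub>2" "is_interval a\<^sub>2" "a\<^sub>2 \<noteq> {}" "a\<^sub>2 \<subseteq> base S" "?F ` a\<^sub>2 = base S"
    using scheme_facts(5)[OF S a(2)] by blast+
  show ?thesis
    unfolding K_def
  proof (rule two_full_branches_separated[OF scheme_facts(1)[OF S] bd f1 f2 dj \<kappa>(1)])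
    fix s t
    show "\<kappa> * \<bar>s - t\<bar> \<le> \<bar>?F s - ?F t\<bar> \<and> \<bar>?F s - ?F t\<bar> \<le> max M1 M2 * \<bar>s - t\<bar>" if "s \<in> a\<^sub>1" "t \<in> a\<^sub>1"
      using M1[rule_format, OF that] mx(1)[of s t] by linarith
    show "\<kappa> * \<bar>s - t\<bar> \<le> \<bar>?F s - ?F t\<bar> \<and> \<bar>?F s - ?F t\<bar> \<le> max M1 M2 * \<bar>s - t\<bar>" if "s \<in> a\<^sub>2" "t \<in> a\<^sub>2"
      using M2[rule_format, OF that] mx(2)[of s t] by linarith
  qed
qed

lemma distortion_values_dim_pos:
  assumes S: "inducing_scheme L S"
    and z: "periodic_point L S z" "y \<in> unstable_manifold L (base S) z"
    and z': "periodic_point L S z'" "y' \<in> unstable_manifold L (base S) z'" "iterates_avoid f \<Gamma> l y'"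
    and V: "openin (top_of_set (shifted_manifold L (base S) l y)) V" "C1_diffeo_onto_image (distortion_along L l y') V"
    and S': "inducing_scheme L S'" "saturate L (base S') \<subseteq> (\<Union>v\<in>V. ssleaf L v)"
    and a: "a\<^sub>1 \<in> part_leaves L S'" "a\<^sub>2 \<in> part_leaves L S'" "a\<^sub>1 \<noteq> a\<^sub>2"
  shows "lower_box_dim (distortion_values L (finite_subsystem L S' a\<^sub>1 a\<^sub>2)) > 0"
proof -
  define h where "h = distortion_along L l y'"
  obtain b\<^sub>1 b\<^sub>2 where b: "b\<^sub>1 \<in> part S'" "a\<^sub>1 = saturate L b\<^sub>1" "b\<^sub>2 \<in> part S'" "a\<^sub>2 = saturate L b\<^sub>2"
    using a unfolding part_leaves_def by blast
  have "b\<^sub>1 \<noteq> b\<^sub>2" using a(3) b(2,4) by blast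
  define K where "K = {s \<in> base S'. \<forall>n. (induced_qmap L S' ^^ n) s \<in> b\<^sub>1 \<union> b\<^sub>2}"
  obtain x\<^sub>0 where x0: "x\<^sub>0 \<in> K" and sep: "\<forall>\<delta>>0. \<exists>c \<mu>. 0 < c \<and> 0 < \<mu> \<and> \<mu> < 1 \<and>
    (\<forall>n::nat. \<exists>P. finite P \<and> P \<subseteq> K \<inter> ball x\<^sub>0 \<delta> \<and> card P = 2 ^ n \<and>
      (\<forall>x\<in>P. \<forall>y\<in>P. x \<noteq> y \<longrightarrow> c * \<mu> ^ n \<le> \<bar>x - y\<bar>))"
    using subsystem_cantor_set[OF S'(1) b(1,3) \<open>b\<^sub>1 \<noteq> b\<^sub>2\<close>] unfolding K_def by blast
  have mem: "x \<in> finite_subsystem L S' a\<^sub>1 a\<^sub>2" if "x \<in> X" "p x \<in> K" for x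
    unfolding b(2,4) by (rule finite_subsystem_mem[OF S'(1) b(1,3) that(1)]) (use that(2) in \<open>auto simp: K_def\<close>)
  have base: "base S' \<subseteq> {-1..1}" by (rule scheme_facts(2)[OF S'(1)])
  have x0I: "x\<^sub>0 \<in> {-1..1}" "x\<^sub>0 \<in> base S'" using x0 base by (auto simp: K_def)
  obtain W where W: "unstable_curve L (base S) W" "z \<in> W" "y \<in> W"
    using z(2) unfolding unstable_manifold_def by blast
  obtain W' where W': "unstable_curve L (base S) W'" "z' \<in> W'" "y' \<in> W'"
    using z'(2) unfolding unstable_manifold_def by blast
  have man: "unstable_manifold L (base S) y = W"
    unfolding unstable_manifold_def using W unstable_curve_eq[OF _ W(1) _ W(3)] by blast
  have per: "finite (range (\<lambda>n. (b ^^ n) z))" "finite (range (\<lambda>n. (b ^^ n) z'))"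
    using periodic_backward_finite[OF S z(1) unstable_curve_point(1)[OF W(1,2)]]
      periodic_backward_finite[OF S z'(1) unstable_curve_point(1)[OF W'(1,2)]] .
  have "\<sigma> x\<^sub>0 \<in> saturate L (base S')"
    using transversal_leaf(1)[OF x0I(1)] x0I(2) unfolding saturate_def by blast
  then obtain v\<^sub>0 where v0: "v\<^sub>0 \<in> V" "\<sigma> x\<^sub>0 \<in> ssleaf L v\<^sub>0" using S'(2) by blast
  have Vs: "V \<subseteq> shifted_manifold L (base S) l y" using V(1) by (rule openin_imp_subset)
  then obtain a\<^sub>0 where a0: "a\<^sub>0 \<in> W" "iterates_avoid f \<Gamma> l a\<^sub>0" "v\<^sub>0 = (f ^^ l) a\<^sub>0"
    using v0(1) unfolding shifted_manifold_def man by blast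
  have v0X: "v\<^sub>0 \<in> X" unfolding a0(3)
    by (rule backward_forward(1)[OF unstable_curve_point(1)[OF W(1) a0(1)] a0(2) order_refl])
  have pv0: "p v\<^sub>0 = x\<^sub>0" using v0(2) mem_leaf_iff[OF v0X] transversal_in(2)[OF x0I(1)] by simp
  \<comment> \<open>Since \<open>W\<close> and \<open>W'\<close> both lie over
    \<open>base S\<close>, the curve \<open>W'\<close> crosses the leaf of \<open>a\<^sub>0\<close>;
    the iterate of this crossing point is \<open>w\<^sub>0\<close>.\<close>
  obtain b\<^sub>0 where b0: "b\<^sub>0 \<in> W'" "p b\<^sub>0 = p a\<^sub>0"
    using unstable_curve_over[OF W'(1) unstable_curve_point(3)[OF W(1) a0(1)]] by blast
  note cong = iterates_avoid_cong[OF unstable_curve_point(1)[OF W(1) a0(1)] unstable_curve_point(1)[OF W'(1) b0(1)] b0(2)[symmetric] a0(2)]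
  obtain J\<^sub>1 W\<^sub>1 where W1: "unstable_curve L J\<^sub>1 W\<^sub>1" "(f ^^ l) a\<^sub>0 \<in> W\<^sub>1" "W\<^sub>1 \<subseteq> (f ^^ l) ` {x \<in> W. iterates_avoid f \<Gamma> l x}"
    by (rule unstable_curve_pmap_iterate[OF W(1) a0(1,2)]) (rule that)
  obtain J\<^sub>2 W\<^sub>2 where W2: "unstable_curve L J\<^sub>2 W\<^sub>2" "(f ^^ l) b\<^sub>0 \<in> W\<^sub>2" "W\<^sub>2 \<subseteq> (f ^^ l) ` {x \<in> W'. iterates_avoid f \<Gamma> l x}"
    by (rule unstable_curve_pmap_iterate[OF W'(1) b0(1) cong(1)]) (rule that)
  have pw0: "p ((f ^^ l) b\<^sub>0) = x\<^sub>0" using cong(2)[OF order_refl] pv0 a0(3) by simp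
  have w0X: "(f ^^ l) b\<^sub>0 \<in> X" by (rule unstable_curve_point(1)[OF W2(1,2)])
  obtain \<gamma> where \<gamma>: "W\<^sub>1 = \<gamma> ` J\<^sub>1" "\<And>s. s \<in> J\<^sub>1 \<Longrightarrow> \<gamma> s \<in> X" "\<And>s. s \<in> J\<^sub>1 \<Longrightarrow> p (\<gamma> s) = s"
    "\<And>n. continuous_on J\<^sub>1 (\<lambda>s. (b ^^ n) (\<gamma> s))"
    by (rule unstable_curveE[OF W1(1)]) (rule that)
  have x0J: "x\<^sub>0 \<in> J\<^sub>1" "x\<^sub>0 \<in> J\<^sub>2"
    using unstable_curve_point(3)[OF W1(1,2)] unstable_curve_point(3)[OF W2(1,2)] pv0 a0(3) pw0 by auto
  have \<gamma>x0: "\<gamma> x\<^sub>0 = v\<^sub>0"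
  proof -
    obtain s where s: "s \<in> J\<^sub>1" "v\<^sub>0 = \<gamma> s" using W1(2) \<gamma>(1) a0(3) by blast
    then have "s = x\<^sub>0" using pv0 \<gamma>(3) by metis
    then show ?thesis using s(2) by simp
  qed
  obtain M \<delta> where M: "0 \<le> M" "0 < \<delta>" "\<And>v v'. v \<in> V \<Longrightarrow> v' \<in> V \<Longrightarrow> dist v v\<^sub>0 < \<delta> \<Longrightarrow> dist v' v\<^sub>0 < \<delta> \<Longrightarrow> dist v v' \<le> M * dist (h v) (h v')"
    by (rule C1_diffeo_expands_locally[OF V(2)[folded h_def] v0(1)]) (rule that)
  obtain r M1 where rM1: "0 < r" "0 \<le> M1" "\<And>z z'. z \<in> X \<Longrightarrow> z' \<in> X \<Longrightarrow> z \<in> ball v\<^sub>0 r \<Longrightarrow> z' \<in> ball v\<^sub>0 r \<Longrightarrow> \<bar>p z - p z'\<bar> \<le> M1 * dist z z'"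
    by (rule proj_lipschitz[OF v0X]) (rule that)
  obtain U where U: "open U" "V = shifted_manifold L (base S) l y \<inter> U" using V(1) unfolding openin_open by blast
  obtain r2 where r2: "0 < r2" "ball v\<^sub>0 r2 \<subseteq> U" using U v0(1) by (meson IntD2 openE)
  have "continuous_on J\<^sub>1 \<gamma>" using \<gamma>(4)[of 0] by simp
  then have "isCont \<gamma> x\<^sub>0" using x0J(1) unstable_curveD(1)[OF W1(1)] continuous_on_eq_continuous_at by blast
  moreover have "min \<delta> (min r r2) > 0" using M(2) rM1(1) r2(1) by simp
  ultimately obtain d where d: "d > 0" "\<And>t. dist t x\<^sub>0 < d \<Longrightarrow> dist (\<gamma> t) v\<^sub>0 < min \<delta> (min r r2)"
    unfolding continuous_at_eps_delta \<gamma>x0 by blast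
  have "open (J\<^sub>1 \<inter> J\<^sub>2)" using unstable_curveD(1) W1(1) W2(1) by blast
  then obtain d' where d': "d' > 0" "ball x\<^sub>0 d' \<subseteq> J\<^sub>1 \<inter> J\<^sub>2" using x0J by (meson IntI openE)
  \<comment> \<open>Over the ball of this radius both pieces \<open>W\<^sub>1\<close> and
    \<open>W\<^sub>2\<close> are present, and the points of \<open>W\<^sub>1\<close> are close
    enough to \<open>v\<^sub>0\<close> to lie in the relatively open \<open>V\<close> and to satisfy
    both Lipschitz estimates.\<close>
  define \<epsilon> where "\<epsilon> = min d d'"
  have \<epsilon>: "\<epsilon> > 0" using d(1) d'(1) by (simp add: \<epsilon>_def)
  have tJ: "t \<in> J\<^sub>1" "t \<in> J\<^sub>2" "dist (\<gamma> t) v\<^sub>0 < \<delta>" "dist (\<gamma> t) v\<^sub>0 < r" "\<gamma> t \<in> V" if t: "t \<in> ball x\<^sub>0 \<epsilon>" for t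
  proof -
    show J: "t \<in> J\<^sub>1" "t \<in> J\<^sub>2" using t d'(2) by (auto simp: \<epsilon>_def)
    have "dist (\<gamma> t) v\<^sub>0 < min \<delta> (min r r2)" using t by (intro d(2)) (simp add: \<epsilon>_def dist_commute)
    then show "dist (\<gamma> t) v\<^sub>0 < \<delta>" "dist (\<gamma> t) v\<^sub>0 < r" and "\<gamma> t \<in> V"
      using J(1) W1(3) \<gamma>(1) r2(2) unfolding U(2) shifted_manifold_def man by (auto simp: dist_commute)
  qed
  \<comment> \<open>\<open>M1\<close> bounds the projection and \<open>M\<close> the local inverse
    of \<open>h\<close>; the summand 1 makes \<open>m\<close> positive, so that one can divide by
    it.\<close>
  define m where "m = M1 * M + 1"
  have m: "m > 0" using M(1) rM1(2) by (simp add: m_def add_nonneg_pos)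
  have expand: "\<bar>t - t'\<bar> \<le> m * \<bar>h (\<gamma> t) - h (\<gamma> t')\<bar>" if t: "t \<in> ball x\<^sub>0 \<epsilon>" "t' \<in> ball x\<^sub>0 \<epsilon>" for t t'
  proof -
    note T = tJ[OF t(1)] and T' = tJ[OF t(2)]
    have "\<bar>t - t'\<bar> = \<bar>p (\<gamma> t) - p (\<gamma> t')\<bar>" using \<gamma>(3)[OF T(1)] \<gamma>(3)[OF T'(1)] by simp
    also have "\<dots> \<le> M1 * dist (\<gamma> t) (\<gamma> t')"
      using T(4) T'(4) by (intro rM1(3) \<gamma>(2) T(1) T'(1)) (auto simp: dist_commute)
    also have "\<dots> \<le> M1 * (M * \<bar>h (\<gamma> t) - h (\<gamma> t')\<bar>)"
      unfolding dist_real_def[symmetric]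
      by (rule mult_left_mono[OF M(3)[OF T(5) T'(5) T(3) T'(3)] rM1(2)])
    also have "\<dots> \<le> m * \<bar>h (\<gamma> t) - h (\<gamma> t')\<bar>" by (simp add: m_def distrib_right mult.assoc)
    finally show ?thesis .
  qed
  have val: "h (\<gamma> t) - h v\<^sub>0 \<in> distortion_values L (finite_subsystem L S' a\<^sub>1 a\<^sub>2)" if t: "t \<in> K" "t \<in> ball x\<^sub>0 \<epsilon>" for t
  proof -
    note T = tJ[OF t(2)]
    have \<gamma>t: "\<gamma> t \<in> W\<^sub>1" using \<gamma>(1) T(1) by blast
    obtain w where w: "w \<in> W\<^sub>2" "p w = t" using unstable_curve_over[OF W2(1) T(2)] by blast
    have pw: "p w = p (\<gamma> t)" using w(2) \<gamma>(3)[OF T(1)] by simp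
    note dd = distortion_difference[OF per W(1,2) W'(1,2) W'(3) z'(3) W1(1,3) W2(1,3) a0(1,2) W1(2) b0(1) cong(1) W2(2) b0(2) \<gamma>t w(1) pw]
    have "\<gamma> t \<in> finite_subsystem L S' a\<^sub>1 a\<^sub>2" using \<gamma>(2,3)[OF T(1)] t(1) by (intro mem) auto
    moreover have "(f ^^ l) b\<^sub>0 \<in> finite_subsystem L S' a\<^sub>1 a\<^sub>2" using w0X pw0 x0 by (intro mem) auto
    moreover have "h (\<gamma> t) - h v\<^sub>0 = distortion L (\<gamma> t) ((f ^^ l) b\<^sub>0)" unfolding h_def a0(3) dd(2) ..
    ultimately show ?thesis unfolding distortion_values_def using dd(1) by blast
  qed
  obtain c \<mu> where c: "0 < c" "0 < \<mu>" "\<mu> < 1" and P: "\<forall>n::nat. \<exists>P. finite P \<and> P \<subseteq> K \<inter> ball x\<^sub>0 \<epsilon> \<and> card P = 2 ^ n \<and>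
      (\<forall>x\<in>P. \<forall>y\<in>P. x \<noteq> y \<longrightarrow> c * \<mu> ^ n \<le> \<bar>x - y\<bar>)"
    using mp[OF spec[OF sep] \<epsilon>] by (elim exE conjE)
  show ?thesis
  proof (rule lower_box_dim_pos[of "c / m" \<mu>])
    show "0 < c / m" "0 < \<mu>" "\<mu> < 1" using c m by auto
    fix n :: nat
    obtain P where P: "finite P" "P \<subseteq> K \<inter> ball x\<^sub>0 \<epsilon>" "card P = 2 ^ n"
      "\<forall>x\<in>P. \<forall>y\<in>P. x \<noteq> y \<longrightarrow> c * \<mu> ^ n \<le> \<bar>x - y\<bar>" using spec[OF P, of n] by (elim exE conjE)
    define \<Phi> where "\<Phi> t = h (\<gamma> t) - h v\<^sub>0" for t
    have sp: "c / m * \<mu> ^ n \<le> dist (\<Phi> t) (\<Phi> t')" if t: "t \<in> P" "t' \<in> P" "t \<noteq> t'" for t t'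
    proof -
      have "c * \<mu> ^ n \<le> \<bar>t - t'\<bar>" using P(4) t by blast
      also have "\<dots> \<le> m * \<bar>h (\<gamma> t) - h (\<gamma> t')\<bar>" using t P(2) by (intro expand) auto
      finally show ?thesis using m by (simp add: \<Phi>_def dist_real_def pos_divide_le_eq mult.commute)
    qed
    have "inj_on \<Phi> P"
    proof (rule inj_onI, rule ccontr)
      fix t t' assume t: "t \<in> P" "t' \<in> P" "\<Phi> t = \<Phi> t'" "t \<noteq> t'"
      have "0 < c / m * \<mu> ^ n" using c m by simp
      then show False using sp[OF t(1,2,4)] t(3) by simp
    qed
    then have "card (\<Phi> ` P) = 2 ^ n" by (simp add: card_image P(3))
    moreover have "\<Phi> ` P \<subseteq> distortion_values L (finite_subsystem L S' a\<^sub>1 a\<^sub>2)"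
      unfolding \<Phi>_def using val P(2) by blast
    moreover have "\<forall>x\<in>\<Phi> ` P. \<forall>y\<in>\<Phi> ` P. x \<noteq> y \<longrightarrow> c / m * \<mu> ^ n \<le> dist x y"
    proof (intro ballI impI)
      fix x y assume xy: "x \<in> \<Phi> ` P" "y \<in> \<Phi> ` P" "x \<noteq> y"
      then obtain t t' where "t \<in> P" "x = \<Phi> t" "t' \<in> P" "y = \<Phi> t'" by blast
      then show "c / m * \<mu> ^ n \<le> dist x y" using sp[of t t'] xy(3) by blast
    qed
    ultimately show "\<exists>P. finite P \<and> P \<subseteq> distortion_values L (finite_subsystem L S' a\<^sub>1 a\<^sub>2) \<and> card P = 2 ^ n \<and>
        (\<forall>x\<in>P. \<forall>y\<in>P. x \<noteq> y \<longrightarrow> c / m * \<mu> ^ n \<le> dist x y)"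
      using P(1) by (intro exI[of _ "\<Phi> ` P"] conjI finite_imageI)
  qed
qed

end

theorem proposition3p8:
  fixes L :: lorenz and S\<^sub>0 S\<^sub>1 S S' :: scheme and y\<^sub>1 :: real and l :: nat
    and y y' :: "real^3" and V a\<^sub>1 a\<^sub>2 :: "(real^3) set"
  assumes setting: "lorenz_setting L"
    and schemes: "inducing_scheme L S\<^sub>0" "inducing_scheme L S\<^sub>1" "base S\<^sub>0 \<inter> base S\<^sub>1 = {}"
    and base0: "0 \<in> base S\<^sub>0"
    and base1: "((\<lambda>x. qmap L (qmap L x)) \<longlongrightarrow> y\<^sub>1) (at_right 0)" "y\<^sub>1 \<in> base S\<^sub>1"
    and S: "S \<in> {S\<^sub>0, S\<^sub>1}"
    and y: "\<exists>q. periodic_point L S q \<and> y \<in> unstable_manifold L (base S) q"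
      "l < itime S (proj L y)" "iterates_avoid (pmap L) (sing L) l y"
    and y': "\<exists>q. periodic_point L S q \<and> y' \<in> unstable_manifold L (base S) q"
      "l < itime S (proj L y')" "iterates_avoid (pmap L) (sing L) l y'"
    and nonzero: "shifted_distortion L l y y' \<noteq> 0"
    and V: "openin (top_of_set (shifted_manifold L (base S) l y)) V" "V \<noteq> {}"
      "C1_diffeo_onto_image (distortion_along L l y') V"
    and S': "inducing_scheme L S'" "saturate L (base S') \<subseteq> (\<Union>v\<in>V. ssleaf L v)"
    and a: "a\<^sub>1 \<in> part_leaves L S'" "a\<^sub>2 \<in> part_leaves L S'" "a\<^sub>1 \<noteq> a\<^sub>2"
  shows "lower_box_dim (distortion_values L (finite_subsystem L S' a\<^sub>1 a\<^sub>2)) > 0"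
proof -
  interpret lorenz_attractor L using setting by unfold_locales
  have "inducing_scheme L S" using S schemes by blast
  moreover obtain z where "periodic_point L S z" "y \<in> unstable_manifold L (base S) z" using y(1) by blast
  moreover obtain z' where "periodic_point L S z'" "y' \<in> unstable_manifold L (base S) z'" using y'(1) by blast
  ultimately show ?thesis using y'(3) V(1,3) S' a by (rule distortion_values_dim_pos)
qed

end
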